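(* Let $\delta$ be a $J\times J$ matrix with entries in $\mathbb{P}^d$, let $\Lambda\in G_\delta\cap\mathbb{M}_n^d$ and let $W\in\mathbb{M}_n$. There exists a function $\phi$ in the closed unit ball of $H^\infty(G_\delta)$ such that $\phi(\Lambda)=W$ if and only if both of the following hold: (i) $W\in\mathbb{M}_\Lambda$, so that there exists $p_0\in\mathbb{P}^d$ such that $p_0(\Lambda)=W$; (ii) $\sup\{\|p_0(x)\| : x\in V_\Lambda\cap G_\delta\}\le 1$.
   Context: $\mathbb{M}_n$ is the set of $n\times n$ complex matrices, $\mathbb{M}_n^d$ is the set of $d$-tuples $x=(x^1,\dots,x^d)$ of $n\times n$ complex matrices, and $\mathbb{M}^{[d]}=\bigcup_{n\ge1}\mathbb{M}_n^d$. $\mathbb{P}^d$ is the (unital) algebra of free polynomials, i.e. complex polynomials in $d$ non-commuting variables. Direct sums and similarities of $d$-tuples are taken coordinatewise. Norms of matrices are operator norms. For a $J\times J$ matrix $\delta$ with entries in $\mathbb{P}^d$ and $x\in\mathbb{M}_n^d$, $\delta(x)$ is regarded as an operator on $\mathbb{C}^n\otimes\mathbb{C}^J$, and $G_\delta=\{x\in\mathbb{M}^{[d]}:\|\delta(x)\|<1\}$; these sets are called basic free open sets, and they form a basis of the free topology on $\mathbb{M}^{[d]}$ (as $J$ and $\delta$ vary). A free open set is a set open in this topology. A graded function on a subset $D\subseteq\mathbb{M}^{[d]}$ is a function $\phi$ with $\phi(x)\in\mathbb{M}_n$ whenever $x\in D\cap\mathbb{M}_n^d$. An nc-function on $D$ is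 a graded function $\phi$ such that (a) if $x,y,x\oplus y\in D$ then $\phi(x\oplus y)=\phi(x)\oplus\phi(y)$; (b) if $s\in\mathbb{M}_n$ is invertible and $x,s^{-1}xs\in D\cap\mathbb{M}_n^d$ then $\phi(s^{-1}xs)=s^{-1}\phi(x)s$. A free holomorphic function on a free open set $U$ is a function $\phi$ on $U$ such that for every $x\in U$ there is a basic free open set $G_{\delta'}\subseteq U$ containing $x$ such that $\phi|_{G_{\delta'}}$ is a bounded nc-function. $H^\infty(U)$ is the space of bounded free holomorphic functions on $U$ with the supremum norm $\sup_{x\in U}\|\phi(x)\|$. For $\Lambda\in\mathbb{M}^{[d]}$: $\mathcal{I}_\Lambda=\{p\in\mathbb{P}^d: p(\Lambda)=0\}$, $V_\Lambda=\{x\in\mathbb{M}^{[d]}: p(x)=0 \text{ for all } p\in\mathcal{I}_\Lambda\}$ (matrices of all sizes allowed), and $\mathbb{M}_\Lambda=\{p(\Lambda):p\in\mathbb{P}^d\}$. (The value of $p_0(x)$ for $x\in V_\Lambda$ depends only on $p_0(\Lambda)$.) *)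

theory Defs
  imports
    "HOL-Analysis.Analysis"
    "HOL-Library.Poly_Mapping"
    "Jordan_Normal_Form.Matrix"
begin

text \<open>
  Words over \<^typ>\<open>'d\<close> form the free monoid under concatenation, written additively
  because \<^type>\<open>poly_mapping\<close> multiplies by convolution over an additive monoid. With this
  instance the type \<open>'d fpoly\<close> below carries exactly the product of the free algebra.
\<close>

instantiation list :: (type) monoid_add
begin

definition zero_list_def: "(0 :: 'a list) = []"
definition plus_list_def: "(xs :: 'a list) + ys = xs @ ys"

instance by standard (simp_all add: zero_list_def plus_list_def)

end

text \<open>
  The \<open>d\<close> non-commuting variables are indexed by a finite type \<^typ>\<open>'d\<close> with
  \<open>d = CARD('d)\<close> (so \<open>d \<ge> 1\<close>).
\<close>

type_synonym 'd fpoly = "'d list \<Rightarrow>\<^sub>0 complex"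
type_synonym 'd tuple = "'d \<Rightarrow> complex mat"

definition tuples :: "nat \<Rightarrow> 'd tuple set" where
  "tuples n = {x. \<forall>i. x i \<in> carrier_mat n n}"

definition all_tuples :: "'d tuple set" where
  "all_tuples = (\<Union>n\<in>{1..}. tuples n)"

definition tsize :: "'d tuple \<Rightarrow> nat" where
  "tsize x = (THE n. x \<in> tuples n)"

fun word_eval :: "'d list \<Rightarrow> 'd tuple \<Rightarrow> complex mat" where
  "word_eval [] x = 1\<^sub>m (tsize x)"
| "word_eval (i # w) x = x i * word_eval w x"

text \<open>
  The sum over the support is taken entrywise, since \<^typ>\<open>complex mat\<close> (matrices of all
  sizes) is not an additive monoid.
\<close>

definition peval :: "'d fpoly \<Rightarrow> 'd tuple \<Rightarrow> complex mat" where
  "peval p x = mat (tsize x) (tsize x)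
     (\<lambda>(a, b). \<Sum>w\<in>Poly_Mapping.keys p. Poly_Mapping.lookup p w * word_eval w x $$ (a, b))"

definition vnorm :: "complex vec \<Rightarrow> real" where
  "vnorm v = L2_set (\<lambda>i. cmod (v $ i)) {..<dim_vec v}"

definition mnorm :: "complex mat \<Rightarrow> real" where
  "mnorm A = Sup {vnorm (A *\<^sub>v v) | v. v \<in> carrier_vec (dim_col A) \<and> vnorm v \<le> 1}"

text \<open>
  The value of a \<open>J \<times> J\<close> matrix of free polynomials at a tuple of size \<open>n\<close>, as a matrix
  with respect to the lexicographically ordered basis of \<open>\<complex>\<^sup>n \<otimes> \<complex>\<^sup>J\<close>:
  the index \<open>a * J + i\<close> stands for \<open>e\<^sub>a \<otimes> f\<^sub>i\<close>.
\<close>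

definition pmat_eval :: "'d fpoly mat \<Rightarrow> 'd tuple \<Rightarrow> complex mat" where
  "pmat_eval \<delta> x = (let n = tsize x; J = dim_row \<delta> in
     mat (n * J) (n * J) (\<lambda>(r, s). peval (\<delta> $$ (r mod J, s mod J)) x $$ (r div J, s div J)))"

definition G :: "'d fpoly mat \<Rightarrow> 'd tuple set" where
  "G \<delta> = {x \<in> all_tuples. mnorm (pmat_eval \<delta> x) < 1}"

definition basic_free_open :: "'d tuple set \<Rightarrow> bool" where
  "basic_free_open U \<longleftrightarrow> (\<exists>J \<ge> 1. \<exists>\<delta> \<in> carrier_mat J J. U = G \<delta>)"

definition free_topology :: "'d tuple topology" where
  "free_topology = topology_generated_by (Collect basic_free_open)"

text \<open>
  Functions on a set of tuples are total functions whose values off that set are ignored.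
  The supremum is taken in \<^typ>\<open>ereal\<close>, so it is \<open>\<infinity>\<close> when the norms are unbounded.
\<close>

definition sup_norm :: "'d tuple set \<Rightarrow> ('d tuple \<Rightarrow> complex mat) \<Rightarrow> ereal" where
  "sup_norm D \<phi> = (SUP x\<in>D. ereal (mnorm (\<phi> x)))"

definition graded :: "'d tuple set \<Rightarrow> ('d tuple \<Rightarrow> complex mat) \<Rightarrow> bool" where
  "graded D \<phi> \<longleftrightarrow> (\<forall>n. \<forall>x \<in> D \<inter> tuples n. \<phi> x \<in> carrier_mat n n)"

definition dsum :: "'d tuple \<Rightarrow> 'd tuple \<Rightarrow> 'd tuple" where
  "dsum x y = (\<lambda>i. diag_block_mat [x i, y i])"

definition nc_function :: "'d tuple set \<Rightarrow> ('d tuple \<Rightarrow> complex mat) \<Rightarrow> bool" where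
  "nc_function D \<phi> \<longleftrightarrow> graded D \<phi> \<and>
     (\<forall>x y. x \<in> D \<and> y \<in> D \<and> dsum x y \<in> D \<longrightarrow> \<phi> (dsum x y) = diag_block_mat [\<phi> x, \<phi> y]) \<and>
     (\<forall>n. \<forall>s \<in> carrier_mat n n. \<forall>s' \<in> carrier_mat n n. \<forall>x.
        inverts_mat s s' \<and> inverts_mat s' s \<and>
        x \<in> D \<inter> tuples n \<and> (\<lambda>i. s' * x i * s) \<in> D \<inter> tuples n \<longrightarrow>
        \<phi> (\<lambda>i. s' * x i * s) = s' * \<phi> x * s)"

definition free_holomorphic :: "'d tuple set \<Rightarrow> ('d tuple \<Rightarrow> complex mat) \<Rightarrow> bool" where
  "free_holomorphic U \<phi> \<longleftrightarrow> openin free_topology U \<and>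
     (\<forall>x \<in> U. \<exists>B. basic_free_open B \<and> x \<in> B \<and> B \<subseteq> U \<and> nc_function B \<phi> \<and> sup_norm B \<phi> < \<infinity>)"

definition Hinf :: "'d tuple set \<Rightarrow> ('d tuple \<Rightarrow> complex mat) set" where
  "Hinf U = {\<phi>. free_holomorphic U \<phi> \<and> sup_norm U \<phi> < \<infinity>}"

definition I_ideal :: "'d tuple \<Rightarrow> 'd fpoly set" where
  "I_ideal \<Lambda> = {p. peval p \<Lambda> = 0\<^sub>m (tsize \<Lambda>) (tsize \<Lambda>)}"

definition V_var :: "'d tuple \<Rightarrow> 'd tuple set" where
  "V_var \<Lambda> = {x \<in> all_tuples. \<forall>p \<in> I_ideal \<Lambda>. peval p x = 0\<^sub>m (tsize x) (tsize x)}"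

definition M_alg :: "'d tuple \<Rightarrow> complex mat set" where
  "M_alg \<Lambda> = range (\<lambda>p. peval p \<Lambda>)"

lemma peval_minus: "peval (p - q) x = peval p x - peval q x"
proof -
  define K where "K = Poly_Mapping.keys p \<union> Poly_Mapping.keys q"
  have ext: "peval r x = mat (tsize x) (tsize x)
       (\<lambda>(a, b). \<Sum>w\<in>K. Poly_Mapping.lookup r w * word_eval w x $$ (a, b))"
    if "Poly_Mapping.keys r \<subseteq> K" for r
    unfolding peval_def using that
    by (intro cong_mat refl)
      (auto simp: K_def in_keys_iff intro!: sum.mono_neutral_left)
  have "Poly_Mapping.keys (p - q) \<subseteq> K"
    by (auto simp: K_def in_keys_iff lookup_minus)
  moreover have "Poly_Mapping.keys p \<subseteq> K" "Poly_Mapping.keys q \<subseteq> K"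
    by (auto simp: K_def)
  ultimately show ?thesis
    by (intro eq_matI) (auto simp: ext lookup_minus left_diff_distrib sum_subtractf)
qed

text \<open>On \<open>V_var \<Lambda>\<close> the value of a free polynomial depends only on its value at \<open>\<Lambda>\<close>.\<close>

lemma peval_eq_on_V_var:
  assumes "peval p \<Lambda> = peval q \<Lambda>" and "x \<in> V_var \<Lambda>"
  shows "peval p x = peval q x"
proof -
  have dim: "dim_row (peval r y) = tsize y" "dim_col (peval r y) = tsize y" for r y
    by (simp_all add: peval_def)
  have "p - q \<in> I_ideal \<Lambda>"
    using assms(1) by (auto simp: I_ideal_def peval_minus dim intro!: eq_matI)
  then have z: "peval p x - peval q x = 0\<^sub>m (tsize x) (tsize x)"
    using assms(2) by (auto simp: V_var_def peval_minus)
  show ?thesis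
  proof (rule eq_matI)
    fix i j assume "i < dim_row (peval q x)" "j < dim_col (peval q x)"
    then show "peval p x $$ (i, j) = peval q x $$ (i, j)"
      using arg_cong[OF z, of "\<lambda>A. A $$ (i, j)"] by (simp add: dim)
  qed (simp_all add: dim)
qed

end

theory Submission
  imports Defs "Jordan_Normal_Form.Determinant"
begin

text \<open>
The proof works with the single point \<open>\<Lambda>\<close> and with finite-dimensional spaces throughout. Its main
tool is that everything in sight respects intertwiners: if \<open>x\<^sup>i S = S y\<^sup>i\<close> for every \<open>i\<close>, then
\<open>p(x) S = S p(y)\<close> for a free polynomial \<open>p\<close> (\<open>peval_intertwine\<close>), and the same is true of an
nc-function on a basic free open set (\<open>nc_function_intertwine\<close>).

Necessity. Given \<open>x \<in> V\<^sub>\<Lambda> \<inter> G\<^sub>\<delta>\<close>, the point \<open>\<Lambda> \<oplus> x\<close> lies in \<open>G\<^sub>\<delta>\<close>, so \<open>\<phi>\<close> is an nc-function on some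
basic set \<open>B\<close> around it; \<open>B\<close> also contains \<open>\<Lambda>\<close> and \<open>x\<close>, because a basic set contains a direct sum
exactly if it contains both summands. An nc-function on a basic set leaves the invariant subspaces
of its argument invariant. Applied to the ampliation \<open>z \<otimes> 1\<close> and its cyclic subspace generated by
\<open>\<Sum>\<^sub>a e\<^sub>a \<otimes> e\<^sub>a\<close> this says that \<open>\<phi>(z)\<close> is a polynomial in \<open>z\<close> (\<open>nc_function_in_algebra\<close>). With
\<open>z = \<Lambda> \<oplus> x\<close> one polynomial \<open>p\<close> satisfies \<open>\<phi>(\<Lambda>) = p(\<Lambda>)\<close> and \<open>\<phi>(x) = p(x)\<close>; both conditions follow.

Sufficiency. It is enough to find finitely many families \<open>u = (u\<^sub>1, \<dots>, u\<^sub>J)\<close> of \<open>n \<times> n\<close> matrices with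
  \<open>1 \<otimes> 1\<^sup>* - W \<otimes> W\<^sup>* = \<Sum>\<^sub>u \<Sum>\<^sub>j (u\<^sub>j \<otimes> u\<^sub>j\<^sup>* - (\<delta>(\<Lambda>) u)\<^sub>j \<otimes> (\<delta>(\<Lambda>) u)\<^sub>j\<^sup>*)\<close>,
where \<open>v \<otimes> v\<^sup>*\<close> is the form with the entries \<open>v\<^sub>\<alpha>\<close> times the conjugate of \<open>v\<^sub>\<beta>\<close>.
Indeed, moving the negative terms to the other side makes this an equality of two Gram matrices,
hence there is a contraction taking the vectors \<open>(1, \<delta>(\<Lambda>) u)\<close> to \<open>(W, u)\<close> (\<open>lurking_contraction\<close>),
and its blocks define a transfer function \<open>\<phi>(x) = A + C \<delta>(x) (1 - D \<delta>(x))\<^sup>-\<^sup>1 B\<close>, with \<open>\<delta>(x)\<close> acting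
diagonally on the families. This \<open>\<phi>\<close> is an nc-function bounded by one on \<open>G\<^sub>\<delta>\<close>, and \<open>\<phi>(\<Lambda>) = W\<close>
(\<open>interpolant_of_gram\<close>).

The right-hand sides form a closed convex cone. If the left-hand side is not in it, then a linear
functional separates the two (\<open>cone_dichotomy\<close>). Such a functional is a sesquilinear form \<open>L\<close> on the
\<open>n \<times> n\<close> matrices for which multiplication by \<open>\<delta>(\<Lambda>)\<close> is contractive while
\<open>L(W, W) > L(1, 1)\<close>. Because \<open>\<delta>(\<Lambda>)\<close> is a strict contraction, \<open>L\<close> is positive semidefinite
(\<open>form_nonneg\<close>), and adding a small multiple of the Hilbert-Schmidt form makes \<open>L\<close> positive definite
and the action of \<open>\<delta>(\<Lambda>)\<close> strictly contractive. Left multiplication by \<open>\<Lambda>\<^sup>i\<close> on the Hilbert space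
obtained from the \<open>n \<times> n\<close> matrices in this way is a tuple \<open>x\<close> in \<open>V\<^sub>\<Lambda> \<inter> G\<^sub>\<delta>\<close>, being similar to an
ampliation of \<open>\<Lambda>\<close>. Now \<open>p\<^sub>0(x)\<close> takes the vector \<open>1\<close> to \<open>p\<^sub>0(\<Lambda>) = W\<close>, so \<open>\<parallel>p\<^sub>0(x)\<parallel> \<le> 1\<close> contradicts
the choice of the functional (\<open>form_monotone\<close>).
\<close>

no_notation Finite_Cartesian_Product.vec_nth (infixl "$" 90)

section \<open>Inner products, orthonormal families and the lurking isometry\<close>

definition ip :: "'i set \<Rightarrow> ('i \<Rightarrow> complex) \<Rightarrow> ('i \<Rightarrow> complex) \<Rightarrow> complex" where
  "ip I f g = (\<Sum>i\<in>I. f i * cnj (g i))"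

definition nsq :: "'i set \<Rightarrow> ('i \<Rightarrow> complex) \<Rightarrow> real" where
  "nsq I f = (\<Sum>i\<in>I. (cmod (f i))\<^sup>2)"

lemma nsq_nonneg: "0 \<le> nsq I f"
  by (simp add: nsq_def sum_nonneg)

lemma nsq_eq_0: "finite I \<Longrightarrow> nsq I f = 0 \<longleftrightarrow> (\<forall>i\<in>I. f i = 0)"
  by (simp add: nsq_def sum_nonneg_eq_0_iff)

lemma nsq_cong: "(\<And>i. i \<in> I \<Longrightarrow> f i = g i) \<Longrightarrow> nsq I f = nsq I g"
  by (simp add: nsq_def)

lemma nsq_scale: "nsq I (\<lambda>i. c * f i) = (cmod c)\<^sup>2 * nsq I f"
  by (simp add: nsq_def norm_mult power_mult_distrib sum_distrib_left)

lemma ip_self: "ip I f f = of_real (nsq I f)"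
  by (simp add: ip_def nsq_def complex_norm_square[symmetric])

lemma ip_commute: "ip I g f = cnj (ip I f g)"
  by (simp add: ip_def mult.commute)

lemma ip_sum_left: "ip I (\<lambda>i. \<Sum>k\<in>K. c k * f k i) g = (\<Sum>k\<in>K. c k * ip I (f k) g)"
  unfolding ip_def sum_distrib_right sum_distrib_left by (subst sum.swap) (simp add: mult.assoc)

lemma ip_sum_right: "ip I g (\<lambda>i. \<Sum>k\<in>K. c k * f k i) = (\<Sum>k\<in>K. cnj (c k) * ip I g (f k))"
  unfolding ip_def cnj_sum sum_distrib_right sum_distrib_left by (subst sum.swap) (simp add: ac_simps)

lemma ip_diff_left: "ip I (\<lambda>i. f i - f' i) g = ip I f g - ip I f' g"
  by (simp add: ip_def left_diff_distrib sum_subtractf)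

lemma ip_diff_right: "ip I g (\<lambda>i. f i - f' i) = ip I g f - ip I g f'"
  by (simp add: ip_def right_diff_distrib sum_subtractf)

lemma ip_scale_left: "ip I (\<lambda>i. c * f i) g = c * ip I f g"
  by (simp add: ip_def sum_distrib_left mult.assoc)

lemma nsq_mult_le:
  assumes "finite S" "x \<in> S" "y \<in> S"
  shows "cmod (w x) * cmod (w y) \<le> nsq S w"
proof -
  have le: "(cmod (w r))\<^sup>2 \<le> nsq S w" if "r \<in> S" for r
    unfolding nsq_def using that assms(1) by (intro member_le_sum) auto
  have "0 \<le> (cmod (w x) - cmod (w y))\<^sup>2" by simp
  then have "2 * (cmod (w x) * cmod (w y)) \<le> (cmod (w x))\<^sup>2 + (cmod (w y))\<^sup>2"
    by (simp add: power2_diff)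
  then show ?thesis
    using le[OF assms(2)] le[OF assms(3)] by linarith
qed

definition orthonormal :: "'i set \<Rightarrow> nat \<Rightarrow> (nat \<Rightarrow> 'i \<Rightarrow> complex) \<Rightarrow> bool" where
  "orthonormal I k q \<longleftrightarrow> (\<forall>j<k. \<forall>l<k. ip I (q j) (q l) = (if j = l then 1 else 0))"

lemma nsq_orthonormal_sum:
  assumes "orthonormal I k q"
  shows "nsq I (\<lambda>i. \<Sum>j<k. c j * q j i) = (\<Sum>j<k. (cmod (c j))\<^sup>2)"
proof -
  have "complex_of_real (nsq I (\<lambda>i. \<Sum>j<k. c j * q j i))
      = (\<Sum>j<k. c j * (\<Sum>l<k. cnj (c l) * ip I (q j) (q l)))"
    by (simp add: ip_self[symmetric] ip_sum_left ip_sum_right)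
  also have "\<dots> = (\<Sum>j<k. c j * (\<Sum>l<k. if j = l then cnj (c l) else 0))"
    using assms by (intro sum.cong refl arg_cong2[where f = "(*)"]) (auto simp: orthonormal_def)
  also have "\<dots> = of_real (\<Sum>j<k. (cmod (c j))\<^sup>2)"
    by (simp add: complex_norm_square[symmetric])
  finally show ?thesis
    using of_real_eq_iff by blast
qed

lemma nsq_residual:
  assumes "orthonormal I k q"
  shows "nsq I (\<lambda>i. f i - (\<Sum>j<k. ip I f (q j) * q j i)) = nsq I f - (\<Sum>j<k. (cmod (ip I f (q j)))\<^sup>2)"
proof -
  let ?p = "\<lambda>i. \<Sum>j<k. ip I f (q j) * q j i"
  have 1: "ip I ?p f = (\<Sum>j<k. of_real ((cmod (ip I f (q j)))\<^sup>2))"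
    unfolding ip_sum_left complex_norm_square by (simp add: ip_commute[of I _ f])
  have 2: "ip I f ?p = (\<Sum>j<k. of_real ((cmod (ip I f (q j)))\<^sup>2))"
    unfolding ip_sum_right complex_norm_square by (simp add: mult.commute)
  have 3: "ip I ?p ?p = (\<Sum>j<k. of_real ((cmod (ip I f (q j)))\<^sup>2))"
    unfolding ip_self nsq_orthonormal_sum[OF assms] by simp
  have "complex_of_real (nsq I (\<lambda>i. f i - ?p i)) = of_real (nsq I f - (\<Sum>j<k. (cmod (ip I f (q j)))\<^sup>2))"
    unfolding ip_self[symmetric] ip_diff_left ip_diff_right 1 2 3 by (simp add: ip_self)
  then show ?thesis
    using of_real_eq_iff by blast
qed

lemma bessel:
  assumes "orthonormal I k q"
  shows "(\<Sum>j<k. (cmod (ip I f (q j)))\<^sup>2) \<le> nsq I f"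
  using nsq_residual[OF assms, of f] nsq_nonneg[of I "\<lambda>i. f i - (\<Sum>j<k. ip I f (q j) * q j i)"] by simp

text \<open>
Count \<open>\<Sum>\<^sub>j \<Sum>\<^sub>i \<bar>q\<^sub>j i\<bar>\<^sup>2\<close> in two ways: every \<open>q\<^sub>j\<close> contributes one, and Bessel's inequality for the
standard basis vector at \<open>i\<close> bounds the contribution of \<open>i\<close> by one.
\<close>

lemma orthonormal_card:
  assumes "finite I" "orthonormal I k q"
  shows "k \<le> card I"
proof -
  have row: "(\<Sum>j<k. (cmod (q j i))\<^sup>2) \<le> 1" if "i \<in> I" for i
  proof -
    let ?e = "\<lambda>i'. if i' = i then 1 else 0 :: complex"
    have "ip I ?e (q j) = (\<Sum>i'\<in>I. if i' = i then cnj (q j i') else 0)" for j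
      unfolding ip_def by (intro sum.cong) auto
    then have "ip I ?e (q j) = cnj (q j i)" for j
      using that assms(1) by simp
    moreover have "nsq I ?e = (\<Sum>i'\<in>I. if i' = i then 1 else 0)"
      unfolding nsq_def by (intro sum.cong) auto
    then have "nsq I ?e = 1"
      using that assms(1) by simp
    ultimately show ?thesis
      using bessel[OF assms(2), of ?e] by simp
  qed
  have one: "nsq I (q j) = 1" if "j < k" for j
  proof -
    have "complex_of_real (nsq I (q j)) = 1"
      using assms(2) that by (simp add: ip_self[symmetric] orthonormal_def)
    then show ?thesis by simp
  qed
  have "real k = (\<Sum>j<k. nsq I (q j))"
    using one by simp
  also have "\<dots> = (\<Sum>i\<in>I. \<Sum>j<k. (cmod (q j i))\<^sup>2)"
    unfolding nsq_def by (rule sum.swap)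
  also have "\<dots> \<le> (\<Sum>i\<in>I. 1)"
    by (intro sum_mono row)
  finally show ?thesis by simp
qed

text \<open>
Subspaces of \<open>\<complex>\<^sup>I\<close> are given as sets of functions closed under the two operations. An orthonormal
family of maximal length inside \<open>M\<close> works: it exists because lengths are bounded by \<open>card I\<close>, and a
vector with a nonzero residual would extend the family by the normalised residual.
\<close>

lemma subspace_orthonormal_basis:
  fixes M :: "('i \<Rightarrow> complex) set"
  assumes fin: "finite I" and zero: "(\<lambda>i. 0) \<in> M"
    and add: "\<And>f g. f \<in> M \<Longrightarrow> g \<in> M \<Longrightarrow> (\<lambda>i. f i + g i) \<in> M"
    and scale: "\<And>c f. f \<in> M \<Longrightarrow> (\<lambda>i. c * f i) \<in> M"
  obtains k q where "orthonormal I k q" "\<And>j. j < k \<Longrightarrow> q j \<in> M"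
    "\<And>f i. f \<in> M \<Longrightarrow> i \<in> I \<Longrightarrow> f i = (\<Sum>j<k. ip I f (q j) * q j i)"
proof -
  define P where "P k \<longleftrightarrow> (\<exists>q. orthonormal I k q \<and> (\<forall>j<k. q j \<in> M))" for k
  have "P 0"
    by (simp add: P_def orthonormal_def)
  moreover have "\<forall>k. P k \<longrightarrow> k \<le> card I"
    using orthonormal_card[OF fin] by (auto simp: P_def)
  ultimately obtain k where k: "P k" and maxi: "\<And>l. P l \<Longrightarrow> l \<le> k"
    using GreatestI_nat[of P 0 "card I"] Greatest_le_nat[of P _ "card I"] by blast
  obtain q where q: "orthonormal I k q" and qM: "\<And>j. j < k \<Longrightarrow> q j \<in> M"
    using k by (auto simp: P_def)
  have "f i = (\<Sum>j<k. ip I f (q j) * q j i)" if f: "f \<in> M" and i: "i \<in> I" for f i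
  proof (rule ccontr)
    assume ne: "f i \<noteq> (\<Sum>j<k. ip I f (q j) * q j i)"
    define r where "r i = f i - (\<Sum>j<k. ip I f (q j) * q j i)" for i
    have part: "l \<le> k \<Longrightarrow> (\<lambda>i. \<Sum>j<l. ip I f (q j) * q j i) \<in> M" for l
      by (induct l) (auto intro!: zero add scale qM)
    have rM: "r \<in> M"
      using add[OF f scale[OF part[OF order_refl], of "-1"]] by (simp add: r_def[abs_def])
    have "nsq I r \<noteq> 0"
      using ne i by (auto simp: nsq_eq_0[OF fin] r_def)
    then have pos: "nsq I r > 0"
      using nsq_nonneg[of I r] by linarith
    define s where "s = complex_of_real (1 / sqrt (nsq I r))"
    have orth: "ip I r (q l) = 0" if "l < k" for l
    proof -
      have "ip I r (q l) = ip I f (q l) - (\<Sum>j<k. ip I f (q j) * ip I (q j) (q l))"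
        unfolding r_def[abs_def] ip_diff_left ip_sum_left ..
      also have "(\<Sum>j<k. ip I f (q j) * ip I (q j) (q l)) = (\<Sum>j<k. if j = l then ip I f (q j) else 0)"
        using q that by (intro sum.cong refl) (auto simp: orthonormal_def)
      finally show ?thesis using that by simp
    qed
    define q' where "q' j = (if j = k then (\<lambda>i. s * r i) else q j)" for j
    have "ip I (q' k) (q' k) = 1"
      unfolding ip_self q'_def if_P[OF refl] nsq_scale using pos
      by (simp add: s_def norm_divide power_divide)
    moreover have "ip I (q' k) (q' l) = 0" "ip I (q' l) (q' k) = 0" if "l < k" for l
    proof -
      show *: "ip I (q' k) (q' l) = 0"
        using that orth by (simp add: q'_def ip_scale_left)
      show "ip I (q' l) (q' k) = 0"
        using * by (subst ip_commute) simp
    qed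
    moreover have "ip I (q' j) (q' l) = (if j = l then 1 else 0)" if "j < k" "l < k" for j l
      using q that by (auto simp: q'_def orthonormal_def)
    ultimately have "orthonormal I (Suc k) q'"
      unfolding orthonormal_def less_Suc_eq by fastforce
    moreover have "\<forall>j<Suc k. q' j \<in> M"
      using qM rM scale by (auto simp: q'_def less_Suc_eq)
    ultimately have "P (Suc k)"
      unfolding P_def by blast
    then show False
      using maxi by fastforce
  qed
  with that q qM show ?thesis by blast
qed

text \<open>
The lurking isometry argument. Equal Gram matrices mean that the assignment \<open>X\<^sub>r \<mapsto> Y\<^sub>r\<close> extends to an
isometry from the span of the \<open>X\<^sub>r\<close> to the span of the \<open>Y\<^sub>r\<close>; composed with the orthogonal projection
onto the first span it becomes a contraction \<open>V\<close> on the whole space.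
\<close>

lemma lurking_contraction:
  fixes X Y :: "'r \<Rightarrow> 'i \<Rightarrow> complex"
  assumes fin: "finite R" "finite I"
    and gram: "\<And>r r'. r \<in> R \<Longrightarrow> r' \<in> R \<Longrightarrow> ip I (X r) (X r') = ip I (Y r) (Y r')"
  obtains V where "\<And>r t. r \<in> R \<Longrightarrow> t \<in> I \<Longrightarrow> Y r t = (\<Sum>s\<in>I. V t s * X r s)"
    "\<And>\<beta>. nsq I (\<lambda>t. \<Sum>s\<in>I. V t s * \<beta> s) \<le> nsq I \<beta>"
proof -
  define LX where "LX c = (\<lambda>i. \<Sum>r\<in>R. c r * X r i)" for c
  define LY where "LY c = (\<lambda>i. \<Sum>r\<in>R. c r * Y r i)" for c
  have gramL: "ip I (LX c) (LX d) = ip I (LY c) (LY d)" for c d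
    unfolding LX_def LY_def ip_sum_left ip_sum_right
    by (intro sum.cong refl arg_cong2[where f = "(*)"] gram)
  have comb: "(\<lambda>i. \<Sum>j<k. b j * L (c j) i) = L (\<lambda>r. \<Sum>j<k. b j * c j r)"
    if "L = LX \<or> L = LY" for L b c and k :: nat
    using that unfolding LX_def LY_def
    by (elim disjE; simp only: sum_distrib_left sum_distrib_right, subst sum.swap, simp add: mult.assoc)
  obtain k q where q: "orthonormal I k q" and qM: "\<And>j. j < k \<Longrightarrow> q j \<in> range LX"
    and rep: "\<And>f i. f \<in> range LX \<Longrightarrow> i \<in> I \<Longrightarrow> f i = (\<Sum>j<k. ip I f (q j) * q j i)"
  proof (rule subspace_orthonormal_basis[OF fin(2), of "range LX"])
    show "(\<lambda>i. 0) \<in> range LX"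
      by (rule image_eqI[of _ _ "\<lambda>r. 0"]) (simp_all add: LX_def)
    show "(\<lambda>i. f i + g i) \<in> range LX" if fg: "f \<in> range LX" "g \<in> range LX" for f g
    proof -
      obtain c d where "f = LX c" "g = LX d" using fg by auto
      then show ?thesis
        by (intro image_eqI[of _ _ "\<lambda>r. c r + d r"]) (simp_all add: LX_def ring_distribs sum.distrib)
    qed
    show "(\<lambda>i. a * f i) \<in> range LX" if f: "f \<in> range LX" for a f
    proof -
      obtain c where "f = LX c" using f by auto
      then show ?thesis
        by (intro image_eqI[of _ _ "\<lambda>r. a * c r"]) (simp_all add: LX_def sum_distrib_left mult.assoc)
    qed
  qed blast
  have "\<forall>j. \<exists>c. j < k \<longrightarrow> q j = LX c"
    using qM by blast
  then obtain c where c: "\<And>j. j < k \<Longrightarrow> q j = LX (c j)"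
    by metis
  (* the images of the orthonormal basis; they are orthonormal again since the Gram matrices agree *)
  define y where "y j = LY (c j)" for j
  have y: "orthonormal I k y"
    using q by (auto simp: orthonormal_def y_def c gramL)
  define V where "V t s = (\<Sum>j<k. y j t * cnj (q j s))" for t s
  have V: "(\<Sum>s\<in>I. V t s * \<beta> s) = (\<Sum>j<k. ip I \<beta> (q j) * y j t)" for t \<beta>
    unfolding V_def ip_def sum_distrib_right by (subst sum.swap) (simp add: ac_simps)
  show ?thesis
  proof (rule that)
    fix r t assume r: "r \<in> R" and t: "t \<in> I"
    define e where "e = (\<lambda>r'. if r' = r then 1 else 0 :: complex)"
    have e: "(\<Sum>r'\<in>R. e r' * Z r' i) = Z r i" for Z :: "'r \<Rightarrow> 'i \<Rightarrow> complex" and i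
    proof -
      have "(\<Sum>r'\<in>R. e r' * Z r' i) = (\<Sum>r'\<in>R. if r' = r then Z r' i else 0)"
        unfolding e_def by (intro sum.cong) auto
      then show ?thesis using r fin(1) by simp
    qed
    (* coefficients of the residual of X r in the basis q; the same coefficients give Y r - V (X r) *)
    define d where "d r' = e r' - (\<Sum>j<k. ip I (X r) (q j) * c j r')" for r'
    have ex: "LX e = X r" "LY e = Y r"
      by (simp_all add: LX_def LY_def e)
    have diff: "LX d = (\<lambda>i. LX e i - LX (\<lambda>r'. \<Sum>j<k. ip I (X r) (q j) * c j r') i)"
      "LY d = (\<lambda>i. LY e i - LY (\<lambda>r'. \<Sum>j<k. ip I (X r) (q j) * c j r') i)"
      by (simp_all add: LX_def LY_def d_def[abs_def] left_diff_distrib sum_subtractf)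
    have "LX d i = 0" if "i \<in> I" for i
    proof -
      have "X r i = (\<Sum>j<k. ip I (X r) (q j) * q j i)"
        using rep[of "X r" i] that ex(1) by (metis rangeI)
      then show ?thesis
        unfolding diff comb[OF disjI1[OF refl], symmetric] ex using c by simp
    qed
    then have "ip I (LX d) (LX d) = 0"
      by (simp add: ip_def)
    then have "nsq I (LY d) = 0"
      using gramL[of d d] by (simp add: ip_self)
    then have "LY d t = 0"
      using t nsq_eq_0[OF fin(2)] by blast
    then show "Y r t = (\<Sum>s\<in>I. V t s * X r s)"
      unfolding diff comb[OF disjI2[OF refl], symmetric] ex V by (simp add: y_def)
  next
    fix \<beta>
    show "nsq I (\<lambda>t. \<Sum>s\<in>I. V t s * \<beta> s) \<le> nsq I \<beta>"
      unfolding V nsq_orthonormal_sum[OF y] by (rule bessel[OF q])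
  qed
qed

section \<open>Positive semidefinite forms, cone duality and linear systems\<close>

definition qform :: "'i set \<Rightarrow> ('i \<times> 'i \<Rightarrow> complex) \<Rightarrow> ('i \<Rightarrow> complex) \<Rightarrow> complex" where
  "qform I \<Gamma> c = (\<Sum>i\<in>I. \<Sum>j\<in>I. c i * \<Gamma> (i, j) * cnj (c j))"

definition psd :: "'i set \<Rightarrow> ('i \<times> 'i \<Rightarrow> complex) \<Rightarrow> bool" where
  "psd I \<Gamma> \<longleftrightarrow> (\<forall>i\<in>I. \<forall>j\<in>I. \<Gamma> (j, i) = cnj (\<Gamma> (i, j))) \<and> (\<forall>c. 0 \<le> Re (qform I \<Gamma> c))"

lemma qform_cong:
  assumes "\<And>i. i \<in> I \<Longrightarrow> c i = d i" "\<And>i j. i \<in> I \<Longrightarrow> j \<in> I \<Longrightarrow> \<Gamma> (i, j) = \<Delta> (i, j)"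
  shows "qform I \<Gamma> c = qform I \<Delta> d"
  unfolding qform_def using assms by (intro sum.cong refl) auto

lemma qform_insert:
  assumes "finite I" "p \<notin> I"
  shows "qform (insert p I) \<Gamma> c = c p * \<Gamma> (p, p) * cnj (c p)
    + c p * (\<Sum>j\<in>I. \<Gamma> (p, j) * cnj (c j)) + (\<Sum>i\<in>I. c i * \<Gamma> (i, p)) * cnj (c p) + qform I \<Gamma> c"
  using assms by (simp add: qform_def sum.distrib sum_distrib_left sum_distrib_right algebra_simps)

lemma psd_subset:
  assumes "psd (insert p I) \<Gamma>" "finite I" "p \<notin> I"
  shows "psd I \<Gamma>"
proof -
  have "0 \<le> Re (qform I \<Gamma> c)" for c
  proof -
    have "qform (insert p I) \<Gamma> (c(p := 0)) = qform I \<Gamma> (c(p := 0))"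
      unfolding qform_insert[OF assms(2,3)] by simp
    also have "\<dots> = qform I \<Gamma> c"
      using assms(3) by (intro qform_cong) auto
    finally show ?thesis
      using assms(1) unfolding psd_def by metis
  qed
  then show ?thesis
    using assms(1) unfolding psd_def by blast
qed

lemma le_of_perturbed_le:
  fixes a b c d :: real
  assumes le: "\<And>\<epsilon>. 0 < \<epsilon> \<Longrightarrow> a + \<epsilon> * c \<le> b + \<epsilon> * d"
  shows "a \<le> b"
proof (rule field_le_epsilon)
  fix e :: real assume e: "0 < e"
  define \<epsilon> where "\<epsilon> = e / (\<bar>d - c\<bar> + 1)"
  have "\<epsilon> > 0" using e by (simp add: \<epsilon>_def add_nonneg_pos)
  have "\<epsilon> * (d - c) \<le> \<epsilon> * (\<bar>d - c\<bar> + 1)"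
    using \<open>\<epsilon> > 0\<close> by (intro mult_left_mono) auto
  also have "\<dots> = e" by (simp add: \<epsilon>_def)
  finally show "a \<le> b + e"
    using le[OF \<open>\<epsilon> > 0\<close>] by (simp add: algebra_simps)
qed

text \<open>
First-order condition at a minimum: \<open>2 r\<close> is the one-sided derivative at \<open>0\<close> of the quadratic.
\<close>

lemma nonneg_of_quadratic:
  fixes r m :: real
  assumes m: "0 \<le> m" and q: "\<And>t. 0 < t \<Longrightarrow> t \<le> 1 \<Longrightarrow> 0 \<le> 2 * t * r + t\<^sup>2 * m"
  shows "0 \<le> r"
proof (rule ccontr)
  assume "\<not> 0 \<le> r"
  define t where "t = min 1 (- r / (m + 1))"
  have t: "0 < t" "t \<le> 1"
    using \<open>\<not> 0 \<le> r\<close> m by (auto simp: t_def divide_simps)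
  have "t * m \<le> - r / (m + 1) * m"
    using m by (intro mult_right_mono) (auto simp: t_def)
  also have "\<dots> \<le> - r"
    using \<open>\<not> 0 \<le> r\<close> m by (simp add: divide_simps)
  finally have "2 * r + t * m < 0"
    using \<open>\<not> 0 \<le> r\<close> by linarith
  then have "t * (2 * r + t * m) < 0"
    using t by (simp add: mult_pos_neg)
  then show False
    using q[OF t] by (simp add: algebra_simps power2_eq_square)
qed

text \<open>
Cholesky factorisation, by induction on the index set. If the diagonal entry at the new index \<open>p\<close> is
zero, positivity forces its whole row to vanish; otherwise subtracting the rank-one form through \<open>p\<close>
leaves the Schur complement, which is again positive semidefinite. The last of the vectors \<open>v\<^sub>k\<close>
records the row of \<open>p\<close>.
\<close>

lemma psd_gram:
  assumes "finite I" "psd I \<Gamma>"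
  shows "\<exists>v. \<forall>i\<in>I. \<forall>j\<in>I. \<Gamma> (i, j) = (\<Sum>k<card I. v k i * cnj (v k j))"
  using assms
proof (induction I arbitrary: \<Gamma> rule: finite_induct)
  case empty
  then show ?case by simp
next
  case (insert p I)
  note fin = insert.hyps(1) and p = insert.hyps(2)
  have herm: "\<Gamma> (j, i) = cnj (\<Gamma> (i, j))" if "i \<in> insert p I" "j \<in> insert p I" for i j
    using insert.prems that unfolding psd_def by blast
  have pos: "0 \<le> Re (qform (insert p I) \<Gamma> c)" for c
    using insert.prems unfolding psd_def by blast
  define z where "z c = (\<Sum>i\<in>I. c i * \<Gamma> (i, p))" for c
  have cz: "(\<Sum>j\<in>I. \<Gamma> (p, j) * cnj (c j)) = cnj (z c)" for c
    unfolding z_def cnj_sum by (intro sum.cong refl) (simp add: herm[of _ p] mult.commute)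
  define g where "g = Re (\<Gamma> (p, p))"
  have g: "\<Gamma> (p, p) = of_real g"
    using herm[of p p] by (simp add: g_def complex_eq_iff)
  have val: "Re (qform (insert p I) \<Gamma> c) = (cmod (c p))\<^sup>2 * g + 2 * Re (z c * cnj (c p)) + Re (qform I \<Gamma> c)" for c
  proof -
    have e: "c p * of_real g * cnj (c p) = of_real ((cmod (c p))\<^sup>2 * g)"
      by (simp only: of_real_mult complex_norm_square ac_simps)
    have "qform (insert p I) \<Gamma> c = of_real ((cmod (c p))\<^sup>2 * g) + (cnj (z c * cnj (c p)) + z c * cnj (c p)) + qform I \<Gamma> c"
      unfolding qform_insert[OF fin p] cz z_def[symmetric] g e by simp
    then show ?thesis by simp
  qed
  have upd: "z (c(p := t)) = z c" "qform I \<Gamma> (c(p := t)) = qform I \<Gamma> c" for c t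
  proof -
    have "(c(p := t)) i = c i" if "i \<in> I" for i
      using p that by auto
    then show "z (c(p := t)) = z c" "qform I \<Gamma> (c(p := t)) = qform I \<Gamma> c"
      unfolding z_def by (simp_all cong: sum.cong qform_cong)
  qed
  have quad: "0 \<le> (cmod t)\<^sup>2 * g + 2 * Re (z c * cnj t) + Re (qform I \<Gamma> c)" for c t
    using pos[of "c(p := t)"] unfolding val upd by simp
  have psdI: "psd I \<Gamma>"
    using psd_subset[OF insert.prems fin p] .
  show ?case
  proof (cases "g = 0")
    case True
    (* with g = 0 the quadratic form is affine in the entry at p, hence bounded below only if its slope
       vanishes; s is large enough to make the value negative *)
    have z0: "z c = 0" for c
    proof (rule ccontr)
      assume "z c \<noteq> 0"
      define s where "s = (\<bar>Re (qform I \<Gamma> c)\<bar> + 1) / (cmod (z c))\<^sup>2"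
      have "Re (z c * cnj (- of_real s * z c)) = - s * (cmod (z c))\<^sup>2"
        by (simp add: cmod_power2) (simp add: power2_eq_square algebra_simps)
      also have "\<dots> = - (\<bar>Re (qform I \<Gamma> c)\<bar> + 1)"
        using \<open>z c \<noteq> 0\<close> by (simp add: s_def)
      finally show False
        using quad[of "- of_real s * z c" c] unfolding True mult_zero_right by linarith
    qed
    have \<Gamma>0: "\<Gamma> (i, p) = 0" "\<Gamma> (p, i) = 0" if "i \<in> I" for i
    proof -
      have "z (\<lambda>j. if j = i then 1 else 0) = (\<Sum>j\<in>I. if j = i then \<Gamma> (j, p) else 0)"
        unfolding z_def by (intro sum.cong) auto
      then show *: "\<Gamma> (i, p) = 0"
        using z0 that fin by simp
      show "\<Gamma> (p, i) = 0"
        using herm[of i p] that * by simp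
    qed
    obtain v where v: "\<forall>i\<in>I. \<forall>j\<in>I. \<Gamma> (i, j) = (\<Sum>k<card I. v k i * cnj (v k j))"
      using insert.IH[OF psdI] by blast
    define v' where "v' k i = (if i = p \<or> k = card I then 0 else v k i)" for k i
    have "\<Gamma> (i, j) = (\<Sum>k<card (insert p I). v' k i * cnj (v' k j))"
      if "i \<in> insert p I" "j \<in> insert p I" for i j
    proof (cases "i = p \<or> j = p")
      case True
      then have "\<Gamma> (i, j) = 0"
        using that \<Gamma>0 g \<open>g = 0\<close> by auto
      then show ?thesis
        using True p fin by (auto simp: v'_def)
    next
      case False
      then show ?thesis
        using that v p fin by (simp add: v'_def)
    qed
    then show ?thesis by blast
  next
    case False
    have "0 \<le> g"
    proof -
      have "z (\<lambda>_. 0) = 0" "qform I \<Gamma> (\<lambda>_. 0) = 0"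
        by (simp_all add: z_def qform_def)
      then show ?thesis using quad[of 1 "\<lambda>_. 0"] by simp
    qed
    then have gpos: "g > 0" using False by simp
    define \<Delta> where "\<Delta> = (\<lambda>(i, j). \<Gamma> (i, j) - \<Gamma> (i, p) * \<Gamma> (p, j) / of_real g)"
    have "qform I \<Delta> c = qform I \<Gamma> c - z c * (\<Sum>j\<in>I. \<Gamma> (p, j) * cnj (c j)) / of_real g" for c
      unfolding qform_def \<Delta>_def z_def sum_product sum_divide_distrib sum_subtractf[symmetric]
      by (intro sum.cong refl) (simp add: algebra_simps)
    then have q\<Delta>: "qform I \<Delta> c = qform I \<Gamma> c - of_real ((cmod (z c))\<^sup>2 / g)" for c
      by (simp only: cz of_real_divide complex_norm_square)
    have "0 \<le> Re (qform I \<Delta> c)" for c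
    proof -
      (* the entry - z c / g at p minimises the form; the minimum is the Schur complement *)
      have "Re (z c * cnj (- z c / of_real g)) = - (cmod (z c))\<^sup>2 / g"
        by (simp add: cmod_power2) (simp add: power2_eq_square add_divide_distrib diff_divide_distrib)
      moreover have "(cmod (- z c / of_real g))\<^sup>2 * g = (cmod (z c))\<^sup>2 / g"
        using gpos by (simp add: norm_divide power_divide power2_eq_square)
      moreover have "Re (qform I \<Delta> c) = Re (qform I \<Gamma> c) - (cmod (z c))\<^sup>2 / g"
        unfolding q\<Delta> by simp
      ultimately show ?thesis
        using quad[of "- z c / of_real g" c] by linarith
    qed
    moreover have "\<Delta> (j, i) = cnj (\<Delta> (i, j))" if "i \<in> I" "j \<in> I" for i j
      using that herm[of i j] herm[of i p] herm[of p j] by (simp add: \<Delta>_def)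
    ultimately have "psd I \<Delta>"
      unfolding psd_def by blast
    then obtain v where v: "\<forall>i\<in>I. \<forall>j\<in>I. \<Delta> (i, j) = (\<Sum>k<card I. v k i * cnj (v k j))"
      using insert.IH by blast
    define v' where "v' k i = (if k = card I then \<Gamma> (i, p) / of_real (sqrt g)
      else if i = p then 0 else v k i)" for k i
    have last: "\<Gamma> (i, p) / of_real (sqrt g) * cnj (\<Gamma> (j, p) / of_real (sqrt g)) = \<Gamma> (i, p) * \<Gamma> (p, j) / of_real g"
      if "j \<in> insert p I" for i j
    proof -
      have "complex_of_real (sqrt g) * of_real (sqrt g) = of_real g"
        using gpos by (simp flip: of_real_mult)
      then show ?thesis
        unfolding herm[OF that insertI1] complex_cnj_divide complex_cnj_complex_of_real times_divide_times_eq by simp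
    qed
    have "\<Gamma> (i, j) = (\<Sum>k<card (insert p I). v' k i * cnj (v' k j))"
      if ij: "i \<in> insert p I" "j \<in> insert p I" for i j
    proof -
      have "(\<Sum>k<card (insert p I). v' k i * cnj (v' k j))
        = (\<Sum>k<card I. v' k i * cnj (v' k j)) + \<Gamma> (i, p) * \<Gamma> (p, j) / of_real g"
        using p fin last[OF ij(2)] by (simp add: v'_def)
      also have "(\<Sum>k<card I. v' k i * cnj (v' k j)) = \<Gamma> (i, j) - \<Gamma> (i, p) * \<Gamma> (p, j) / of_real g"
      proof (cases "i = p \<or> j = p")
        case True
        then show ?thesis
          using gpos g by (auto simp: v'_def)
      next
        case False
        then have "(\<Sum>k<card I. v' k i * cnj (v' k j)) = \<Delta> (i, j)"
          using v ij by (simp add: v'_def)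
        then show ?thesis by (simp add: \<Delta>_def)
      qed
      finally show ?thesis by simp
    qed
    then show ?thesis by blast
  qed
qed

lemma nsq_add_scaled:
  "nsq A (\<lambda>a. f a + of_real t * g a) = nsq A f + 2 * t * Re (\<Sum>a\<in>A. cnj (f a) * g a) + t\<^sup>2 * nsq A g"
proof -
  have "(cmod (f a + of_real t * g a))\<^sup>2 = (cmod (f a))\<^sup>2 + 2 * t * Re (cnj (f a) * g a) + t\<^sup>2 * (cmod (g a))\<^sup>2" for a
    by (simp add: cmod_power2) (simp add: power2_eq_square algebra_simps)
  then show ?thesis
    unfolding nsq_def Re_sum sum_distrib_left sum.distrib[symmetric] by simp
qed

text \<open>
Tychonoff's theorem in the product topology of the function space. It replaces compactness of balls
in a Euclidean space, whose dimension would have to be a type.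
\<close>

lemma compact_box: "compact {f :: 'i \<Rightarrow> complex. \<forall>i. cmod (f i) \<le> b}"
proof -
  have "{f :: 'i \<Rightarrow> complex. \<forall>i. cmod (f i) \<le> b} = PiE UNIV (\<lambda>i. cball 0 b)"
    by (auto simp: PiE_def)
  moreover have "compactin (product_topology (\<lambda>i. euclidean) UNIV) (PiE UNIV (\<lambda>i::'i. cball (0::complex) b))"
    by (simp add: compactin_PiE)
  ultimately show ?thesis
    by (simp add: euclidean_product_topology)
qed

text \<open>
Duality for the image of a closed convex cone \<open>K\<close> under a linear map \<open>R\<close> to \<open>\<complex>\<^sup>A\<close>: either \<open>Q\<close> is in the
image or a functional separates it from the image. Coercivity confines the competitors for the
distance from \<open>Q\<close> to a compact box, so that a nearest point \<open>R f\<^sub>0\<close> exists; the separating functional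
is the inner product with \<open>R f\<^sub>0 - Q\<close>.
\<close>

lemma cone_alternative:
  fixes K :: "('i \<Rightarrow> complex) set" and R :: "('i \<Rightarrow> complex) \<Rightarrow> 'a \<Rightarrow> complex"
  assumes A: "finite A" and clos: "closed K" and zero: "(\<lambda>_. 0) \<in> K"
    and add: "\<And>f g. f \<in> K \<Longrightarrow> g \<in> K \<Longrightarrow> (\<lambda>i. f i + g i) \<in> K"
    and scale: "\<And>t f. 0 \<le> t \<Longrightarrow> f \<in> K \<Longrightarrow> (\<lambda>i. of_real t * f i) \<in> K"
    and R_add: "\<And>f g a. R (\<lambda>i. f i + g i) a = R f a + R g a"
    and R_scale: "\<And>t f a. R (\<lambda>i. of_real t * f i) a = of_real t * R f a"
    and cont: "\<And>a. continuous_on UNIV (\<lambda>f. R f a)"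
    and c: "0 \<le> c" and coercive: "\<And>f i. f \<in> K \<Longrightarrow> cmod (f i) \<le> c * (\<Sum>a\<in>A. cmod (R f a))"
  shows "(\<exists>f\<in>K. \<forall>a\<in>A. R f a = Q a) \<or>
    (\<exists>L. (\<forall>f\<in>K. 0 \<le> Re (\<Sum>a\<in>A. cnj (L a) * R f a)) \<and> Re (\<Sum>a\<in>A. cnj (L a) * Q a) < 0)"
proof -
  define F where "F f = nsq A (\<lambda>a. R f a - Q a)" for f
  have R0: "R (\<lambda>_. 0) a = 0" for a
    using R_scale[of 0 "\<lambda>_. 0" a] by simp
  define s where "s = sqrt (F (\<lambda>_. 0))"
  define b where "b = c * (\<Sum>a\<in>A. s + cmod (Q a))"
  define B where "B = {f :: 'i \<Rightarrow> complex. \<forall>i. cmod (f i) \<le> b}"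
  have inB: "f \<in> B" if f: "f \<in> K" "F f \<le> F (\<lambda>_. 0)" for f
  proof -
    have "cmod (R f a) \<le> s + cmod (Q a)" if a: "a \<in> A" for a
    proof -
      have "(cmod (R f a - Q a))\<^sup>2 \<le> F f"
        unfolding F_def nsq_def using A a by (intro member_le_sum) auto
      then have "cmod (R f a - Q a) \<le> s"
        unfolding s_def using f(2) by (intro real_le_rsqrt) linarith
      then show ?thesis
        using norm_triangle_sub[of "R f a" "Q a"] by linarith
    qed
    then have "c * (\<Sum>a\<in>A. cmod (R f a)) \<le> b"
      unfolding b_def using c by (intro mult_left_mono sum_mono) auto
    then show ?thesis
      unfolding B_def using coercive[OF f(1)] order_trans by blast
  qed
  have zB: "(\<lambda>_. 0) \<in> K \<inter> B"
    using inB[OF zero] zero by simp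
  have "compact (K \<inter> B)"
    using closed_Int_compact[OF clos compact_box[of b]] by (simp add: B_def)
  moreover have "continuous_on (K \<inter> B) F"
    unfolding F_def nsq_def
    by (intro continuous_intros continuous_on_subset[OF cont subset_UNIV])
  ultimately obtain f0 where f0: "f0 \<in> K \<inter> B" and min: "\<And>f. f \<in> K \<inter> B \<Longrightarrow> F f0 \<le> F f"
    using continuous_attains_inf[of "K \<inter> B" F] zB by blast
  have minK: "F f0 \<le> F f" if "f \<in> K" for f
    using min[of f] min[OF zB] inB[OF that] that by (cases "F f \<le> F (\<lambda>_. 0)") auto
  define L where "L a = R f0 a - Q a" for a
  have F0: "F f0 = nsq A L"
    by (simp add: F_def L_def[abs_def])
  show ?thesis
  proof (cases "nsq A L = 0")
    case True
    then show ?thesis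
      using f0 by (auto simp: nsq_eq_0[OF A] L_def)
  next
    case False
    (* moving from f0 in the direction of f does not decrease the distance *)
    have pos: "0 \<le> Re (\<Sum>a\<in>A. cnj (L a) * R f a)" if f: "f \<in> K" for f
    proof (rule nonneg_of_quadratic[OF nsq_nonneg[of A "R f"]])
      fix t :: real assume t: "0 < t" "t \<le> 1"
      have "(\<lambda>i. f0 i + of_real t * f i) \<in> K"
        using f0 f t by (intro add scale) auto
      from minK[OF this] have "nsq A L \<le> nsq A (\<lambda>a. L a + of_real t * R f a)"
        unfolding F0 by (simp add: F_def R_add R_scale L_def algebra_simps)
      then show "0 \<le> 2 * t * Re (\<Sum>a\<in>A. cnj (L a) * R f a) + t\<^sup>2 * nsq A (R f)"
        unfolding nsq_add_scaled by simp
    qed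
    (* neither does shrinking f0 towards the apex *)
    have "0 \<le> Re (\<Sum>a\<in>A. cnj (L a) * - R f0 a)"
    proof (rule nonneg_of_quadratic[OF nsq_nonneg[of A "\<lambda>a. - R f0 a"]])
      fix t :: real assume t: "0 < t" "t \<le> 1"
      have shrink: "R (\<lambda>i. of_real (1 - t) * f0 i) a - Q a = L a + of_real t * - R f0 a" for a
        unfolding R_scale L_def by (simp add: algebra_simps)
      have "(\<lambda>i. of_real (1 - t) * f0 i) \<in> K"
        using f0 t by (intro scale) auto
      from minK[OF this] have "nsq A L \<le> nsq A (\<lambda>a. L a + of_real t * - R f0 a)"
        unfolding F0 by (simp only: F_def shrink)
      then show "0 \<le> 2 * t * Re (\<Sum>a\<in>A. cnj (L a) * - R f0 a) + t\<^sup>2 * nsq A (\<lambda>a. - R f0 a)"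
        unfolding nsq_add_scaled by simp
    qed
    then have neg: "Re (\<Sum>a\<in>A. cnj (L a) * R f0 a) \<le> 0"
      by (simp add: sum_negf)
    have "(\<Sum>a\<in>A. cnj (L a) * Q a) = (\<Sum>a\<in>A. cnj (L a) * R f0 a) - ip A L L"
      unfolding ip_def sum_subtractf[symmetric] by (intro sum.cong refl) (simp add: L_def algebra_simps)
    then have "Re (\<Sum>a\<in>A. cnj (L a) * Q a) < 0"
      using neg False nsq_nonneg[of A L] by (simp add: ip_self)
    with pos show ?thesis by blast
  qed
qed

lemma injective_mat_inverse:
  fixes M :: "complex mat"
  assumes M: "M \<in> carrier_mat n n"
    and inj: "\<And>v. v \<in> carrier_vec n \<Longrightarrow> M *\<^sub>v v = 0\<^sub>v n \<Longrightarrow> v = 0\<^sub>v n"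
  obtains M' where "M' \<in> carrier_mat n n" "M * M' = 1\<^sub>m n" "M' * M = 1\<^sub>m n"
proof -
  have "Determinant.det M \<noteq> 0"
    using det_0_iff_vec_prod_zero_field[OF M] inj by blast
  from det_non_zero_imp_unit[OF M this, of "()"] show ?thesis
    using that by (auto simp: Units_def ring_mat_def)
qed

text \<open>
A square system \<open>(1 - M) u = b\<close> with trivial kernel is solvable: enumerate the index set and invert the
matrix.
\<close>

lemma injective_system_solvable:
  fixes M :: "'i \<Rightarrow> 'i \<Rightarrow> complex"
  assumes fin: "finite I"
    and inj: "\<And>u. (\<And>i. i \<in> I \<Longrightarrow> u i = (\<Sum>j\<in>I. M i j * u j)) \<Longrightarrow> \<forall>i\<in>I. u i = 0"
  shows "\<exists>u. \<forall>i\<in>I. u i = b i + (\<Sum>j\<in>I. M i j * u j)"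
proof -
  define N where "N = card I"
  obtain h where h: "bij_betw h {..<N} I"
    using ex_bij_betw_nat_finite[OF fin] by (auto simp: N_def atLeast0LessThan)
  define g where "g = the_inv_into {..<N} h"
  have gh: "g (h r) = r" if "r < N" for r
    using h that by (simp add: g_def bij_betw_def the_inv_into_f_f)
  have hg: "h (g i) = i" "g i < N" if "i \<in> I" for i
    using h that f_the_inv_into_f_bij_betw[OF h] bij_betwE[OF bij_betw_the_inv_into[OF h]]
    by (auto simp: g_def)
  have hI: "h r \<in> I" if "r < N" for r
    using bij_betwE[OF h] that by auto
  define E where "E = mat N N (\<lambda>(r, s). (if r = s then 1 else 0) - M (h r) (h s))"
  have E: "E \<in> carrier_mat N N"
    by (simp add: E_def)
  have Ev: "(E *\<^sub>v v) $ r = v $ r - (\<Sum>j\<in>I. M (h r) j * v $ (g j))"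
    if v: "v \<in> carrier_vec N" and r: "r < N" for v r
  proof -
    have "(E *\<^sub>v v) $ r = (\<Sum>s<N. (if r = s then v $ s else 0) - M (h r) (h s) * v $ s)"
      using v r by (auto simp: E_def scalar_prod_def left_diff_distrib atLeast0LessThan intro!: sum.cong)
    also have "\<dots> = v $ r - (\<Sum>s<N. M (h r) (h s) * v $ (g (h s)))"
      using r gh by (simp add: sum_subtractf)
    also have "(\<Sum>s<N. M (h r) (h s) * v $ (g (h s))) = (\<Sum>j\<in>I. M (h r) j * v $ (g j))"
      by (rule sum.reindex_bij_betw[OF h])
    finally show ?thesis .
  qed
  obtain E' where E': "E' \<in> carrier_mat N N" "E * E' = 1\<^sub>m N"
  proof (rule injective_mat_inverse[OF E])
    fix v assume v: "v \<in> carrier_vec N" "E *\<^sub>v v = 0\<^sub>v N"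
    have "\<forall>i\<in>I. v $ (g i) = 0"
    proof (rule inj)
      fix i assume i: "i \<in> I"
      show "v $ (g i) = (\<Sum>j\<in>I. M i j * v $ (g j))"
        using Ev[OF v(1) hg(2)[OF i]] v(2) hg[OF i] by simp
    qed
    then show "v = 0\<^sub>v N"
      using v(1) gh hI by (intro eq_vecI) (auto, metis)
  qed blast
  define w where "w = E' *\<^sub>v vec N (\<lambda>r. b (h r))"
  have w: "w \<in> carrier_vec N"
    using E' by (simp add: w_def)
  have "E *\<^sub>v w = vec N (\<lambda>r. b (h r))"
    using E E' by (simp add: w_def flip: assoc_mult_mat_vec)
  then have "w $ (g i) = b i + (\<Sum>j\<in>I. M i j * w $ (g j))" if "i \<in> I" for i
    using Ev[OF w hg(2)[OF that]] hg[OF that] by (simp add: algebra_simps)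
  then show ?thesis
    by (intro exI[of _ "\<lambda>i. w $ (g i)"]) blast
qed

section \<open>Operator norms, evaluation of free polynomials and basic free open sets\<close>

lemma sum_flatten: "(\<Sum>r<n * m. f r) = (\<Sum>b<n. \<Sum>c<m. f (b * m + c))" for f :: "nat \<Rightarrow> 'a::comm_monoid_add"
proof -
  have "(\<Sum>r<n * m. f r) = (\<Sum>b<n. sum f {b * m..<b * m + m})"
    by (rule sum.nat_group[symmetric])
  also have "\<dots> = (\<Sum>b<n. \<Sum>c<m. f (b * m + c))"
  proof (rule sum.cong[OF refl])
    fix b
    show "sum f {b * m..<b * m + m} = (\<Sum>c<m. f (b * m + c))"
      using sum.atLeastLessThan_shift_0[of f "b * m" "b * m + m"] by (simp add: atLeast0LessThan)
  qed
  finally show ?thesis .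
qed

lemma sum_lessThan_plus: "(\<Sum>r<n + m. f r) = (\<Sum>b<n. f b) + (\<Sum>c<m. f (n + c))"
  for f :: "nat \<Rightarrow> 'a::comm_monoid_add"
  by (induct m) (simp_all add: add.assoc)

lemma nsq_times:
  "nsq (A \<times> B) f = (\<Sum>a\<in>A. nsq B (\<lambda>b. f (a, b)))"
  by (simp add: nsq_def sum.cartesian_product split_def)

lemma flat_index: "b < n \<Longrightarrow> c < m \<Longrightarrow> b * m + c < n * (m::nat)"
proof -
  assume "b < n" "c < m"
  then have "b * m + c < Suc b * m" by simp
  also have "\<dots> \<le> n * m" using \<open>b < n\<close> by (intro mult_le_mono1) simp
  finally show ?thesis .
qed

lemma flat_index_div: "r < n * m \<Longrightarrow> r div m < (n::nat)"
  by (simp add: less_mult_imp_div_less)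

lemma flat_index_mod: "r < n * m \<Longrightarrow> r mod m < (m::nat)"
  by (metis mod_less_divisor mult_is_0 not_gr_zero not_less_zero)

lemma mult_mat_index:
  "A \<in> carrier_mat n k \<Longrightarrow> B \<in> carrier_mat k m \<Longrightarrow> i < n \<Longrightarrow> j < m \<Longrightarrow>
    (A * B) $$ (i, j) = (\<Sum>l<k. A $$ (i, l) * B $$ (l, j))" for A :: "'a::semiring_0 mat"
  by (auto simp: scalar_prod_def atLeast0LessThan intro!: sum.cong)

lemma mult_vec_index:
  "A \<in> carrier_mat n k \<Longrightarrow> v \<in> carrier_vec k \<Longrightarrow> i < n \<Longrightarrow>
    (A *\<^sub>v v) $ i = (\<Sum>l<k. A $$ (i, l) * v $ l)" for A :: "'a::semiring_0 mat"
  by (auto simp: scalar_prod_def atLeast0LessThan intro!: sum.cong)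

lemma vnorm_nsq: "v \<in> carrier_vec n \<Longrightarrow> vnorm v = sqrt (nsq {..<n} (\<lambda>i. v $ i))"
  by (auto simp: vnorm_def L2_set_def nsq_def)

lemma vnorm_mult_bdd:
  assumes A: "A \<in> carrier_mat n m"
  shows "bdd_above {vnorm (A *\<^sub>v v) | v. v \<in> carrier_vec (dim_col A) \<and> vnorm v \<le> 1}"
proof (rule bdd_aboveI)
  fix t assume "t \<in> {vnorm (A *\<^sub>v v) | v. v \<in> carrier_vec (dim_col A) \<and> vnorm v \<le> 1}"
  then obtain v where t: "t = vnorm (A *\<^sub>v v)" and v: "v \<in> carrier_vec m" "vnorm v \<le> 1"
    using A by auto
  have v1: "cmod (v $ j) \<le> 1" if "j < m" for j
  proof -
    have "cmod (v $ j) \<le> vnorm v"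
      using that v(1) unfolding vnorm_def by (intro member_le_L2_set) auto
    then show ?thesis using v(2) by simp
  qed
  have "t \<le> (\<Sum>i<n. cmod ((A *\<^sub>v v) $ i))"
    unfolding t vnorm_def using A L2_set_le_sum[of "{..<n}" "\<lambda>i. cmod ((A *\<^sub>v v) $ i)"]
    by (simp del: index_mult_mat_vec)
  also have "\<dots> \<le> (\<Sum>i<n. \<Sum>j<m. cmod (A $$ (i, j)))"
  proof (intro sum_mono)
    fix i assume "i \<in> {..<n}"
    then have "cmod ((A *\<^sub>v v) $ i) \<le> (\<Sum>j<m. cmod (A $$ (i, j) * v $ j))"
      using mult_vec_index[OF A v(1)] by (simp add: norm_sum)
    also have "\<dots> \<le> (\<Sum>j<m. cmod (A $$ (i, j)))"
      using v1 by (intro sum_mono) (simp add: norm_mult mult_left_le)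
    finally show "cmod ((A *\<^sub>v v) $ i) \<le> (\<Sum>j<m. cmod (A $$ (i, j)))" .
  qed
  finally show "t \<le> (\<Sum>i<n. \<Sum>j<m. cmod (A $$ (i, j)))" .
qed

lemma vnorm_mult_le:
  assumes A: "A \<in> carrier_mat n m" and v: "v \<in> carrier_vec m"
  shows "vnorm (A *\<^sub>v v) \<le> mnorm A * vnorm v"
proof (cases "vnorm v = 0")
  case True
  then have "v = 0\<^sub>v m"
    using v by (auto simp: vnorm_def L2_set_eq_0_iff intro!: eq_vecI)
  then have "A *\<^sub>v v = 0\<^sub>v n"
    using A by auto
  then show ?thesis
    using True by (simp add: vnorm_def L2_set_def)
next
  case False
  have nn: "vnorm v \<ge> 0"
    by (simp add: vnorm_def L2_set_nonneg)
  have smult: "vnorm (complex_of_real t \<cdot>\<^sub>v w) = t * vnorm w" if "t \<ge> 0" for t w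
  proof -
    have "vnorm (complex_of_real t \<cdot>\<^sub>v w) = L2_set (\<lambda>i. t * cmod (w $ i)) {..<dim_vec w}"
      unfolding vnorm_def using that by (intro L2_set_cong) (auto simp: norm_mult)
    then show ?thesis
      using that by (simp add: vnorm_def L2_set_right_distrib)
  qed
  define u where "u = complex_of_real (1 / vnorm v) \<cdot>\<^sub>v v"
  have u: "u \<in> carrier_vec (dim_col A)" "vnorm u \<le> 1"
    using v A nn False smult[of "1 / vnorm v" v] unfolding u_def by auto
  have "vnorm (A *\<^sub>v u) = vnorm (A *\<^sub>v v) / vnorm v"
    using smult[of "1 / vnorm v" "A *\<^sub>v v"] nn unfolding u_def mult_mat_vec[OF A v] by simp
  moreover have "vnorm (A *\<^sub>v u) \<le> mnorm A"
    unfolding mnorm_def using u by (intro cSup_upper vnorm_mult_bdd[OF A]) auto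
  ultimately have "vnorm (A *\<^sub>v v) / vnorm v \<le> mnorm A"
    by simp
  then show ?thesis
    using nn False by (simp add: divide_le_eq)
qed

lemma mnorm_le:
  assumes A: "A \<in> carrier_mat n m" and c: "0 \<le> c"
    and le: "\<And>v. v \<in> carrier_vec m \<Longrightarrow> vnorm (A *\<^sub>v v) \<le> c * vnorm v"
  shows "mnorm A \<le> c"
  unfolding mnorm_def
proof (rule cSup_least)
  have "vnorm (0\<^sub>v m) \<le> 1"
    by (simp add: vnorm_def L2_set_def)
  then show "{vnorm (A *\<^sub>v v) | v. v \<in> carrier_vec (dim_col A) \<and> vnorm v \<le> 1} \<noteq> {}"
    using A by (auto intro!: exI[of _ "0\<^sub>v m"])
next
  fix t assume "t \<in> {vnorm (A *\<^sub>v v) | v. v \<in> carrier_vec (dim_col A) \<and> vnorm v \<le> 1}"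
  then obtain v where t: "t = vnorm (A *\<^sub>v v)" and v: "v \<in> carrier_vec m" "vnorm v \<le> 1"
    using A by auto
  have "t \<le> c * vnorm v"
    unfolding t by (rule le[OF v(1)])
  also have "\<dots> \<le> c"
    using v(2) c by (simp add: mult_left_le)
  finally show "t \<le> c" .
qed

lemma mnorm_le_1_iff:
  assumes A: "A \<in> carrier_mat n n"
  shows "mnorm A \<le> 1 \<longleftrightarrow> (\<forall>h. nsq {..<n} (\<lambda>a. \<Sum>b<n. A $$ (a, b) * h b) \<le> nsq {..<n} h)"
proof
  assume le: "mnorm A \<le> 1"
  show "\<forall>h. nsq {..<n} (\<lambda>a. \<Sum>b<n. A $$ (a, b) * h b) \<le> nsq {..<n} h"
  proof
    fix h
    have v: "Matrix.vec n h \<in> (carrier_vec n :: complex Matrix.vec set)" by simp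
    have "vnorm (A *\<^sub>v Matrix.vec n h) \<le> mnorm A * vnorm (Matrix.vec n h)"
      by (rule vnorm_mult_le[OF A v])
    also have "\<dots> \<le> 1 * vnorm (Matrix.vec n h)"
      using le by (intro mult_right_mono) (auto simp: vnorm_def L2_set_nonneg)
    finally have "nsq {..<n} (\<lambda>i. (A *\<^sub>v Matrix.vec n h) $ i) \<le> nsq {..<n} (\<lambda>i. Matrix.vec n h $ i)"
      using A by (simp add: vnorm_nsq[of _ n])
    also have "nsq {..<n} (\<lambda>i. Matrix.vec n h $ i) = nsq {..<n} h"
      by (intro nsq_cong) auto
    also have "nsq {..<n} (\<lambda>i. (A *\<^sub>v Matrix.vec n h) $ i) = nsq {..<n} (\<lambda>a. \<Sum>b<n. A $$ (a, b) * h b)"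
      using mult_vec_index[OF A v] by (intro nsq_cong) auto
    finally show "nsq {..<n} (\<lambda>a. \<Sum>b<n. A $$ (a, b) * h b) \<le> nsq {..<n} h" .
  qed
next
  assume le: "\<forall>h. nsq {..<n} (\<lambda>a. \<Sum>b<n. A $$ (a, b) * h b) \<le> nsq {..<n} h"
  show "mnorm A \<le> 1"
  proof (rule mnorm_le[OF A])
    fix v :: "complex Matrix.vec" assume v: "v \<in> carrier_vec n"
    have "nsq {..<n} (\<lambda>i. (A *\<^sub>v v) $ i) = nsq {..<n} (\<lambda>a. \<Sum>b<n. A $$ (a, b) * v $ b)"
      using mult_vec_index[OF A v] by (intro nsq_cong) auto
    then show "vnorm (A *\<^sub>v v) \<le> 1 * vnorm v"
      using A v le by (simp add: vnorm_nsq[of _ n])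
  qed simp
qed

lemma tuples_unique: "x \<in> tuples n \<Longrightarrow> x \<in> tuples m \<Longrightarrow> n = m"
  unfolding tuples_def by (metis (mono_tags) carrier_matD(1) mem_Collect_eq)

lemma tsize_eq [simp]: "x \<in> tuples n \<Longrightarrow> tsize x = n"
  unfolding tsize_def using tuples_unique by blast

lemma all_tuples_iff: "x \<in> tuples n \<Longrightarrow> x \<in> all_tuples \<longleftrightarrow> n \<ge> 1"
  by (auto simp: all_tuples_def dest: tuples_unique)

lemma all_tuplesE:
  assumes "x \<in> all_tuples" obtains n where "n \<ge> 1" "x \<in> tuples n"
  using assms by (auto simp: all_tuples_def)

lemma word_eval_carrier: "x \<in> tuples n \<Longrightarrow> word_eval w x \<in> carrier_mat n n"
  by (induct w) (auto simp: tuples_def intro!: mult_carrier_mat)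

lemma peval_carrier [simp]: "x \<in> tuples n \<Longrightarrow> peval p x \<in> carrier_mat n n"
  by (simp add: peval_def)

lemma peval_index:
  "x \<in> tuples n \<Longrightarrow> a < n \<Longrightarrow> b < n \<Longrightarrow>
    peval p x $$ (a, b) = (\<Sum>w\<in>Poly_Mapping.keys p. Poly_Mapping.lookup p w * word_eval w x $$ (a, b))"
  by (simp add: peval_def)

lemma peval_index_superset:
  assumes "x \<in> tuples n" "a < n" "b < n" "finite F" "Poly_Mapping.keys p \<subseteq> F"
  shows "peval p x $$ (a, b) = (\<Sum>w\<in>F. Poly_Mapping.lookup p w * word_eval w x $$ (a, b))"
  unfolding peval_index[OF assms(1-3)] using assms(4,5)
  by (intro sum.mono_neutral_left) (auto simp: in_keys_iff)

lemma word_eval_intertwine: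
  assumes x: "x \<in> tuples n" and y: "y \<in> tuples m" and S: "S \<in> carrier_mat n m"
    and xS: "\<And>i. x i * S = S * y i"
  shows "word_eval w x * S = S * word_eval w y"
proof (induct w)
  case Nil
  then show ?case using x y S by simp
next
  case (Cons i w)
  have xi: "x i \<in> carrier_mat n n" and yi: "y i \<in> carrier_mat m m"
    using x y by (auto simp: tuples_def)
  note wx = word_eval_carrier[OF x, of w] and wy = word_eval_carrier[OF y, of w]
  have "x i * word_eval w x * S = x i * (S * word_eval w y)"
    unfolding assoc_mult_mat[OF xi wx S] Cons ..
  also have "\<dots> = S * (y i * word_eval w y)"
    unfolding assoc_mult_mat[OF xi S wy, symmetric] xS assoc_mult_mat[OF S yi wy] ..
  finally show ?case by simp
qed

text \<open>
All structural facts about values of free polynomials (direct sums, similarities, ampliations,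
restrictions to invariant subspaces) are instances of this rule for suitable \<open>S\<close>.
\<close>

lemma peval_intertwine:
  assumes x: "x \<in> tuples n" and y: "y \<in> tuples m" and S: "S \<in> carrier_mat n m"
    and xS: "\<And>i. x i * S = S * y i"
  shows "peval p x * S = S * peval p y"
proof (rule eq_matI)
  fix a b assume "a < dim_row (S * peval p y)" "b < dim_col (S * peval p y)"
  then have ab: "a < n" "b < m"
    using S peval_carrier[OF y, of p] by auto
  let ?K = "Poly_Mapping.keys p"
  have "(peval p x * S) $$ (a, b) = (\<Sum>c<n. \<Sum>w\<in>?K. Poly_Mapping.lookup p w * (word_eval w x $$ (a, c) * S $$ (c, b)))"
    using ab by (simp add: mult_mat_index[OF peval_carrier[OF x] S] peval_index[OF x] sum_distrib_right mult.assoc)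
  also have "\<dots> = (\<Sum>w\<in>?K. Poly_Mapping.lookup p w * (word_eval w x * S) $$ (a, b))"
    using ab by (subst sum.swap) (simp add: mult_mat_index[OF word_eval_carrier[OF x] S] sum_distrib_left)
  also have "\<dots> = (\<Sum>w\<in>?K. Poly_Mapping.lookup p w * (S * word_eval w y) $$ (a, b))"
    using word_eval_intertwine[OF x y S xS] by simp
  also have "\<dots> = (\<Sum>c<m. \<Sum>w\<in>?K. Poly_Mapping.lookup p w * (S $$ (a, c) * word_eval w y $$ (c, b)))"
    using ab by (subst sum.swap) (simp add: mult_mat_index[OF S word_eval_carrier[OF y]] sum_distrib_left)
  also have "\<dots> = (S * peval p y) $$ (a, b)"
    using ab by (simp add: mult_mat_index[OF S peval_carrier[OF y]] peval_index[OF y] sum_distrib_left mult_ac)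
  finally show "(peval p x * S) $$ (a, b) = (S * peval p y) $$ (a, b)" .
qed (use S peval_carrier[OF x, of p] peval_carrier[OF y, of p] in auto)

lemma peval_add:
  assumes "x \<in> tuples n" "a < n" "b < n"
  shows "peval (p + q) x $$ (a, b) = peval p x $$ (a, b) + peval q x $$ (a, b)"
proof -
  define F where "F = Poly_Mapping.keys p \<union> Poly_Mapping.keys q"
  have F: "finite F" "Poly_Mapping.keys p \<subseteq> F" "Poly_Mapping.keys q \<subseteq> F" "Poly_Mapping.keys (p + q) \<subseteq> F"
    using Poly_Mapping.keys_add[of p q] by (auto simp: F_def)
  show ?thesis
    using F by (simp add: peval_index_superset[OF assms, of F] lookup_add ring_distribs sum.distrib)
qed

lemma peval_single:
  assumes "x \<in> tuples n" "a < n" "b < n"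
  shows "peval (Poly_Mapping.single w c) x $$ (a, b) = c * word_eval w x $$ (a, b)"
  by (subst peval_index_superset[OF assms, of "{w}"]) auto

lemma peval_sum_single:
  assumes "x \<in> tuples n" "a < n" "b < n" "finite F"
  shows "peval (\<Sum>w\<in>F. Poly_Mapping.single (g w) (c w)) x $$ (a, b) = (\<Sum>w\<in>F. c w * word_eval (g w) x $$ (a, b))"
  using assms(4)
proof (induct F rule: finite_induct)
  case empty
  show ?case using assms(1-3) by (simp add: peval_def)
next
  case (insert w F)
  then show ?case by (simp add: peval_add[OF assms(1-3)] peval_single[OF assms(1-3)])
qed

lemma peval_one: "x \<in> tuples n \<Longrightarrow> peval (Poly_Mapping.single [] 1) x = 1\<^sub>m n"
  using carrier_matD[OF peval_carrier[of x n "Poly_Mapping.single [] 1"]]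
  by (intro eq_matI) (auto simp: peval_single)

lemma ex_peval_scale:
  "\<exists>q. \<forall>x n a b. x \<in> tuples n \<longrightarrow> a < n \<longrightarrow> b < n \<longrightarrow> peval q x $$ (a, b) = c * peval p x $$ (a, b)"
  by (intro exI[of _ "\<Sum>w\<in>Poly_Mapping.keys p. Poly_Mapping.single w (c * Poly_Mapping.lookup p w)"])
    (simp add: peval_sum_single[OF _ _ _ finite_keys] peval_index[of _ _ _ _ p] sum_distrib_left mult.assoc)

lemma ex_peval_var_mult:
  "\<exists>q. \<forall>x n. x \<in> tuples n \<longrightarrow> peval q x = x i * peval p x"
proof -
  define q where "q = (\<Sum>w\<in>Poly_Mapping.keys p. Poly_Mapping.single (i # w) (Poly_Mapping.lookup p w))"
  have "peval q x = x i * peval p x" if x: "x \<in> tuples n" for x n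
  proof (rule eq_matI)
    have xi: "x i \<in> carrier_mat n n" using x by (simp add: tuples_def)
    note c = xi peval_carrier[OF x, of p] peval_carrier[OF x, of q]
    fix a b assume "a < dim_row (x i * peval p x)" "b < dim_col (x i * peval p x)"
    then have ab: "a < n" "b < n" using c by auto
    have "peval q x $$ (a, b) = (\<Sum>w\<in>Poly_Mapping.keys p. Poly_Mapping.lookup p w * (x i * word_eval w x) $$ (a, b))"
      by (simp add: q_def peval_sum_single[OF x ab])
    also have "\<dots> = (\<Sum>l<n. \<Sum>w\<in>Poly_Mapping.keys p. Poly_Mapping.lookup p w * (x i $$ (a, l) * word_eval w x $$ (l, b)))"
      using ab by (subst sum.swap) (simp add: mult_mat_index[OF xi word_eval_carrier[OF x]] sum_distrib_left)
    also have "\<dots> = (x i * peval p x) $$ (a, b)"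
      using ab by (simp add: mult_mat_index[OF xi peval_carrier[OF x]] peval_index[OF x] sum_distrib_left mult_ac)
    finally show "peval q x $$ (a, b) = (x i * peval p x) $$ (a, b)" .
  next
    have xi: "x i \<in> carrier_mat n n" using x by (simp add: tuples_def)
    show "dim_row (peval q x) = dim_row (x i * peval p x)" "dim_col (peval q x) = dim_col (x i * peval p x)"
      using xi peval_carrier[OF x, of p] peval_carrier[OF x, of q] by auto
  qed
  then show ?thesis by blast
qed

text \<open>
\<open>pact \<delta> x\<close> is the operator \<open>\<delta>(x)\<close>; a vector of \<open>\<complex>\<^sup>n \<otimes> \<complex>\<^sup>J\<close> is written as a function \<open>v (j, b)\<close> of an
index \<open>j < J\<close> and a coordinate \<open>b < n\<close>, which avoids flattened indices.
\<close>

definition pact :: "'d fpoly mat \<Rightarrow> 'd tuple \<Rightarrow> (nat \<times> nat \<Rightarrow> complex) \<Rightarrow> nat \<times> nat \<Rightarrow> complex" where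
  "pact \<delta> x v = (\<lambda>(i, a). \<Sum>j<dim_row \<delta>. \<Sum>b<tsize x. peval (\<delta> $$ (i, j)) x $$ (a, b) * v (j, b))"

lemma pact_cong:
  "(\<And>j b. j < dim_row \<delta> \<Longrightarrow> b < tsize x \<Longrightarrow> v (j, b) = w (j, b)) \<Longrightarrow> pact \<delta> x v = pact \<delta> x w"
  by (simp add: pact_def)

lemma pact_sum:
  "pact \<delta> x (\<lambda>p. \<Sum>k\<in>K. c k * v k p) ia = (\<Sum>k\<in>K. c k * pact \<delta> x (v k) ia)"
proof -
  obtain i a where ia: "ia = (i, a)" by fastforce
  have "(\<Sum>k\<in>K. c k * pact \<delta> x (v k) ia)
      = (\<Sum>j<dim_row \<delta>. \<Sum>b<tsize x. \<Sum>k\<in>K. c k * (peval (\<delta> $$ (i, j)) x $$ (a, b) * v k (j, b)))"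
    unfolding ia pact_def prod.case sum_distrib_left
    by (subst sum.swap[of _ _ K], intro sum.cong refl, subst sum.swap[of _ _ K], rule refl)
  then show ?thesis
    unfolding ia by (simp add: pact_def sum_distrib_left mult.left_commute)
qed

text \<open>
Translates the operator norm of the flattened matrix into an inequality between sums of squares. The
constant \<open>\<rho>\<close> bounds the square of the norm.
\<close>

lemma mem_G_iff:
  assumes \<delta>: "\<delta> \<in> carrier_mat J J" and x: "x \<in> tuples n" and n: "n \<ge> 1"
  shows "x \<in> G \<delta> \<longleftrightarrow> (\<exists>\<rho>\<ge>0. \<rho> < 1 \<and>
    (\<forall>v. nsq ({..<J} \<times> {..<n}) (pact \<delta> x v) \<le> \<rho> * nsq ({..<J} \<times> {..<n}) v))"
proof -
  define A where "A = pmat_eval \<delta> x"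
  have A: "A \<in> carrier_mat (n * J) (n * J)"
    using \<delta> x by (simp add: A_def pmat_eval_def Let_def)
  have G: "x \<in> G \<delta> \<longleftrightarrow> mnorm A < 1"
    using all_tuples_iff[OF x] n by (simp add: G_def A_def)
  have nsq_flat: "nsq {..<n * J} f = nsq ({..<J} \<times> {..<n}) (\<lambda>(j, b). f (b * J + j))" for f
    unfolding nsq_times by (simp add: nsq_def sum_flatten) (rule sum.swap)
  have A_index: "(\<Sum>s<n * J. A $$ (a * J + i, s) * f s) = pact \<delta> x (\<lambda>(j, b). f (b * J + j)) (i, a)"
    if "a < n" "i < J" for a i f
  proof -
    have "(\<Sum>s<n * J. A $$ (a * J + i, s) * f s)
        = (\<Sum>b<n. \<Sum>j<J. peval (\<delta> $$ (i, j)) x $$ (a, b) * f (b * J + j))"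
      unfolding sum_flatten using that \<delta> x
      by (intro sum.cong refl) (simp add: A_def pmat_eval_def Let_def flat_index)
    also have "\<dots> = (\<Sum>j<J. \<Sum>b<n. peval (\<delta> $$ (i, j)) x $$ (a, b) * f (b * J + j))"
      by (rule sum.swap)
    finally show ?thesis
      using \<delta> x by (simp add: pact_def)
  qed
  have vA: "vnorm (A *\<^sub>v v) = sqrt (nsq ({..<J} \<times> {..<n}) (pact \<delta> x (\<lambda>(j, b). v $ (b * J + j))))"
    and v: "vnorm v = sqrt (nsq ({..<J} \<times> {..<n}) (\<lambda>(j, b). v $ (b * J + j)))"
    if v: "v \<in> carrier_vec (n * J)" for v
  proof -
    have "A *\<^sub>v v \<in> carrier_vec (n * J)" using A v by simp
    then have "vnorm (A *\<^sub>v v) = sqrt (nsq {..<n * J} (\<lambda>r. \<Sum>s<n * J. A $$ (r, s) * v $ s))"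
      unfolding vnorm_nsq[OF \<open>A *\<^sub>v v \<in> carrier_vec (n * J)\<close>]
      by (intro arg_cong[where f = sqrt] nsq_cong mult_vec_index[OF A v]) simp
    also have "\<dots> = sqrt (nsq ({..<J} \<times> {..<n}) (pact \<delta> x (\<lambda>(j, b). v $ (b * J + j))))"
      unfolding nsq_flat using A_index by (intro arg_cong[where f = sqrt] nsq_cong) auto
    finally show "vnorm (A *\<^sub>v v) = \<dots>" .
    show "vnorm v = sqrt (nsq ({..<J} \<times> {..<n}) (\<lambda>(j, b). v $ (b * J + j)))"
      unfolding vnorm_nsq[OF v] nsq_flat ..
  qed
  show ?thesis
  proof
    assume "x \<in> G \<delta>"
    then have m1: "mnorm A < 1" using G by simp
    define c where "c = max 0 (mnorm A)"
    have c: "0 \<le> c" "c < 1" using m1 by (auto simp: c_def)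
    have "nsq ({..<J} \<times> {..<n}) (pact \<delta> x v) \<le> c\<^sup>2 * nsq ({..<J} \<times> {..<n}) v" for v
    proof -
      define w where "w = Matrix.vec (n * J) (\<lambda>r. v (r mod J, r div J))"
      have w: "w \<in> carrier_vec (n * J)" by (simp add: w_def)
      have wv: "w $ (b * J + j) = v (j, b)" if "j < J" "b < n" for j b
        using that by (simp add: w_def flat_index)
      have 1: "pact \<delta> x (\<lambda>(j, b). w $ (b * J + j)) = pact \<delta> x v"
        using \<delta> x by (intro pact_cong) (simp add: wv)
      have 2: "nsq ({..<J} \<times> {..<n}) (\<lambda>(j, b). w $ (b * J + j)) = nsq ({..<J} \<times> {..<n}) v"
        by (intro nsq_cong) (auto simp: wv)
      have "vnorm (A *\<^sub>v w) \<le> mnorm A * vnorm w"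
        by (rule vnorm_mult_le[OF A w])
      also have "\<dots> \<le> c * vnorm w"
        by (intro mult_right_mono) (auto simp: c_def vnorm_def L2_set_nonneg)
      finally have "sqrt (nsq ({..<J} \<times> {..<n}) (pact \<delta> x v)) \<le> c * sqrt (nsq ({..<J} \<times> {..<n}) v)"
        unfolding vA[OF w] v[OF w] 1 2 .
      also have "\<dots> = sqrt (c\<^sup>2 * nsq ({..<J} \<times> {..<n}) v)"
        using c by (simp add: real_sqrt_mult)
      finally show ?thesis by simp
    qed
    moreover have "c\<^sup>2 < 1"
      using c by (simp add: abs_square_less_1)
    ultimately show "\<exists>\<rho>\<ge>0. \<rho> < 1 \<and> (\<forall>v. nsq ({..<J} \<times> {..<n}) (pact \<delta> x v) \<le> \<rho> * nsq ({..<J} \<times> {..<n}) v)"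
      by (intro exI[of _ "c\<^sup>2"]) simp
  next
    assume "\<exists>\<rho>\<ge>0. \<rho> < 1 \<and> (\<forall>v. nsq ({..<J} \<times> {..<n}) (pact \<delta> x v) \<le> \<rho> * nsq ({..<J} \<times> {..<n}) v)"
    then obtain \<rho> where \<rho>: "0 \<le> \<rho>" "\<rho> < 1"
      and le: "\<And>v. nsq ({..<J} \<times> {..<n}) (pact \<delta> x v) \<le> \<rho> * nsq ({..<J} \<times> {..<n}) v" by blast
    have "mnorm A \<le> sqrt \<rho>"
    proof (rule mnorm_le[OF A])
      fix v :: "complex Matrix.vec" assume v': "v \<in> carrier_vec (n * J)"
      show "vnorm (A *\<^sub>v v) \<le> sqrt \<rho> * vnorm v"
        unfolding vA[OF v'] v[OF v'] real_sqrt_mult[symmetric] using le by simp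
    qed (use \<rho> in simp)
    also have "sqrt \<rho> < 1" using \<rho> by simp
    finally show "x \<in> G \<delta>" using G by simp
  qed
qed

lemma G_tuplesE:
  assumes "x \<in> G \<delta>" obtains n where "n \<ge> 1" "x \<in> tuples n"
  using assms all_tuplesE by (auto simp: G_def)

text \<open>
The operator \<open>S \<otimes> 1\<close> on families of vectors.
\<close>

definition lift :: "complex mat \<Rightarrow> ('a \<times> nat \<Rightarrow> complex) \<Rightarrow> 'a \<times> nat \<Rightarrow> complex" where
  "lift S v = (\<lambda>(j, a). \<Sum>c<dim_col S. S $$ (a, c) * v (j, c))"

lemma pact_intertwine:
  assumes \<delta>: "\<delta> \<in> carrier_mat J J" and x: "x \<in> tuples n" and y: "y \<in> tuples m"
    and S: "S \<in> carrier_mat n m" and xS: "\<And>i. x i * S = S * y i" and a: "a < n"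
  shows "pact \<delta> x (lift S v) (i, a) = lift S (pact \<delta> y v) (i, a)"
proof -
  have "pact \<delta> x (lift S v) (i, a)
      = (\<Sum>j<J. \<Sum>b<n. \<Sum>c<m. peval (\<delta> $$ (i, j)) x $$ (a, b) * S $$ (b, c) * v (j, c))"
    using \<delta> x S by (simp add: pact_def lift_def sum_distrib_left mult.assoc)
  also have "\<dots> = (\<Sum>j<J. \<Sum>c<m. (peval (\<delta> $$ (i, j)) x * S) $$ (a, c) * v (j, c))"
    using a by (subst sum.swap[of _ "{..<m}"]) (simp add: mult_mat_index[OF peval_carrier[OF x] S] sum_distrib_right)
  also have "\<dots> = (\<Sum>j<J. \<Sum>c<m. (S * peval (\<delta> $$ (i, j)) y) $$ (a, c) * v (j, c))"
    using peval_intertwine[OF x y S xS] by simp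
  also have "\<dots> = (\<Sum>j<J. \<Sum>b<m. \<Sum>c<m. S $$ (a, b) * (peval (\<delta> $$ (i, j)) y $$ (b, c) * v (j, c)))"
    using a by (subst (2) sum.swap) (simp add: mult_mat_index[OF S peval_carrier[OF y]] sum_distrib_right mult.assoc)
  also have "\<dots> = lift S (pact \<delta> y v) (i, a)"
    using \<delta> y S by (simp add: pact_def lift_def sum_distrib_left, subst sum.swap) simp
  finally show ?thesis .
qed

text \<open>
Basic free open sets are closed under restriction to invariant subspaces: \<open>y\<close> is the restriction of
\<open>x\<close> to the range of the isometry \<open>S\<close>.
\<close>

lemma G_isometry:
  assumes \<delta>: "\<delta> \<in> carrier_mat J J" and x: "x \<in> tuples n" "x \<in> G \<delta>" and y: "y \<in> tuples m" and m: "m \<ge> 1"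
    and S: "S \<in> carrier_mat n m" and xS: "\<And>i. x i * S = S * y i"
    and iso: "\<And>h. nsq {..<n} (\<lambda>a. \<Sum>c<m. S $$ (a, c) * h c) = nsq {..<m} h"
  shows "y \<in> G \<delta>"
proof -
  have n: "n \<ge> 1"
    using x all_tuples_iff by (auto simp: G_def)
  obtain \<rho> where \<rho>: "\<rho> \<ge> 0" "\<rho> < 1"
    and le: "\<And>v. nsq ({..<J} \<times> {..<n}) (pact \<delta> x v) \<le> \<rho> * nsq ({..<J} \<times> {..<n}) v"
    using x mem_G_iff[OF \<delta> x(1) n] by blast
  have lift_iso: "nsq ({..<J} \<times> {..<n}) (lift S v) = nsq ({..<J} \<times> {..<m}) v" for v
    using S iso by (simp add: nsq_times lift_def)
  have "nsq ({..<J} \<times> {..<m}) (pact \<delta> y v) \<le> \<rho> * nsq ({..<J} \<times> {..<m}) v" for v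
  proof -
    have "nsq ({..<J} \<times> {..<m}) (pact \<delta> y v) = nsq ({..<J} \<times> {..<n}) (pact \<delta> x (lift S v))"
      unfolding lift_iso[symmetric] using pact_intertwine[OF \<delta> x(1) y S xS]
      by (intro nsq_cong) auto
    also have "\<dots> \<le> \<rho> * nsq ({..<J} \<times> {..<m}) v"
      using le[of "lift S v"] by (simp add: lift_iso)
    finally show ?thesis .
  qed
  then show ?thesis
    using mem_G_iff[OF \<delta> y m] \<rho> by blast
qed

section \<open>Direct sums, ampliations and the rigidity of nc-functions\<close>

text \<open>
The isometry \<open>e\<^sub>a \<mapsto> e\<^bsub>f a\<^esub>\<close>. It serves for the inclusions of the summands of a direct sum (\<open>f\<close> the identity
or a shift) and of the copies of \<open>\<complex>\<^sup>n\<close> in \<open>\<complex>\<^sup>n \<otimes> \<complex>\<^sup>m\<close>.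
\<close>

definition inj_mat :: "nat \<Rightarrow> nat \<Rightarrow> (nat \<Rightarrow> nat) \<Rightarrow> complex mat" where
  "inj_mat N m f = mat N m (\<lambda>(r, a). if r = f a then 1 else 0)"

lemma inj_mat_carrier [simp]: "inj_mat N m f \<in> carrier_mat N m"
  by (simp add: inj_mat_def)

lemma mult_inj_mat:
  assumes "X \<in> carrier_mat k N" "r < k" "a < m" "f a < N"
  shows "(X * inj_mat N m f) $$ (r, a) = X $$ (r, f a)"
proof -
  have "(X * inj_mat N m f) $$ (r, a) = (\<Sum>l<N. if l = f a then X $$ (r, l) else 0)"
    unfolding mult_mat_index[OF assms(1) inj_mat_carrier assms(2,3)]
    using assms by (intro sum.cong) (auto simp: inj_mat_def)
  then show ?thesis using assms by simp
qed

lemma inj_mat_sum: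
  assumes "inj_on f {..<m}" "r < N" "a < m"
  shows "(\<Sum>c<m. inj_mat N m f $$ (r, c) * h c) = (if r \<in> f ` {..<m} then h (the_inv_into {..<m} f r) else 0)"
proof -
  have "(\<Sum>c<m. inj_mat N m f $$ (r, c) * h c) = (\<Sum>c<m. if r = f c then h c else 0)"
    using assms by (intro sum.cong) (auto simp: inj_mat_def)
  also have "\<dots> = (if r \<in> f ` {..<m} then h (the_inv_into {..<m} f r) else 0)"
  proof (cases "r \<in> f ` {..<m}")
    case True
    then obtain c where c: "c < m" "r = f c" by auto
    have "(\<Sum>c'<m. if r = f c' then h c' else 0) = (\<Sum>c'<m. if c' = c then h c' else 0)"
      using assms(1) c by (intro sum.cong) (auto dest: inj_onD)
    then show ?thesis
      using c assms(1) by (simp add: the_inv_into_f_f)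
  qed (auto intro!: sum.neutral)
  finally show ?thesis .
qed

lemma inj_mat_mult_image:
  assumes "Y \<in> carrier_mat m k" "inj_on f {..<m}" "a < m" "f a < N" "b < k"
  shows "(inj_mat N m f * Y) $$ (f a, b) = Y $$ (a, b)"
  using assms by (simp add: mult_mat_index[OF inj_mat_carrier] inj_mat_sum the_inv_into_f_f)

lemma inj_mat_mult_outside:
  assumes "Y \<in> carrier_mat m k" "r < N" "r \<notin> f ` {..<m}" "b < k"
  shows "(inj_mat N m f * Y) $$ (r, b) = 0"
  unfolding mult_mat_index[OF inj_mat_carrier assms(1,2,4)]
  using assms by (intro sum.neutral) (auto simp: inj_mat_def)

lemma inj_mat_isometry:
  assumes inj: "inj_on f {..<m}" and range: "f ` {..<m} \<subseteq> {..<N}"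
  shows "nsq {..<N} (\<lambda>a. \<Sum>c<m. inj_mat N m f $$ (a, c) * h c) = nsq {..<m} h"
proof (cases "m = 0")
  case True
  then show ?thesis by (simp add: nsq_def)
next
  case False
  have "nsq {..<N} (\<lambda>a. \<Sum>c<m. inj_mat N m f $$ (a, c) * h c)
    = (\<Sum>r<N. if r \<in> f ` {..<m} then (cmod (h (the_inv_into {..<m} f r)))\<^sup>2 else 0)"
    unfolding nsq_def using False by (intro sum.cong) (auto simp: inj_mat_sum[OF inj])
  also have "\<dots> = (\<Sum>r\<in>f ` {..<m}. (cmod (h (the_inv_into {..<m} f r)))\<^sup>2)"
    using range by (simp add: sum.If_cases Int_absorb1)
  also have "\<dots> = nsq {..<m} h"
    unfolding nsq_def by (subst sum.reindex[OF inj]) (auto simp: the_inv_into_f_f[OF inj])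
  finally show ?thesis .
qed

lemma diag2_four_block:
  "A \<in> carrier_mat n n \<Longrightarrow> B \<in> carrier_mat m m \<Longrightarrow>
    diag_block_mat [A, B] = four_block_mat A (0\<^sub>m n m) (0\<^sub>m m n) B"
  by (simp only: diag_block_mat.simps(2)[of A "[B]"] diag_block_mat_singleton Let_def carrier_matD)

declare diag_block_mat.simps [simp del]

lemma diag2_carrier:
  "A \<in> carrier_mat n n \<Longrightarrow> B \<in> carrier_mat m m \<Longrightarrow> diag_block_mat [A, B] \<in> carrier_mat (n + m) (n + m)"
  by (simp only: diag2_four_block four_block_carrier_mat)

lemma diag2_index:
  assumes "A \<in> carrier_mat n n" "B \<in> carrier_mat m m" "r < n + m" "s < n + m"
  shows "diag_block_mat [A, B] $$ (r, s) = (if r < n \<and> s < n then A $$ (r, s)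
    else if n \<le> r \<and> n \<le> s then B $$ (r - n, s - n) else 0)"
  unfolding diag2_four_block[OF assms(1,2)] using assms by (auto simp: not_less)

lemma diag2_inl:
  assumes A: "A \<in> carrier_mat n n" and B: "B \<in> carrier_mat m m"
  shows "diag_block_mat [A, B] * inj_mat (n + m) n id = inj_mat (n + m) n id * A"
proof (rule eq_matI)
  fix r s assume "r < dim_row (inj_mat (n + m) n id * A)" "s < dim_col (inj_mat (n + m) n id * A)"
  then have rs: "r < n + m" "s < n" using A by (auto simp: inj_mat_def)
  have "(inj_mat (n + m) n id * A) $$ (r, s) = (if r < n then A $$ (r, s) else 0)"
    using inj_mat_mult_image[OF A, of id r "n + m" s] inj_mat_mult_outside[OF A, of r "n + m" id s] rs by auto
  then show "(diag_block_mat [A, B] * inj_mat (n + m) n id) $$ (r, s) = (inj_mat (n + m) n id * A) $$ (r, s)"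
    using mult_inj_mat[OF diag2_carrier[OF A B] rs, of id] diag2_index[OF A B] rs by auto
qed (use A B diag2_carrier[OF A B] in \<open>auto simp: inj_mat_def\<close>)

lemma diag2_inr:
  assumes A: "A \<in> carrier_mat n n" and B: "B \<in> carrier_mat m m"
  shows "diag_block_mat [A, B] * inj_mat (n + m) m ((+) n) = inj_mat (n + m) m ((+) n) * B"
proof (rule eq_matI)
  fix r s assume "r < dim_row (inj_mat (n + m) m ((+) n) * B)" "s < dim_col (inj_mat (n + m) m ((+) n) * B)"
  then have rs: "r < n + m" "s < m" using B by (auto simp: inj_mat_def)
  have "(inj_mat (n + m) m ((+) n) * B) $$ (r, s) = (if n \<le> r then B $$ (r - n, s) else 0)"
  proof (cases "n \<le> r")
    case True
    then show ?thesis
      using inj_mat_mult_image[OF B, of "(+) n" "r - n" "n + m" s] rs by auto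
  next
    case False
    then have "r \<notin> (+) n ` {..<m}" by auto
    then show ?thesis
      using inj_mat_mult_outside[OF B, of r "n + m" "(+) n" s] rs False by simp
  qed
  then show "(diag_block_mat [A, B] * inj_mat (n + m) m ((+) n)) $$ (r, s) = (inj_mat (n + m) m ((+) n) * B) $$ (r, s)"
    using mult_inj_mat[OF diag2_carrier[OF A B] rs, of "(+) n"] diag2_index[OF A B, of r "n + s"] rs by auto
qed (use A B diag2_carrier[OF A B] in \<open>auto simp: inj_mat_def\<close>)

text \<open>
Block-diagonal matrices are characterised by intertwining relations with the two inclusions, so
compatibility with direct sums is a case of compatibility with intertwiners.
\<close>

lemma diag2_unique:
  assumes X: "X \<in> carrier_mat (n + m) (n + m)" and A: "A \<in> carrier_mat n n" and B: "B \<in> carrier_mat m m"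
    and l: "X * inj_mat (n + m) n id = inj_mat (n + m) n id * A"
    and r: "X * inj_mat (n + m) m ((+) n) = inj_mat (n + m) m ((+) n) * B"
  shows "X = diag_block_mat [A, B]"
proof -
  have D: "diag_block_mat [A, B] \<in> carrier_mat (n + m) (n + m)" by (rule diag2_carrier[OF A B])
  show ?thesis
  proof (rule eq_matI)
    fix i j assume "i < dim_row (diag_block_mat [A, B])" "j < dim_col (diag_block_mat [A, B])"
    then have ij: "i < n + m" "j < n + m" using carrier_matD[OF D] by auto
    show "X $$ (i, j) = diag_block_mat [A, B] $$ (i, j)"
    proof (cases "j < n")
      case True
      then show ?thesis
        using mult_inj_mat[OF X ij(1) True, of id] mult_inj_mat[OF D ij(1) True, of id] l diag2_inl[OF A B] by simp
    next
      case False
      then have j: "j - n < m" "n + (j - n) = j" using ij by auto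
      show ?thesis
        using mult_inj_mat[OF X ij(1) j(1), of "(+) n"] mult_inj_mat[OF D ij(1) j(1), of "(+) n"] l diag2_inr[OF A B] r j(2) ij
        by metis
    qed
  qed (use carrier_matD[OF D] X in auto)
qed

lemma dsum_tuples: "x \<in> tuples n \<Longrightarrow> y \<in> tuples m \<Longrightarrow> dsum x y \<in> tuples (n + m)"
  unfolding tuples_def dsum_def using diag2_carrier by blast

lemma dsum_inl:
  "x \<in> tuples n \<Longrightarrow> y \<in> tuples m \<Longrightarrow> dsum x y i * inj_mat (n + m) n id = inj_mat (n + m) n id * x i"
  unfolding tuples_def dsum_def by (intro diag2_inl) auto

lemma dsum_inr:
  "x \<in> tuples n \<Longrightarrow> y \<in> tuples m \<Longrightarrow> dsum x y i * inj_mat (n + m) m ((+) n) = inj_mat (n + m) m ((+) n) * y i"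
  unfolding tuples_def dsum_def by (intro diag2_inr) auto

lemma peval_dsum:
  assumes x: "x \<in> tuples n" and y: "y \<in> tuples m"
  shows "peval p (dsum x y) = diag_block_mat [peval p x, peval p y]"
proof (rule diag2_unique)
  note z = dsum_tuples[OF x y]
  show "peval p (dsum x y) \<in> carrier_mat (n + m) (n + m)"
    by (rule peval_carrier[OF z])
  show "peval p (dsum x y) * inj_mat (n + m) n id = inj_mat (n + m) n id * peval p x"
    by (rule peval_intertwine[OF z x inj_mat_carrier dsum_inl[OF x y]])
  show "peval p (dsum x y) * inj_mat (n + m) m ((+) n) = inj_mat (n + m) m ((+) n) * peval p y"
    by (rule peval_intertwine[OF z y inj_mat_carrier dsum_inr[OF x y]])
qed (use x y in simp_all)

lemma G_dsum_iff:
  assumes \<delta>: "\<delta> \<in> carrier_mat J J" and x: "x \<in> tuples n" "n \<ge> 1" and y: "y \<in> tuples m" "m \<ge> 1"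
  shows "dsum x y \<in> G \<delta> \<longleftrightarrow> x \<in> G \<delta> \<and> y \<in> G \<delta>"
proof
  assume z: "dsum x y \<in> G \<delta>"
  show "x \<in> G \<delta> \<and> y \<in> G \<delta>"
  proof
    show "x \<in> G \<delta>"
      by (rule G_isometry[OF \<delta> dsum_tuples[OF x(1) y(1)] z x inj_mat_carrier dsum_inl[OF x(1) y(1)]])
        (auto intro!: inj_mat_isometry)
    show "y \<in> G \<delta>"
      by (rule G_isometry[OF \<delta> dsum_tuples[OF x(1) y(1)] z y inj_mat_carrier dsum_inr[OF x(1) y(1)]])
        (auto intro!: inj_mat_isometry)
  qed
next
  assume "x \<in> G \<delta> \<and> y \<in> G \<delta>"
  then obtain \<rho> \<rho>' where \<rho>: "\<rho> \<ge> 0" "\<rho> < 1" "\<And>v. nsq ({..<J} \<times> {..<n}) (pact \<delta> x v) \<le> \<rho> * nsq ({..<J} \<times> {..<n}) v"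
    and \<rho>': "\<rho>' \<ge> 0" "\<rho>' < 1" "\<And>v. nsq ({..<J} \<times> {..<m}) (pact \<delta> y v) \<le> \<rho>' * nsq ({..<J} \<times> {..<m}) v"
    using mem_G_iff[OF \<delta> x] mem_G_iff[OF \<delta> y] by metis
  have z: "dsum x y \<in> tuples (n + m)"
    by (rule dsum_tuples[OF x(1) y(1)])
  note c = peval_carrier[OF x(1)] peval_carrier[OF y(1)]
  have split: "nsq ({..<J} \<times> {..<n + m}) v = nsq ({..<J} \<times> {..<n}) v + nsq ({..<J} \<times> {..<m}) (\<lambda>(j, b). v (j, n + b))" for v
    unfolding nsq_times by (simp add: nsq_def sum_lessThan_plus sum.distrib)
  have act: "pact \<delta> (dsum x y) v (i, a) = (if a < n then pact \<delta> x v (i, a) else pact \<delta> y (\<lambda>(j, b). v (j, n + b)) (i, a - n))"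
    if "a < n + m" for v i a
    using that \<delta> x(1) y(1) z by (simp add: pact_def sum_lessThan_plus peval_dsum[OF x(1) y(1)] diag2_index[OF c])
  have "nsq ({..<J} \<times> {..<n + m}) (pact \<delta> (dsum x y) v) \<le> max \<rho> \<rho>' * nsq ({..<J} \<times> {..<n + m}) v" for v
  proof -
    have "nsq ({..<J} \<times> {..<n + m}) (pact \<delta> (dsum x y) v)
      = nsq ({..<J} \<times> {..<n}) (pact \<delta> x v) + nsq ({..<J} \<times> {..<m}) (pact \<delta> y (\<lambda>(j, b). v (j, n + b)))"
      unfolding split by (intro arg_cong2[where f = "(+)"] nsq_cong) (auto simp: act)
    also have "\<dots> \<le> max \<rho> \<rho>' * nsq ({..<J} \<times> {..<n}) v + max \<rho> \<rho>' * nsq ({..<J} \<times> {..<m}) (\<lambda>(j, b). v (j, n + b))"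
      by (intro add_mono order.trans[OF \<rho>(3)] order.trans[OF \<rho>'(3)] mult_right_mono nsq_nonneg) auto
    finally show ?thesis
      unfolding split by (simp add: distrib_left)
  qed
  moreover have "0 \<le> max \<rho> \<rho>'" "max \<rho> \<rho>' < 1"
    using \<rho> \<rho>' by auto
  ultimately show "dsum x y \<in> G \<delta>"
    using mem_G_iff[OF \<delta> z] x(2) by auto
qed

text \<open>
The ampliation \<open>z \<otimes> 1\<^sub>m\<close>; the index \<open>a * m + b\<close> stands for \<open>e\<^sub>a \<otimes> e\<^sub>b\<close>, and \<open>slot n m b\<close> is the inclusion
\<open>e\<^sub>a \<mapsto> e\<^sub>a \<otimes> e\<^sub>b\<close>.
\<close>

definition amp :: "nat \<Rightarrow> 'd tuple \<Rightarrow> 'd tuple" where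
  "amp m z = (\<lambda>i. mat (tsize z * m) (tsize z * m)
    (\<lambda>(r, s). if r mod m = s mod m then z i $$ (r div m, s div m) else 0))"

definition slot :: "nat \<Rightarrow> nat \<Rightarrow> nat \<Rightarrow> complex mat" where
  "slot n m b = inj_mat (n * m) n (\<lambda>a. a * m + b)"

lemma slot_carrier [simp]: "slot n m b \<in> carrier_mat (n * m) n"
  by (simp add: slot_def)

lemma mult_slot:
  "X \<in> carrier_mat k (n * m) \<Longrightarrow> r < k \<Longrightarrow> a < n \<Longrightarrow> b < m \<Longrightarrow> (X * slot n m b) $$ (r, a) = X $$ (r, a * m + b)"
  unfolding slot_def by (rule mult_inj_mat) (auto simp: flat_index)

lemma slot_mult:
  assumes Y: "Y \<in> carrier_mat n k" and r: "r < n * m" and b: "b < m" and c: "c < k"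
  shows "(slot n m b * Y) $$ (r, c) = (if r mod m = b then Y $$ (r div m, c) else 0)"
proof (cases "r mod m = b")
  case True
  have "inj_on (\<lambda>a. a * m + b) {..<n}"
    using b by (auto simp: inj_on_def)
  moreover have "r div m * m + b = r"
    using True div_mult_mod_eq[of r m] by simp
  ultimately show ?thesis
    using inj_mat_mult_image[OF Y, of "\<lambda>a. a * m + b" "r div m" "n * m" c] True r c flat_index_div[OF r]
    by (simp add: slot_def)
next
  case False
  then have "r \<notin> (\<lambda>a. a * m + b) ` {..<n}"
    using b by auto
  then show ?thesis
    using inj_mat_mult_outside[OF Y r _ c] False by (simp add: slot_def)
qed

lemma amp_tuples: "z \<in> tuples n \<Longrightarrow> amp m z \<in> tuples (n * m)"
  by (simp add: amp_def tuples_def[of "n * m"])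

text \<open>
A matrix has the form \<open>Y \<otimes> 1\<^sub>m\<close> exactly if it intertwines \<open>Y\<close> through every slot. This identifies the
values of polynomials, and of nc-functions, at an ampliation.
\<close>

lemma slot_intertwine_iff:
  assumes X: "X \<in> carrier_mat (n * m) (n * m)" and Y: "Y \<in> carrier_mat n n"
  shows "(\<forall>b<m. X * slot n m b = slot n m b * Y) \<longleftrightarrow>
    (\<forall>r<n * m. \<forall>s<n * m. X $$ (r, s) = (if r mod m = s mod m then Y $$ (r div m, s div m) else 0))"
proof (intro iffI allI impI)
  fix r s assume inter: "\<forall>b<m. X * slot n m b = slot n m b * Y" and rs: "r < n * m" "s < n * m"
  have b: "s mod m < m" and a: "s div m < n"
    using flat_index_mod[OF rs(2)] flat_index_div[OF rs(2)] by auto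
  have "X $$ (r, s) = (X * slot n m (s mod m)) $$ (r, s div m)"
    using mult_slot[OF X rs(1) a b] by simp
  also have "\<dots> = (slot n m (s mod m) * Y) $$ (r, s div m)"
    using inter b by simp
  finally show "X $$ (r, s) = (if r mod m = s mod m then Y $$ (r div m, s div m) else 0)"
    using slot_mult[OF Y rs(1) b a] by simp
next
  fix b assume X_eq: "\<forall>r<n * m. \<forall>s<n * m. X $$ (r, s) = (if r mod m = s mod m then Y $$ (r div m, s div m) else 0)"
    and b: "b < m"
  show "X * slot n m b = slot n m b * Y"
  proof (rule eq_matI)
    fix r a assume "r < dim_row (slot n m b * Y)" "a < dim_col (slot n m b * Y)"
    then have ra: "r < n * m" "a < n" using Y by (auto simp: slot_def inj_mat_def)
    show "(X * slot n m b) $$ (r, a) = (slot n m b * Y) $$ (r, a)"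
      using mult_slot[OF X ra b] slot_mult[OF Y ra(1) b ra(2)] X_eq ra b flat_index[OF ra(2) b] by simp
  qed (use X Y carrier_matD[OF slot_carrier[of n m b]] in auto)
qed

lemma amp_slot:
  assumes z: "z \<in> tuples n" and b: "b < m"
  shows "amp m z i * slot n m b = slot n m b * z i"
proof -
  have "amp m z i \<in> carrier_mat (n * m) (n * m)" "z i \<in> carrier_mat n n"
    using z amp_tuples[OF z] by (auto simp: tuples_def)
  from slot_intertwine_iff[OF this] show ?thesis
    using z b by (simp add: amp_def)
qed

lemma peval_amp:
  assumes z: "z \<in> tuples n" and rs: "r < n * m" "s < n * m"
  shows "peval p (amp m z) $$ (r, s) = (if r mod m = s mod m then peval p z $$ (r div m, s div m) else 0)"
proof -
  have "\<forall>b<m. peval p (amp m z) * slot n m b = slot n m b * peval p z"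
    using peval_intertwine[OF amp_tuples[OF z] z slot_carrier amp_slot[OF z]] by blast
  then show ?thesis
    using slot_intertwine_iff[OF peval_carrier[OF amp_tuples[OF z]] peval_carrier[OF z]] rs by blast
qed

lemma sum_same_residue:
  fixes f :: "nat \<Rightarrow> complex"
  assumes "a < n" "b < m"
  shows "(\<Sum>s<n * m. if (a * m + b) mod m = s mod m then f s else 0) = (\<Sum>c<n. f (c * m + b))"
proof -
  have "(\<Sum>d<m. if (a * m + b) mod m = (c * m + d) mod m then f (c * m + d) else 0)
      = (\<Sum>d<m. if d = b then f (c * m + d) else 0)" for c
    using assms by (intro sum.cong) auto
  then show ?thesis
    unfolding sum_flatten using assms by simp
qed

lemma pact_amp:
  assumes z: "z \<in> tuples n" and a: "a < n" and c: "c < m"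
  shows "pact \<delta> (amp m z) v (i, a * m + c) = pact \<delta> z (\<lambda>(j, b). v (j, b * m + c)) (i, a)"
proof -
  have "(\<Sum>s<n * m. peval p (amp m z) $$ (a * m + c, s) * v (j, s)) = (\<Sum>b<n. peval p z $$ (a, b) * v (j, b * m + c))"
    for p j
  proof -
    have "(\<Sum>s<n * m. peval p (amp m z) $$ (a * m + c, s) * v (j, s))
      = (\<Sum>s<n * m. if (a * m + c) mod m = s mod m then peval p z $$ (a, s div m) * v (j, s) else 0)"
      using flat_index[OF a c] c by (intro sum.cong refl) (simp add: peval_amp[OF z])
    also have "\<dots> = (\<Sum>b<n. peval p z $$ (a, b) * v (j, b * m + c))"
      unfolding sum_same_residue[OF a c] using c by simp
    finally show ?thesis .
  qed
  then show ?thesis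
    using z amp_tuples[OF z, of m] by (simp add: pact_def)
qed

lemma nsq_amp:
  fixes v :: "nat \<times> nat \<Rightarrow> complex"
  shows "nsq ({..<J} \<times> {..<n * m}) v = (\<Sum>c<m. nsq ({..<J} \<times> {..<n}) (\<lambda>(j, b). v (j, b * m + c)))"
  unfolding nsq_times unfolding nsq_def prod.case
proof -
  have "(\<Sum>j<J. \<Sum>b<n * m. (cmod (v (j, b)))\<^sup>2) = (\<Sum>j<J. \<Sum>c<m. \<Sum>b<n. (cmod (v (j, b * m + c)))\<^sup>2)"
    unfolding sum_flatten by (intro sum.cong refl sum.swap)
  also have "\<dots> = (\<Sum>c<m. \<Sum>j<J. \<Sum>b<n. (cmod (v (j, b * m + c)))\<^sup>2)"
    by (rule sum.swap)
  finally show "(\<Sum>j<J. \<Sum>b<n * m. (cmod (v (j, b)))\<^sup>2) = \<dots>" .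
qed

lemma amp_mem_G:
  assumes \<delta>: "\<delta> \<in> carrier_mat J J" and z: "z \<in> tuples n" "z \<in> G \<delta>" and m: "m \<ge> 1"
  shows "amp m z \<in> G \<delta>"
proof -
  have n: "n \<ge> 1"
    using z all_tuples_iff by (auto simp: G_def)
  obtain \<rho> where \<rho>: "\<rho> \<ge> 0" "\<rho> < 1"
    and le: "\<And>v. nsq ({..<J} \<times> {..<n}) (pact \<delta> z v) \<le> \<rho> * nsq ({..<J} \<times> {..<n}) v"
    using z mem_G_iff[OF \<delta> z(1) n] by blast
  have "nsq ({..<J} \<times> {..<n * m}) (pact \<delta> (amp m z) v) \<le> \<rho> * nsq ({..<J} \<times> {..<n * m}) v" for v
  proof -
    have "nsq ({..<J} \<times> {..<n * m}) (pact \<delta> (amp m z) v)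
      = (\<Sum>c<m. nsq ({..<J} \<times> {..<n}) (pact \<delta> z (\<lambda>(j, b). v (j, b * m + c))))"
      unfolding nsq_amp by (intro sum.cong refl nsq_cong) (auto simp: pact_amp[OF z(1)])
    also have "\<dots> \<le> \<rho> * nsq ({..<J} \<times> {..<n * m}) v"
      unfolding nsq_amp sum_distrib_left by (intro sum_mono le)
    finally show ?thesis .
  qed
  moreover have "n * m \<ge> 1" using n m by simp
  ultimately show ?thesis
    using mem_G_iff[OF \<delta> amp_tuples[OF z(1)]] \<rho> by blast
qed

text \<open>
A relation \<open>A S = S B\<close> is an invariance of \<open>A \<oplus> B\<close> under conjugation by a unipotent matrix. This turns
the similarity axiom of nc-functions into a statement about intertwiners.
\<close>

lemma unipotent_commute_iff:
  fixes A B S :: "complex mat"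
  assumes A: "A \<in> carrier_mat n n" and B: "B \<in> carrier_mat m m" and S: "S \<in> carrier_mat n m"
  defines "s \<equiv> four_block_mat (1\<^sub>m n) S (0\<^sub>m m n) (1\<^sub>m m)"
  shows "diag_block_mat [A, B] * s = s * diag_block_mat [A, B] \<longleftrightarrow> A * S = S * B"
proof -
  have 1: "diag_block_mat [A, B] * s = four_block_mat A (A * S) (0\<^sub>m m n) B"
    unfolding s_def diag2_four_block[OF A B]
    by (subst mult_four_block_mat[of _ n n _ m _ m _ _ n _ m]) (use A B S in \<open>auto simp: right_mult_one_mat[OF A] right_mult_one_mat[OF B]\<close>)
  have 2: "s * diag_block_mat [A, B] = four_block_mat A (S * B) (0\<^sub>m m n) B"
    unfolding s_def diag2_four_block[OF A B]
    by (subst mult_four_block_mat[of _ n n _ m _ m _ _ n _ m]) (use A B S in \<open>auto simp: left_mult_one_mat[OF A] left_mult_one_mat[OF B]\<close>)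
  show ?thesis
  proof
    assume eq: "diag_block_mat [A, B] * s = s * diag_block_mat [A, B]"
    show "A * S = S * B"
    proof (rule eq_matI)
      fix i j assume "i < dim_row (S * B)" "j < dim_col (S * B)"
      then have ij: "i < n" "j < m" using S B by auto
      then show "(A * S) $$ (i, j) = (S * B) $$ (i, j)"
        using arg_cong[OF eq[unfolded 1 2], of "\<lambda>M. M $$ (i, n + j)"] A B S
        by (simp del: index_mult_mat(1))
    qed (use A B S in auto)
  qed (simp add: 1 2)
qed

text \<open>
Conjugation by the unipotent matrix \<open>s\<close> built from \<open>S\<close> fixes \<open>x \<oplus> y\<close>, hence it fixes
\<open>\<phi>(x \<oplus> y) = \<phi>(x) \<oplus> \<phi>(y)\<close>; the off-diagonal block of this invariance is the claim.
\<close>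

lemma nc_function_intertwine:
  assumes \<delta>: "\<delta> \<in> carrier_mat J J" and nc: "nc_function (G \<delta>) \<phi>"
    and x: "x \<in> G \<delta>" "x \<in> tuples n" and y: "y \<in> G \<delta>" "y \<in> tuples m"
    and S: "S \<in> carrier_mat n m" and xS: "\<And>i. x i * S = S * y i"
  shows "\<phi> x * S = S * \<phi> y"
proof -
  have n: "n \<ge> 1" and m: "m \<ge> 1"
    using x y all_tuples_iff by (auto simp: G_def)
  define z where "z = dsum x y"
  define s where "s = four_block_mat (1\<^sub>m n) S (0\<^sub>m m n) (1\<^sub>m m)"
  define s' where "s' = four_block_mat (1\<^sub>m n) (- S) (0\<^sub>m m n) (1\<^sub>m m)"
  have s: "s \<in> carrier_mat (n + m) (n + m)" and s': "s' \<in> carrier_mat (n + m) (n + m)"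
    by (simp_all add: s_def s'_def)
  have neg0: "- 0\<^sub>m m m = (0\<^sub>m m m :: complex mat)"
    by (rule eq_matI) auto
  have neg1: "S + - S = 0\<^sub>m n m"
    by (rule eq_matI) (use S in auto)
  have ss': "s * s' = 1\<^sub>m (n + m)"
    unfolding s_def s'_def
    by (subst mult_four_block_mat[of _ n n _ m _ m _ _ n _ m]) (use S in \<open>auto simp: neg0 neg1\<close>)
  have s's: "s' * s = 1\<^sub>m (n + m)"
    unfolding s_def s'_def
    by (subst mult_four_block_mat[of _ n n _ m _ m _ _ n _ m]) (use S in \<open>auto simp: neg0 neg1\<close>)
  have z: "z \<in> tuples (n + m)" "z \<in> G \<delta>"
    using dsum_tuples[OF x(2) y(2)] G_dsum_iff[OF \<delta> x(2) n y(2) m] x y by (auto simp: z_def)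
  have zi: "z i \<in> carrier_mat (n + m) (n + m)" for i
    using z(1) by (simp add: tuples_def)
  have comm: "z i * s = s * z i" for i
    unfolding z_def dsum_def s_def
    by (subst unipotent_commute_iff) (use x y S xS in \<open>auto simp: tuples_def\<close>)
  have conj: "(\<lambda>i. s' * z i * s) = z"
  proof
    fix i
    have "s' * z i * s = s' * s * z i"
      using s s' zi[of i] comm[of i] by (simp add: assoc_mult_mat[of _ "n + m" "n + m" _ "n + m" _ "n + m"])
    then show "s' * z i * s = z i"
      using zi[of i] by (simp add: s's)
  qed
  have "inverts_mat s s'" "inverts_mat s' s"
    using s s' ss' s's by (auto simp: inverts_mat_def)
  then have inv: "\<phi> z = s' * \<phi> z * s"
    using nc z s s' conj unfolding nc_function_def by (metis IntI)
  have c: "\<phi> x \<in> carrier_mat n n" "\<phi> y \<in> carrier_mat m m" "\<phi> z \<in> carrier_mat (n + m) (n + m)"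
    using nc x y z unfolding nc_function_def graded_def by blast+
  have "\<phi> z = diag_block_mat [\<phi> x, \<phi> y]"
    using nc x y z unfolding nc_function_def z_def by blast
  moreover have "s * \<phi> z = s * s' * \<phi> z * s"
    using s s' c(3) by (subst inv) (simp add: assoc_mult_mat[of _ "n + m" "n + m" _ "n + m" _ "n + m"])
  then have "\<phi> z * s = s * \<phi> z"
    using c(3) by (simp add: ss')
  ultimately show ?thesis
    using unipotent_commute_iff[OF c(1,2) S] by (simp add: s_def)
qed

text \<open>
Let \<open>M\<close> be the cyclic subspace of \<open>Z = z \<otimes> 1\<close> generated by \<open>f\<^sub>1 = \<Sum>\<^sub>a e\<^sub>a \<otimes> e\<^sub>a\<close>. Flattened, \<open>f\<^sub>1\<close> is the
identity matrix, and \<open>M\<close> consists of the flattened matrices \<open>p(z)\<close>. The restriction \<open>y\<close> of \<open>Z\<close> to \<open>M\<close>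
lies in the same basic set, so the inclusion \<open>Q\<close> of \<open>M\<close> intertwines \<open>\<phi>(Z)\<close> and \<open>\<phi>(y)\<close>. Thus \<open>\<phi>(Z)\<close> leaves
\<open>M\<close> invariant, and \<open>\<phi>(Z) f\<^sub>1\<close>, which is \<open>\<phi>(z)\<close> flattened, has the form \<open>p(z)\<close>.
\<close>

lemma nc_function_in_algebra:
  assumes \<delta>: "\<delta> \<in> carrier_mat J J" and nc: "nc_function (G \<delta>) \<phi>"
    and z: "z \<in> G \<delta>" "z \<in> tuples n"
  shows "\<exists>p. \<phi> z = peval p z"
proof -
  have n: "n \<ge> 1"
    using z all_tuples_iff by (auto simp: G_def)
  define Z where "Z = amp n z"
  define N where "N = n * n"
  have Z: "Z \<in> tuples N" "Z \<in> G \<delta>"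
    using amp_tuples[OF z(2)] amp_mem_G[OF \<delta> z(2,1) n] by (auto simp: Z_def N_def)
  have Zi: "Z i \<in> carrier_mat N N" for i
    using Z by (simp add: tuples_def)
  have c: "\<phi> z \<in> carrier_mat n n" "\<phi> Z \<in> carrier_mat N N"
    using nc z Z unfolding nc_function_def graded_def by blast+
  define M where "M = {f. \<exists>p. \<forall>r<N. f r = peval p z $$ (r div n, r mod n)}"
  (* X = Y \<otimes> 1 acts on flattened matrices as left multiplication by Y *)
  have amp_mult: "(\<Sum>s<N. X $$ (r, s) * f s) = (Y * peval p z) $$ (r div n, r mod n)"
    if X: "\<forall>r<N. \<forall>s<N. X $$ (r, s) = (if r mod n = s mod n then Y $$ (r div n, s div n) else 0)"
      and Y: "Y \<in> carrier_mat n n" and f: "\<forall>r<N. f r = peval p z $$ (r div n, r mod n)" and r: "r < N"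
    for X Y f p r
  proof -
    have r': "r div n < n" "r mod n < n" "(r div n) * n + r mod n = r"
      using r flat_index_div flat_index_mod by (auto simp: N_def)
    have "(\<Sum>s<N. X $$ (r, s) * f s)
      = (\<Sum>s<n * n. if ((r div n) * n + r mod n) mod n = s mod n then Y $$ (r div n, s div n) * peval p z $$ (s div n, s mod n) else 0)"
      unfolding r'(3) N_def[symmetric] using X f r by (intro sum.cong refl) simp
    also have "\<dots> = (\<Sum>l<n. Y $$ (r div n, l) * peval p z $$ (l, r mod n))"
      unfolding sum_same_residue[OF r'(1,2)] using r' by simp
    also have "\<dots> = (Y * peval p z) $$ (r div n, r mod n)"
      using r' by (simp add: mult_mat_index[OF Y peval_carrier[OF z(2)]])
    finally show ?thesis .
  qed
  have M_inv: "(\<lambda>r. \<Sum>s<N. Z i $$ (r, s) * f s) \<in> M" if f: "f \<in> M" for f i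
  proof -
    obtain p where p: "\<forall>r<N. f r = peval p z $$ (r div n, r mod n)"
      using f by (auto simp: M_def)
    obtain q where q: "peval q z = z i * peval p z"
      using ex_peval_var_mult[of i p] z(2) by blast
    have ZZ: "\<forall>r<N. \<forall>s<N. Z i $$ (r, s) = (if r mod n = s mod n then z i $$ (r div n, s div n) else 0)"
      using z(2) by (simp add: Z_def amp_def N_def)
    have "z i \<in> carrier_mat n n"
      using z(2) by (simp add: tuples_def)
    then show ?thesis
      unfolding M_def using amp_mult[OF ZZ _ p] q by (intro CollectI exI[of _ q]) simp
  qed
  have M_zero: "(\<lambda>_. 0) \<in> M"
  proof -
    have "peval 0 z $$ (r div n, r mod n) = 0" if "r < N" for r
      using that flat_index_div flat_index_mod by (simp add: N_def peval_index[OF z(2)])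
    then show ?thesis
      unfolding M_def by (intro CollectI exI[of _ 0]) simp
  qed
  have M_add: "(\<lambda>r. f r + g r) \<in> M" if fg: "f \<in> M" "g \<in> M" for f g
  proof -
    obtain p q where pq: "\<forall>r<N. f r = peval p z $$ (r div n, r mod n)" "\<forall>r<N. g r = peval q z $$ (r div n, r mod n)"
      using fg by (auto simp: M_def)
    then have "\<forall>r<N. f r + g r = peval (p + q) z $$ (r div n, r mod n)"
      using flat_index_div flat_index_mod by (simp add: N_def peval_add[OF z(2)])
    then show ?thesis
      unfolding M_def by blast
  qed
  have M_scale: "(\<lambda>r. t * f r) \<in> M" if f: "f \<in> M" for t f
  proof -
    obtain p where p: "\<forall>r<N. f r = peval p z $$ (r div n, r mod n)"
      using f by (auto simp: M_def)
    obtain q where q: "\<forall>x n a b. x \<in> tuples n \<longrightarrow> a < n \<longrightarrow> b < n \<longrightarrow> peval q x $$ (a, b) = t * peval p x $$ (a, b)"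
      using ex_peval_scale by blast
    have "\<forall>r<N. t * f r = peval q z $$ (r div n, r mod n)"
      using p q z(2) flat_index_div flat_index_mod by (simp add: N_def)
    then show ?thesis
      unfolding M_def by blast
  qed
  obtain k q where q: "orthonormal {..<N} k q" and qM: "\<And>j. j < k \<Longrightarrow> q j \<in> M"
    and rep: "\<And>f i. f \<in> M \<Longrightarrow> i \<in> {..<N} \<Longrightarrow> f i = (\<Sum>j<k. ip {..<N} f (q j) * q j i)"
    by (rule subspace_orthonormal_basis[OF finite_lessThan[of N] M_zero M_add M_scale]) (assumption | rule that)+
  define Q where "Q = mat N k (\<lambda>(r, j). q j r)"
  have Q: "Q \<in> carrier_mat N k" by (simp add: Q_def)
  define f1 :: "nat \<Rightarrow> complex" where "f1 r = (if r div n = r mod n then 1 else 0)" for r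
  have f1: "\<forall>r<N. f1 r = peval (Poly_Mapping.single [] 1) z $$ (r div n, r mod n)"
    unfolding peval_one[OF z(2)] using flat_index_div flat_index_mod by (simp add: N_def f1_def)
  then have f1M: "f1 \<in> M"
    unfolding M_def by blast
  have k: "k \<ge> 1"
  proof (rule ccontr)
    assume "\<not> k \<ge> 1"
    then have "k = 0" by simp
    then have "f1 0 = 0"
      using rep[OF f1M, of 0] n by (simp add: N_def)
    then show False by (simp add: f1_def)
  qed
  (* the matrix of the restriction of Z to M in the orthonormal basis q *)
  define y where "y i = mat k k (\<lambda>(j, l). ip {..<N} (\<lambda>r. \<Sum>s<N. Z i $$ (r, s) * q l s) (q j))" for i
  have y: "y \<in> tuples k"
    by (simp add: y_def tuples_def)
  have ZQ: "Z i * Q = Q * y i" for i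
  proof (rule eq_matI)
    fix r l assume "r < dim_row (Q * y i)" "l < dim_col (Q * y i)"
    then have rl: "r < N" "l < k" by (auto simp: Q_def y_def)
    have "(Z i * Q) $$ (r, l) = (\<Sum>s<N. Z i $$ (r, s) * q l s)"
      using rl by (simp add: mult_mat_index[OF Zi Q]) (simp add: Q_def)
    also have "\<dots> = (\<Sum>j<k. ip {..<N} (\<lambda>r. \<Sum>s<N. Z i $$ (r, s) * q l s) (q j) * q j r)"
      using rep[OF M_inv[OF qM[OF rl(2)]]] rl by simp
    also have "\<dots> = (\<Sum>j<k. Q $$ (r, j) * y i $$ (j, l))"
      using rl by (intro sum.cong refl) (simp add: Q_def y_def mult.commute)
    also have "\<dots> = (Q * y i) $$ (r, l)"
      using rl y by (subst mult_mat_index[OF Q]) (auto simp: tuples_def)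
    finally show "(Z i * Q) $$ (r, l) = (Q * y i) $$ (r, l)" .
  qed (use Zi[of i] in \<open>auto simp: Q_def y_def\<close>)
  have yG: "y \<in> G \<delta>"
  proof (rule G_isometry[OF \<delta> Z y k Q ZQ])
    fix h :: "nat \<Rightarrow> complex"
    have "nsq {..<N} (\<lambda>a. \<Sum>c<k. Q $$ (a, c) * h c) = nsq {..<N} (\<lambda>a. \<Sum>c<k. h c * q c a)"
      by (intro nsq_cong) (simp add: Q_def mult.commute)
    also have "\<dots> = nsq {..<k} h"
      unfolding nsq_orthonormal_sum[OF q] by (simp add: nsq_def)
    finally show "nsq {..<N} (\<lambda>a. \<Sum>c<k. Q $$ (a, c) * h c) = nsq {..<k} h" .
  qed
  have cy: "\<phi> y \<in> carrier_mat k k"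
    using nc y yG unfolding nc_function_def graded_def by blast
  have \<phi>Q: "\<phi> Z * Q = Q * \<phi> y"
    by (rule nc_function_intertwine[OF \<delta> nc Z(2,1) yG y Q ZQ])
  have Q_sum: "(\<lambda>r. \<Sum>j<l. t j * q j r) \<in> M" if "l \<le> k" for l t
    using that
  proof (induct l)
    case (Suc l)
    have "(\<lambda>r. (\<Sum>j<l. t j * q j r) + t l * q l r) \<in> M"
      by (rule M_add[OF Suc(1) M_scale[OF qM]]) (use Suc(2) in auto)
    then show ?case by simp
  qed (use M_zero in simp)
  have \<phi>Z: "\<forall>r<N. \<forall>s<N. \<phi> Z $$ (r, s) = (if r mod n = s mod n then \<phi> z $$ (r div n, s div n) else 0)"
  proof -
    have "\<phi> Z * slot n n b = slot n n b * \<phi> z" if "b < n" for b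
      using nc_function_intertwine[OF \<delta> nc Z(2) _ z slot_carrier] amp_slot[OF z(2) that] Z(1)
      by (simp add: Z_def N_def)
    then show ?thesis
      using slot_intertwine_iff[of "\<phi> Z" n n "\<phi> z"] c by (simp add: N_def)
  qed
  define t where "t j = (\<Sum>l<k. \<phi> y $$ (j, l) * ip {..<N} f1 (q l))" for j
  have "(\<Sum>s<N. \<phi> Z $$ (r, s) * f1 s) = (\<Sum>j<k. t j * q j r)" if r: "r < N" for r
  proof -
    have "(\<Sum>s<N. \<phi> Z $$ (r, s) * f1 s) = (\<Sum>s<N. \<Sum>l<k. \<phi> Z $$ (r, s) * Q $$ (s, l) * ip {..<N} f1 (q l))"
      using rep[OF f1M] by (intro sum.cong refl) (simp add: Q_def sum_distrib_left mult_ac)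
    also have "\<dots> = (\<Sum>l<k. (\<phi> Z * Q) $$ (r, l) * ip {..<N} f1 (q l))"
      using r by (subst sum.swap) (simp add: mult_mat_index[OF c(2) Q] sum_distrib_right)
    also have "\<dots> = (\<Sum>l<k. \<Sum>j<k. q j r * (\<phi> y $$ (j, l) * ip {..<N} f1 (q l)))"
      unfolding \<phi>Q using r by (simp add: mult_mat_index[OF Q cy] sum_distrib_right mult.assoc) (simp add: Q_def)
    also have "\<dots> = (\<Sum>j<k. t j * q j r)"
      by (subst sum.swap) (simp add: t_def sum_distrib_left sum_distrib_right mult_ac)
    finally show ?thesis .
  qed
  moreover have "(\<Sum>s<N. \<phi> Z $$ (r, s) * f1 s) = \<phi> z $$ (r div n, r mod n)" if "r < N" for r
    using amp_mult[OF \<phi>Z c(1) f1 that] c(1) unfolding peval_one[OF z(2)] by simp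
  ultimately have "(\<lambda>r. \<phi> z $$ (r div n, r mod n)) \<in> M"
    using Q_sum[of k t] unfolding M_def by auto
  then obtain p where p: "\<forall>r<N. \<phi> z $$ (r div n, r mod n) = peval p z $$ (r div n, r mod n)"
    unfolding M_def by blast
  have "\<phi> z = peval p z"
  proof (rule eq_matI)
    fix a b assume "a < dim_row (peval p z)" "b < dim_col (peval p z)"
    then have ab: "a < n" "b < n" using carrier_matD[OF peval_carrier[OF z(2), of p]] by auto
    then show "\<phi> z $$ (a, b) = peval p z $$ (a, b)"
      using p[rule_format, of "a * n + b"] flat_index[OF ab] by (simp add: N_def)
  qed (use c(1) carrier_matD[OF peval_carrier[OF z(2), of p]] in auto)
  then show ?thesis by blast
qed

section \<open>Necessity\<close>

lemma diag2_inject: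
  assumes "A \<in> carrier_mat n n" "B \<in> carrier_mat m m" "A' \<in> carrier_mat n n" "B' \<in> carrier_mat m m"
    and eq: "diag_block_mat [A, B] = diag_block_mat [A', B']"
  shows "A = A' \<and> B = B'"
proof
  show "A = A'"
  proof (rule eq_matI)
    fix i j assume "i < dim_row A'" "j < dim_col A'"
    then show "A $$ (i, j) = A' $$ (i, j)"
      using diag2_index[OF assms(1,2), of i j] diag2_index[OF assms(3,4), of i j] assms(3)
      unfolding eq by simp
  qed (use assms in auto)
  show "B = B'"
  proof (rule eq_matI)
    fix i j assume "i < dim_row B'" "j < dim_col B'"
    then show "B $$ (i, j) = B' $$ (i, j)"
      using diag2_index[OF assms(1,2), of "n + i" "n + j"] diag2_index[OF assms(3,4), of "n + i" "n + j"] assms(4)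
      unfolding eq by simp
  qed (use assms in auto)
qed

lemma sup_norm_le_1_iff: "sup_norm D \<phi> \<le> 1 \<longleftrightarrow> (\<forall>x\<in>D. mnorm (\<phi> x) \<le> 1)"
  by (simp add: sup_norm_def SUP_le_iff flip: one_ereal_def)

text \<open>
Being an nc-function is only a local requirement; evaluating at \<open>x \<oplus> y\<close> brings both points into one
basic set and yields one polynomial for both.
\<close>

lemma free_holomorphic_polynomial_at_two_points:
  assumes \<delta>: "\<delta> \<in> carrier_mat J J" and \<phi>: "free_holomorphic (G \<delta>) \<phi>"
    and x: "x \<in> G \<delta>" and y: "y \<in> G \<delta>"
  shows "\<exists>p. \<phi> x = peval p x \<and> \<phi> y = peval p y"
proof -
  obtain n where n: "n \<ge> 1" "x \<in> tuples n" using x by (rule G_tuplesE)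
  obtain m where m: "m \<ge> 1" "y \<in> tuples m" using y by (rule G_tuplesE)
  define z where "z = dsum x y"
  have z: "z \<in> tuples (n + m)" "z \<in> G \<delta>"
    using dsum_tuples[OF n(2) m(2)] G_dsum_iff[OF \<delta> n(2,1) m(2,1)] x y by (auto simp: z_def)
  obtain B where B: "basic_free_open B" "z \<in> B" "nc_function B \<phi>"
    using \<phi> z(2) unfolding free_holomorphic_def by blast
  obtain J' \<delta>' where \<delta>': "\<delta>' \<in> carrier_mat J' J'" and B': "B = G \<delta>'"
    using B(1) unfolding basic_free_open_def by blast
  have xy: "x \<in> B" "y \<in> B"
    using B(2) G_dsum_iff[OF \<delta>' n(2,1) m(2,1)] unfolding z_def B' by auto
  obtain p where p: "\<phi> z = peval p z"
    using nc_function_in_algebra[OF \<delta>' B(3)[unfolded B'] B(2)[unfolded B'] z(1)] by blast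
  have "\<phi> z = diag_block_mat [\<phi> x, \<phi> y]"
    using B(2,3) xy unfolding nc_function_def z_def by blast
  moreover have "\<phi> x \<in> carrier_mat n n" "\<phi> y \<in> carrier_mat m m"
    using B(3) xy n m unfolding nc_function_def graded_def by blast+
  ultimately show ?thesis
    using diag2_inject[OF _ _ peval_carrier[OF n(2)] peval_carrier[OF m(2)]] p
    unfolding z_def peval_dsum[OF n(2) m(2)] by metis
qed

lemma interpolation_necessary:
  assumes \<delta>: "\<delta> \<in> carrier_mat J J" and \<Lambda>: "\<Lambda> \<in> G \<delta>"
    and \<phi>: "\<phi> \<in> Hinf (G \<delta>)" "sup_norm (G \<delta>) \<phi> \<le> 1"
  shows "\<phi> \<Lambda> \<in> M_alg \<Lambda>"
    and "peval p \<Lambda> = \<phi> \<Lambda> \<Longrightarrow> sup_norm (V_var \<Lambda> \<inter> G \<delta>) (peval p) \<le> 1"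
proof -
  have hol: "free_holomorphic (G \<delta>) \<phi>"
    using \<phi>(1) by (simp add: Hinf_def)
  show "\<phi> \<Lambda> \<in> M_alg \<Lambda>"
    using free_holomorphic_polynomial_at_two_points[OF \<delta> hol \<Lambda> \<Lambda>] by (auto simp: M_alg_def)
  assume p: "peval p \<Lambda> = \<phi> \<Lambda>"
  show "sup_norm (V_var \<Lambda> \<inter> G \<delta>) (peval p) \<le> 1"
    unfolding sup_norm_le_1_iff
  proof
    fix x assume x: "x \<in> V_var \<Lambda> \<inter> G \<delta>"
    obtain q where "\<phi> \<Lambda> = peval q \<Lambda>" "\<phi> x = peval q x"
      using free_holomorphic_polynomial_at_two_points[OF \<delta> hol \<Lambda>, of x] x by blast
    then have "peval p x = \<phi> x"
      using peval_eq_on_V_var[of p \<Lambda> q x] p x by simp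
    then show "mnorm (peval p x) \<le> 1"
      using \<phi>(2) x by (simp add: sup_norm_le_1_iff)
  qed
qed

section \<open>Transfer functions of contractive colligations\<close>

text \<open>
A colligation \<open>V\<close> is a contraction on \<open>\<complex> \<oplus> (\<complex>\<^sup>m \<otimes> \<complex>\<^sup>J)\<close>: the index \<open>None\<close> is the external channel and
\<open>Some (k, i)\<close> are the internal ones, on which \<open>\<delta>(x)\<close> acts in the coordinate \<open>i\<close> (\<open>dact\<close>). With
coefficient vectors in \<open>\<complex>\<^sup>n\<close>, an input \<open>h\<close> determines a state \<open>f\<close> by the feedback equation
\<open>f = B h + D \<delta>(x) f\<close> (\<open>is_state\<close>), and the output is \<open>A h + C \<delta>(x) f\<close>. The transfer function takes
\<open>h\<close> to this output.
\<close>

locale colligation =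
  fixes \<delta> :: "'d::finite fpoly mat" and J m :: nat
    and V :: "(nat \<times> nat) option \<Rightarrow> (nat \<times> nat) option \<Rightarrow> complex"
  assumes \<delta>: "\<delta> \<in> carrier_mat J J"
    and contraction: "nsq (insert None (Some ` ({..<m} \<times> {..<J}))) (\<lambda>t. \<Sum>s\<in>insert None (Some ` ({..<m} \<times> {..<J})). V t s * \<beta> s)
      \<le> nsq (insert None (Some ` ({..<m} \<times> {..<J}))) \<beta>"
begin

abbreviation T :: "(nat \<times> nat) set" where
  "T \<equiv> {..<m} \<times> {..<J}"

definition dact :: "'d tuple \<Rightarrow> ((nat \<times> nat) \<times> nat \<Rightarrow> complex) \<Rightarrow> (nat \<times> nat) \<times> nat \<Rightarrow> complex" where
  "dact x f = (\<lambda>((k, i), a). pact \<delta> x (\<lambda>(j, b). f ((k, j), b)) (i, a))"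

text \<open>
The signal sent to the channel \<open>t\<close>; \<open>out None\<close> is the external output.
\<close>

definition out :: "(nat \<times> nat) option \<Rightarrow> 'd tuple \<Rightarrow> (nat \<Rightarrow> complex) \<Rightarrow> ((nat \<times> nat) \<times> nat \<Rightarrow> complex) \<Rightarrow> nat \<Rightarrow> complex" where
  "out t x h f a = V t None * h a + (\<Sum>s\<in>T. V t (Some s) * dact x f (s, a))"

definition is_state :: "'d tuple \<Rightarrow> (nat \<Rightarrow> complex) \<Rightarrow> ((nat \<times> nat) \<times> nat \<Rightarrow> complex) \<Rightarrow> bool" where
  "is_state x h f \<longleftrightarrow> (\<forall>t\<in>T. \<forall>a<tsize x. f (t, a) = out (Some t) x h f a)"

definition state :: "'d tuple \<Rightarrow> (nat \<Rightarrow> complex) \<Rightarrow> (nat \<times> nat) \<times> nat \<Rightarrow> complex" where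
  "state x h = (SOME f. is_state x h f)"

definition std_vec :: "nat \<Rightarrow> nat \<Rightarrow> complex" where
  "std_vec b a = (if a = b then 1 else 0)"

definition transfer :: "'d tuple \<Rightarrow> complex mat" where
  "transfer x = mat (tsize x) (tsize x) (\<lambda>(a, b). out None x (std_vec b) (state x (std_vec b)) a)"

lemma dact_sum: "dact x (\<lambda>p. \<Sum>k\<in>K. c k * f k p) q = (\<Sum>k\<in>K. c k * dact x (f k) q)"
proof -
  obtain k i a where q: "q = ((k, i), a)" by (metis surj_pair)
  have "(\<lambda>(j, b). \<Sum>l\<in>K. c l * f l ((k, j), b)) = (\<lambda>p. \<Sum>l\<in>K. c l * (case p of (j, b) \<Rightarrow> f l ((k, j), b)))"
    by auto
  then show ?thesis
    by (simp add: q dact_def pact_sum)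
qed

lemma out_sum: "out t x (\<lambda>a. \<Sum>k\<in>K. c k * h k a) (\<lambda>p. \<Sum>k\<in>K. c k * f k p) a = (\<Sum>k\<in>K. c k * out t x (h k) (f k) a)"
proof -
  have "(\<Sum>s\<in>T. V t (Some s) * (\<Sum>k\<in>K. c k * dact x (f k) (s, a)))
      = (\<Sum>k\<in>K. c k * (\<Sum>s\<in>T. V t (Some s) * dact x (f k) (s, a)))"
    unfolding sum_distrib_left by (subst sum.swap) (simp add: mult.left_commute)
  then show ?thesis
    by (simp add: out_def dact_sum sum_distrib_left ring_distribs sum.distrib mult.left_commute)
qed

lemma dact_cong:
  assumes "\<And>t b. t \<in> T \<Longrightarrow> b < tsize x \<Longrightarrow> f (t, b) = g (t, b)" "s \<in> T"
  shows "dact x f (s, a) = dact x g (s, a)"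
proof -
  obtain k i where s: "s = (k, i)" "k < m" using assms(2) by auto
  have "pact \<delta> x (\<lambda>(j, b). f ((k, j), b)) = pact \<delta> x (\<lambda>(j, b). g ((k, j), b))"
    using assms(1) s \<delta> by (intro pact_cong) auto
  then show ?thesis by (simp add: s dact_def)
qed

lemma out_cong:
  assumes "\<And>t b. t \<in> T \<Longrightarrow> b < tsize x \<Longrightarrow> f (t, b) = g (t, b)" "h a = h' a"
  shows "out t x h f a = out t x h' g a"
proof -
  have "dact x f (s, a) = dact x g (s, a)" if "s \<in> T" for s
    using assms(1) that by (rule dact_cong)
  then show ?thesis
    unfolding out_def assms(2) by (intro arg_cong2[where f = "(+)"] sum.cong refl) auto
qed

lemma is_state_sum:
  assumes "\<And>k. k \<in> K \<Longrightarrow> is_state x (h k) (f k)"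
  shows "is_state x (\<lambda>a. \<Sum>k\<in>K. c k * h k a) (\<lambda>p. \<Sum>k\<in>K. c k * f k p)"
  using assms unfolding is_state_def out_sum by (auto intro!: sum.cong)

text \<open>
The energy balance: \<open>V\<close> does not increase energy at any coordinate \<open>a\<close>, and \<open>\<delta>(x)\<close> strictly decreases
the energy of the state. It gives contractivity of the transfer function, and, for \<open>h = 0\<close>,
uniqueness of the state.
\<close>

lemma energy:
  assumes x: "x \<in> G \<delta>" "x \<in> tuples n" and f: "is_state x h f"
  shows "\<exists>\<rho><1. nsq {..<n} (out None x h f) + nsq (T \<times> {..<n}) f \<le> nsq {..<n} h + \<rho> * nsq (T \<times> {..<n}) f"
proof -
  have n: "n \<ge> 1"
    using x all_tuples_iff by (auto simp: G_def)
  obtain \<rho> where \<rho>: "\<rho> \<ge> 0" "\<rho> < 1"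
    and le: "\<And>v. nsq ({..<J} \<times> {..<n}) (pact \<delta> x v) \<le> \<rho> * nsq ({..<J} \<times> {..<n}) v"
    using x(1) mem_G_iff[OF \<delta> x(2) n] by blast
  have split: "nsq (T \<times> {..<n}) F = (\<Sum>k<m. nsq ({..<J} \<times> {..<n}) (\<lambda>(j, b). F ((k, j), b)))" for F
    unfolding nsq_times by (simp add: sum.cartesian_product split_def)
  have dact_le: "nsq (T \<times> {..<n}) (dact x f) \<le> \<rho> * nsq (T \<times> {..<n}) f"
  proof -
    have "nsq (T \<times> {..<n}) (dact x f) = (\<Sum>k<m. nsq ({..<J} \<times> {..<n}) (pact \<delta> x (\<lambda>(j, b). f ((k, j), b))))"
      unfolding split by (intro sum.cong refl nsq_cong) (auto simp: dact_def)
    also have "\<dots> \<le> (\<Sum>k<m. \<rho> * nsq ({..<J} \<times> {..<n}) (\<lambda>(j, b). f ((k, j), b)))"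
      by (intro sum_mono le)
    finally show ?thesis
      unfolding split sum_distrib_left .
  qed
  let ?I = "insert None (Some ` T)"
  have sum_I: "(\<Sum>s\<in>?I. F s) = F None + (\<Sum>t\<in>T. F (Some t))" for F :: "(nat \<times> nat) option \<Rightarrow> 'b::comm_monoid_add"
    by (subst sum.insert) (auto simp: sum.reindex)
  have nsq_I: "nsq ?I F = (cmod (F None))\<^sup>2 + nsq T (\<lambda>t. F (Some t))" for F
    unfolding nsq_def sum_I ..
  have pointwise: "(cmod (out None x h f a))\<^sup>2 + nsq T (\<lambda>t. f (t, a)) \<le> (cmod (h a))\<^sup>2 + nsq T (\<lambda>t. dact x f (t, a))"
    if a: "a < n" for a
  proof -
    define \<beta> where "\<beta> s = (case s of None \<Rightarrow> h a | Some t \<Rightarrow> dact x f (t, a))" for s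
    have "(\<Sum>s\<in>?I. V t s * \<beta> s) = out t x h f a" for t
      unfolding sum_I by (simp add: \<beta>_def out_def)
    then have "nsq ?I (\<lambda>t. out t x h f a) \<le> nsq ?I \<beta>"
      using contraction[of \<beta>] by simp
    moreover have "nsq T (\<lambda>t. out (Some t) x h f a) = nsq T (\<lambda>t. f (t, a))"
      using f a x(2) unfolding is_state_def by (intro nsq_cong) (metis tsize_eq)
    ultimately show ?thesis
      unfolding nsq_I by (simp add: \<beta>_def)
  qed
  have swap: "nsq (T \<times> {..<n}) F = (\<Sum>a<n. nsq T (\<lambda>t. F (t, a)))" for F
    unfolding nsq_times[of T] unfolding nsq_def by (rule sum.swap)
  have "nsq {..<n} (out None x h f) + nsq (T \<times> {..<n}) f \<le> nsq {..<n} h + nsq (T \<times> {..<n}) (dact x f)"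
    unfolding swap nsq_def[of "{..<n}"] sum.distrib[symmetric] by (intro sum_mono pointwise) simp
  then show ?thesis
    using dact_le \<rho> by (intro exI[of _ \<rho>]) linarith
qed

lemma out_contractive:
  assumes "x \<in> G \<delta>" "x \<in> tuples n" "is_state x h f"
  shows "nsq {..<n} (out None x h f) \<le> nsq {..<n} h"
proof -
  obtain \<rho> where "\<rho> < 1" "nsq {..<n} (out None x h f) + nsq (T \<times> {..<n}) f \<le> nsq {..<n} h + \<rho> * nsq (T \<times> {..<n}) f"
    using energy[OF assms] by blast
  moreover have "\<rho> * nsq (T \<times> {..<n}) f \<le> 1 * nsq (T \<times> {..<n}) f"
    using \<open>\<rho> < 1\<close> by (intro mult_right_mono nsq_nonneg) simp
  ultimately show ?thesis by linarith
qed

lemma state_zero: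
  assumes x: "x \<in> G \<delta>" "x \<in> tuples n" and f: "is_state x (\<lambda>_. 0) f" and t: "t \<in> T" "a < n"
  shows "f (t, a) = 0"
proof -
  obtain \<rho> where \<rho>: "\<rho> < 1" "nsq {..<n} (out None x (\<lambda>_. 0) f) + nsq (T \<times> {..<n}) f \<le> nsq {..<n} (\<lambda>_. 0) + \<rho> * nsq (T \<times> {..<n}) f"
    using energy[OF x f] by blast
  then have "nsq (T \<times> {..<n}) f \<le> \<rho> * nsq (T \<times> {..<n}) f"
    using nsq_nonneg[of "{..<n}" "out None x (\<lambda>_. 0) f"] by (simp add: nsq_def[of "{..<n}" "\<lambda>_. 0"])
  then have "(1 - \<rho>) * nsq (T \<times> {..<n}) f \<le> 0"
    by (simp add: algebra_simps)
  then have "nsq (T \<times> {..<n}) f = 0"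
    using \<rho>(1) nsq_nonneg[of "T \<times> {..<n}" f] by (simp add: mult_le_0_iff)
  then have "\<forall>p\<in>T \<times> {..<n}. f p = 0"
    by (subst (asm) nsq_eq_0) auto
  then show ?thesis using t by blast
qed

lemma state_unique:
  assumes x: "x \<in> G \<delta>" "x \<in> tuples n" and f: "is_state x h f" "is_state x h g" and t: "t \<in> T" "a < n"
  shows "f (t, a) = g (t, a)"
proof -
  have "is_state x (\<lambda>a. \<Sum>k\<in>UNIV. (if k then 1 else - 1) * h a) (\<lambda>p. \<Sum>k\<in>UNIV. (if k then 1 else - 1) * (if k then f else g) p)"
    using f by (intro is_state_sum) auto
  then have "is_state x (\<lambda>_. 0) (\<lambda>p. f p - g p)"
    by (simp add: UNIV_bool)
  from state_zero[OF x this t] show ?thesis by simp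
qed

text \<open>
The feedback equation is a finite linear system which is injective by \<open>state_zero\<close>.
\<close>

lemma state_exists:
  assumes x: "x \<in> G \<delta>" "x \<in> tuples n"
  shows "\<exists>f. is_state x h f"
proof -
  define e where "e q p = (if p = q then 1 else 0 :: complex)" for p q :: "(nat \<times> nat) \<times> nat"
  (* the matrix of the operator D \<delta>(x) in the basis e *)
  define M where "M p q = (\<Sum>s\<in>T. V (Some (fst p)) (Some s) * dact x (e q) (s, snd p))" for p q
  have e_sum: "(\<Sum>q\<in>T \<times> {..<n}. f q * e q p) = f p" if "p \<in> T \<times> {..<n}" for f p
  proof -
    have "(\<Sum>q\<in>T \<times> {..<n}. f q * e q p) = (\<Sum>q\<in>T \<times> {..<n}. if p = q then f q else 0)"
      by (intro sum.cong) (auto simp: e_def)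
    then show ?thesis using that by simp
  qed
  have M: "(\<Sum>q\<in>T \<times> {..<n}. M (t, a) q * f q) = (\<Sum>s\<in>T. V (Some t) (Some s) * dact x f (s, a))" for t a f
  proof -
    have "(\<Sum>q\<in>T \<times> {..<n}. M (t, a) q * f q)
      = (\<Sum>s\<in>T. V (Some t) (Some s) * (\<Sum>q\<in>T \<times> {..<n}. f q * dact x (e q) (s, a)))"
      unfolding M_def sum_distrib_left sum_distrib_right by (subst sum.swap) (simp add: mult_ac)
    also have "\<dots> = (\<Sum>s\<in>T. V (Some t) (Some s) * dact x f (s, a))"
    proof (intro sum.cong refl arg_cong2[where f = "(*)"])
      fix s assume s: "s \<in> T"
      have "(\<Sum>q\<in>T \<times> {..<n}. f q * dact x (e q) (s, a)) = dact x (\<lambda>p. \<Sum>q\<in>T \<times> {..<n}. f q * e q p) (s, a)"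
        by (rule dact_sum[symmetric])
      also have "\<dots> = dact x f (s, a)"
        using x(2) by (intro dact_cong[OF _ s] e_sum) auto
      finally show "(\<Sum>q\<in>T \<times> {..<n}. f q * dact x (e q) (s, a)) = dact x f (s, a)" .
    qed
    finally show ?thesis .
  qed
  have "\<exists>f. \<forall>p\<in>T \<times> {..<n}. f p = (V (Some (fst p)) None * h (snd p)) + (\<Sum>q\<in>T \<times> {..<n}. M p q * f q)"
  proof (rule injective_system_solvable)
    fix u assume u: "\<And>p. p \<in> T \<times> {..<n} \<Longrightarrow> u p = (\<Sum>q\<in>T \<times> {..<n}. M p q * u q)"
    have "is_state x (\<lambda>_. 0) u"
      unfolding is_state_def
    proof (intro ballI allI impI)
      fix t a assume "t \<in> T" "a < tsize x"
      then have "u (t, a) = (\<Sum>q\<in>T \<times> {..<n}. M (t, a) q * u q)"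
        using x(2) by (intro u) simp
      then show "u (t, a) = out (Some t) x (\<lambda>_. 0) u a"
        by (simp only: M out_def mult_zero_right add_0_left)
    qed
    then show "\<forall>p\<in>T \<times> {..<n}. u p = 0"
      using state_zero[OF x] by blast
  qed simp
  then show ?thesis
    using x(2) by (auto simp: is_state_def out_def M)
qed

lemma is_state_state: "x \<in> G \<delta> \<Longrightarrow> x \<in> tuples n \<Longrightarrow> is_state x h (state x h)"
  unfolding state_def by (rule someI_ex[OF state_exists])

lemma transfer_carrier [simp]: "x \<in> tuples n \<Longrightarrow> transfer x \<in> carrier_mat n n"
  by (simp add: transfer_def)

text \<open>
Any state for \<open>h\<close> may be used to compute the output, since states are unique on the relevant indices;
this frees the arguments below from the choice in \<open>state\<close>.
\<close>

lemma transfer_apply: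
  assumes x: "x \<in> G \<delta>" "x \<in> tuples n" and f: "is_state x h f" and a: "a < n"
  shows "(\<Sum>b<n. transfer x $$ (a, b) * h b) = out None x h f a"
proof -
  have std_vec_sum: "(\<Sum>b<n. h b * std_vec b c) = h c" if "c < n" for c
  proof -
    have "(\<Sum>b<n. h b * std_vec b c) = (\<Sum>b<n. if c = b then h b else 0)"
      by (intro sum.cong) (auto simp: std_vec_def)
    then show ?thesis using that by simp
  qed
  let ?g = "\<lambda>p. \<Sum>b<n. h b * state x (std_vec b) p"
  have g': "is_state x (\<lambda>c. \<Sum>b<n. h b * std_vec b c) ?g"
    by (intro is_state_sum is_state_state[OF x])
  have g: "is_state x h ?g"
    unfolding is_state_def
  proof (intro ballI allI impI)
    fix t c assume t: "t \<in> T" and c: "c < tsize x"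
    then have "?g (t, c) = out (Some t) x (\<lambda>c. \<Sum>b<n. h b * std_vec b c) ?g c"
      using g' unfolding is_state_def by blast
    also have "\<dots> = out (Some t) x h ?g c"
      using std_vec_sum c x(2) by (intro out_cong) auto
    finally show "?g (t, c) = out (Some t) x h ?g c" .
  qed
  have "(\<Sum>b<n. transfer x $$ (a, b) * h b) = out None x (\<lambda>c. \<Sum>b<n. h b * std_vec b c) ?g a"
    unfolding out_sum using a x(2) by (simp add: transfer_def mult.commute)
  also have "\<dots> = out None x h f a"
    using state_unique[OF x g f] x(2) std_vec_sum[OF a] by (intro out_cong) auto
  finally show ?thesis .
qed

lemma transfer_contractive:
  assumes x: "x \<in> G \<delta>"
  shows "mnorm (transfer x) \<le> 1"
proof -
  obtain n where n: "x \<in> tuples n" using x by (rule G_tuplesE)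
  have "nsq {..<n} (\<lambda>a. \<Sum>b<n. transfer x $$ (a, b) * h b) \<le> nsq {..<n} h" for h
  proof -
    have "nsq {..<n} (\<lambda>a. \<Sum>b<n. transfer x $$ (a, b) * h b) = nsq {..<n} (out None x h (state x h))"
      using transfer_apply[OF x n is_state_state[OF x n]] by (intro nsq_cong) simp
    then show ?thesis
      using out_contractive[OF x n is_state_state[OF x n]] by simp
  qed
  then show ?thesis
    using mnorm_le_1_iff[OF transfer_carrier[OF n]] by blast
qed

text \<open>
If \<open>g\<close> is the state at \<open>y\<close> for the input \<open>e\<^sub>b\<close>, then \<open>S g\<close> is the state at \<open>x\<close> for the input \<open>S e\<^sub>b\<close>, because
\<open>V\<close> acts on the channels and \<open>S\<close> on the coefficients.
\<close>

lemma transfer_intertwine: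
  assumes x: "x \<in> G \<delta>" "x \<in> tuples n" and y: "y \<in> G \<delta>" "y \<in> tuples l"
    and S: "S \<in> carrier_mat n l" and xS: "\<And>i. x i * S = S * y i"
  shows "transfer x * S = S * transfer y"
proof (rule eq_matI)
  fix a b assume "a < dim_row (S * transfer y)" "b < dim_col (S * transfer y)"
  then have ab: "a < n" "b < l"
    using S carrier_matD[OF transfer_carrier[OF y(2)]] by auto
  define g where "g = state y (std_vec b)"
  have g: "is_state y (std_vec b) g"
    unfolding g_def by (rule is_state_state[OF y])
  have dact_lift: "dact x (lift S g) (s, c) = lift S (dact y g) (s, c)" if "c < n" for s c
  proof -
    obtain k i where s: "s = (k, i)" by fastforce
    have "(\<lambda>(j, b). lift S g ((k, j), b)) = lift S (\<lambda>(j, b). g ((k, j), b))"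
      by (simp add: lift_def)
    then have "dact x (lift S g) (s, c) = lift S (pact \<delta> y (\<lambda>(j, b). g ((k, j), b))) (i, c)"
      unfolding s dact_def using pact_intertwine[OF \<delta> x(2) y(2) S xS that] by simp
    then show ?thesis
      by (simp add: s dact_def lift_def)
  qed
  have S_unit: "(\<Sum>d<l. S $$ (c, d) * std_vec b d) = S $$ (c, b)" for c
  proof -
    have "(\<Sum>d<l. S $$ (c, d) * std_vec b d) = (\<Sum>d<l. if d = b then S $$ (c, d) else 0)"
      by (intro sum.cong) (auto simp: std_vec_def)
    then show ?thesis using ab by simp
  qed
  have out_lift: "out t x (\<lambda>c. S $$ (c, b)) (lift S g) c = (\<Sum>d<l. S $$ (c, d) * out t y (std_vec b) g d)"
    if "c < n" for t c
  proof -
    have "(\<Sum>s\<in>T. V t (Some s) * dact x (lift S g) (s, c)) = (\<Sum>s\<in>T. \<Sum>d<l. S $$ (c, d) * (V t (Some s) * dact y g (s, d)))"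
      using S dact_lift[OF that] by (simp add: lift_def sum_distrib_left mult_ac)
    also have "\<dots> = (\<Sum>d<l. S $$ (c, d) * (\<Sum>s\<in>T. V t (Some s) * dact y g (s, d)))"
      unfolding sum_distrib_left by (rule sum.swap)
    finally show ?thesis
      unfolding out_def by (simp add: ring_distribs sum.distrib S_unit[of c, symmetric] sum_distrib_left mult.left_commute)
  qed
  have state: "is_state x (\<lambda>c. S $$ (c, b)) (lift S g)"
    unfolding is_state_def
  proof (intro ballI allI impI)
    fix t c assume t: "t \<in> T" and "c < tsize x"
    then have c: "c < n" using x(2) by simp
    have "lift S g (t, c) = (\<Sum>d<l. S $$ (c, d) * out (Some t) y (std_vec b) g d)"
    proof -
      have "g (t, d) = out (Some t) y (std_vec b) g d" if "d < l" for d
        using g t y(2) that unfolding is_state_def by (metis tsize_eq)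
      then show ?thesis
        using S by (simp add: lift_def)
    qed
    then show "lift S g (t, c) = out (Some t) x (\<lambda>c. S $$ (c, b)) (lift S g) c"
      by (simp add: out_lift[OF c])
  qed
  have "(transfer x * S) $$ (a, b) = (\<Sum>c<n. transfer x $$ (a, c) * S $$ (c, b))"
    using ab by (simp add: mult_mat_index[OF transfer_carrier[OF x(2)] S])
  also have "\<dots> = (\<Sum>d<l. S $$ (a, d) * out None y (std_vec b) g d)"
    by (simp add: transfer_apply[OF x state ab(1)] out_lift[OF ab(1)])
  also have "\<dots> = (\<Sum>d<l. S $$ (a, d) * transfer y $$ (d, b))"
    using ab y(2) by (intro sum.cong refl) (simp add: transfer_def g_def)
  also have "\<dots> = (S * transfer y) $$ (a, b)"
    using ab by (simp add: mult_mat_index[OF S transfer_carrier[OF y(2)]])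
  finally show "(transfer x * S) $$ (a, b) = (S * transfer y) $$ (a, b)" .
qed (use S carrier_matD[OF transfer_carrier[OF x(2)]] carrier_matD[OF transfer_carrier[OF y(2)]] in auto)

text \<open>
Both axioms are intertwining relations: with the inclusions of the two summands, and with \<open>s'\<close>.
\<close>

lemma transfer_nc: "nc_function (G \<delta>) transfer"
  unfolding nc_function_def
proof (intro conjI allI impI ballI)
  show "graded (G \<delta>) transfer"
    by (simp add: graded_def)
next
  fix x y assume "x \<in> G \<delta> \<and> y \<in> G \<delta> \<and> dsum x y \<in> G \<delta>"
  then have G: "x \<in> G \<delta>" "y \<in> G \<delta>" "dsum x y \<in> G \<delta>" by auto
  obtain n where x: "x \<in> tuples n" using G(1) by (rule G_tuplesE)
  obtain l where y: "y \<in> tuples l" using G(2) by (rule G_tuplesE)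
  note z = dsum_tuples[OF x y]
  show "transfer (dsum x y) = diag_block_mat [transfer x, transfer y]"
  proof (rule diag2_unique)
    show "transfer (dsum x y) * inj_mat (n + l) n id = inj_mat (n + l) n id * transfer x"
      by (rule transfer_intertwine[OF G(3) z G(1) x inj_mat_carrier dsum_inl[OF x y]])
    show "transfer (dsum x y) * inj_mat (n + l) l ((+) n) = inj_mat (n + l) l ((+) n) * transfer y"
      by (rule transfer_intertwine[OF G(3) z G(2) y inj_mat_carrier dsum_inr[OF x y]])
  qed (use x y z in simp_all)
next
  fix n x and s s' :: "complex mat"
  assume s: "s \<in> carrier_mat n n" and s': "s' \<in> carrier_mat n n"
  assume "inverts_mat s s' \<and> inverts_mat s' s \<and> x \<in> G \<delta> \<inter> tuples n \<and> (\<lambda>i. s' * x i * s) \<in> G \<delta> \<inter> tuples n"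
  then have ss': "s * s' = 1\<^sub>m n" and s's: "s' * s = 1\<^sub>m n" and x: "x \<in> G \<delta>" "x \<in> tuples n"
    and x': "(\<lambda>i. s' * x i * s) \<in> G \<delta>" "(\<lambda>i. s' * x i * s) \<in> tuples n"
    using s s' by (auto simp: inverts_mat_def)
  have assoc: "A * B * C = A * (B * C)" if "A \<in> carrier_mat n n" "B \<in> carrier_mat n n" "C \<in> carrier_mat n n" for A B C :: "complex mat"
    using that by (rule assoc_mult_mat)
  have "s' * x i * s * s' = s' * x i" for i
  proof -
    have "x i \<in> carrier_mat n n" using x(2) by (simp add: tuples_def)
    then show ?thesis using s s' ss' by (simp add: assoc)
  qed
  then have "transfer (\<lambda>i. s' * x i * s) * s' = s' * transfer x"
    by (intro transfer_intertwine[OF x' x s'])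
  then have "transfer (\<lambda>i. s' * x i * s) * (s' * s) = s' * transfer x * s"
    using s s' transfer_carrier[OF x'(2)] by (metis assoc)
  then show "transfer (\<lambda>i. s' * x i * s) = s' * transfer x * s"
    using transfer_carrier[OF x'(2)] by (simp add: s's)
qed

end

section \<open>The model cone at a point of a basic free open set\<close>

lemma openin_G: "J \<ge> 1 \<Longrightarrow> \<delta> \<in> carrier_mat J J \<Longrightarrow> openin free_topology (G \<delta>)"
  unfolding free_topology_def by (intro topology_generated_by_Basis) (auto simp: basic_free_open_def)

lemma nc_function_in_Hinf:
  assumes J: "J \<ge> 1" and \<delta>: "\<delta> \<in> carrier_mat J J"
    and nc: "nc_function (G \<delta>) \<phi>" and bdd: "sup_norm (G \<delta>) \<phi> < \<infinity>"
  shows "\<phi> \<in> Hinf (G \<delta>)"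
proof -
  have "basic_free_open (G \<delta>)"
    using J \<delta> by (auto simp: basic_free_open_def)
  then show ?thesis
    using openin_G[OF J \<delta>] nc bdd by (auto simp: Hinf_def free_holomorphic_def)
qed

text \<open>
A point \<open>\<Lambda>\<close> of \<open>G\<^sub>\<delta>\<close> together with a constant \<open>\<rho> < 1\<close> bounding the square of \<open>\<parallel>\<delta>(\<Lambda>)\<parallel>\<close>. Elements of \<open>\<complex>\<^sup>A\<close>
are \<open>n \<times> n\<close> matrices; elements \<open>u\<close> of \<open>\<complex>\<^sup>I\<close> are \<open>J\<close>-tuples of such matrices, with \<open>u ((j, a), b)\<close> the entry
\<open>(a, b)\<close> of the \<open>j\<close>-th matrix \<open>block u j\<close>, and \<open>act\<close> is multiplication by \<open>\<delta>(\<Lambda>)\<close> from the left.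
\<close>

locale strict_point =
  fixes \<delta> :: "'d::finite fpoly mat" and J :: nat and \<Lambda> :: "'d tuple" and n :: nat and \<rho> :: real
  assumes J: "J \<ge> 1" and \<delta>: "\<delta> \<in> carrier_mat J J"
    and n: "n \<ge> 1" and \<Lambda>: "\<Lambda> \<in> tuples n" "\<Lambda> \<in> G \<delta>"
    and \<rho>: "0 \<le> \<rho>" "\<rho> < 1"
    and bound: "nsq ({..<J} \<times> {..<n}) (pact \<delta> \<Lambda> v) \<le> \<rho> * nsq ({..<J} \<times> {..<n}) v"
begin

abbreviation A :: "(nat \<times> nat) set" where "A \<equiv> {..<n} \<times> {..<n}"
abbreviation P :: "(nat \<times> nat) set" where "P \<equiv> {..<J} \<times> {..<n}"
abbreviation I :: "((nat \<times> nat) \<times> nat) set" where "I \<equiv> P \<times> {..<n}"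

definition block :: "((nat \<times> nat) \<times> nat \<Rightarrow> complex) \<Rightarrow> nat \<Rightarrow> nat \<times> nat \<Rightarrow> complex" where
  "block u j = (\<lambda>(a, b). u ((j, a), b))"

definition act :: "((nat \<times> nat) \<times> nat \<Rightarrow> complex) \<Rightarrow> (nat \<times> nat) \<times> nat \<Rightarrow> complex" where
  "act u = (\<lambda>(q, b). pact \<delta> \<Lambda> (\<lambda>p. u (p, b)) q)"

definition kern :: "nat \<times> nat \<Rightarrow> nat \<times> nat \<Rightarrow> complex" where
  "kern q p = peval (\<delta> $$ (fst q, fst p)) \<Lambda> $$ (snd q, snd p)"

text \<open>
The linear map with \<open>u \<otimes> u\<^sup>* \<mapsto> \<Sum>\<^sub>j u\<^sub>j \<otimes> u\<^sub>j\<^sup>* - (\<delta>(\<Lambda>) u)\<^sub>j \<otimes> (\<delta>(\<Lambda>) u)\<^sub>j\<^sup>*\<close>. Its values on positive semidefinite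
forms make up the cone in which the interpolation data have to lie.
\<close>

definition stein :: "(((nat \<times> nat) \<times> nat) \<times> ((nat \<times> nat) \<times> nat) \<Rightarrow> complex) \<Rightarrow> (nat \<times> nat) \<times> (nat \<times> nat) \<Rightarrow> complex" where
  "stein \<Gamma> = (\<lambda>((a, b), (c, d)). \<Sum>j<J. \<Gamma> (((j, a), b), ((j, c), d))
    - (\<Sum>p\<in>P. \<Sum>q\<in>P. kern (j, a) p * \<Gamma> ((p, b), (q, d)) * cnj (kern (j, c) q)))"

lemma act_kern: "act u (q, b) = (\<Sum>p\<in>P. kern q p * u (p, b))"
proof -
  obtain i a where q: "q = (i, a)" by fastforce
  show ?thesis
    unfolding q act_def pact_def kern_def using \<delta> \<Lambda>(1) by (simp add: sum.cartesian_product split_def)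
qed

lemma nsq_block: "(\<Sum>j<J. nsq A (block u j)) = nsq I u"
  by (simp only: nsq_def sum.cartesian_product' block_def prod.case)

lemma nsq_act: "nsq I (act u) \<le> \<rho> * nsq I u"
proof -
  have split: "nsq I f = (\<Sum>b<n. nsq P (\<lambda>p. f (p, b)))" for f
    unfolding nsq_times[of P] unfolding nsq_def by (rule sum.swap)
  have "nsq I (act u) = (\<Sum>b<n. nsq P (pact \<delta> \<Lambda> (\<lambda>p. u (p, b))))"
    unfolding split by (simp add: act_def)
  also have "\<dots> \<le> (\<Sum>b<n. \<rho> * nsq P (\<lambda>p. u (p, b)))"
    by (intro sum_mono bound)
  finally show ?thesis
    unfolding split sum_distrib_left .
qed

lemma stein_gram:
  fixes m :: nat
  assumes \<Gamma>: "\<And>p q. p \<in> I \<Longrightarrow> q \<in> I \<Longrightarrow> \<Gamma> (p, q) = (\<Sum>k<m. v k p * cnj (v k q))"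
    and abcd: "a < n" "b < n" "c < n" "d < n"
  shows "stein \<Gamma> ((a, b), (c, d)) = (\<Sum>k<m. \<Sum>j<J.
    block (v k) j (a, b) * cnj (block (v k) j (c, d)) - block (act (v k)) j (a, b) * cnj (block (act (v k)) j (c, d)))"
proof -
  have "(\<Sum>p\<in>P. \<Sum>q\<in>P. kern (j, a) p * \<Gamma> ((p, b), (q, d)) * cnj (kern (j, c) q))
      = (\<Sum>k<m. act (v k) ((j, a), b) * cnj (act (v k) ((j, c), d)))" if "j < J" for j
  proof -
    have "(\<Sum>p\<in>P. \<Sum>q\<in>P. kern (j, a) p * \<Gamma> ((p, b), (q, d)) * cnj (kern (j, c) q))
      = (\<Sum>p\<in>P. \<Sum>q\<in>P. \<Sum>k<m. kern (j, a) p * v k (p, b) * cnj (kern (j, c) q * v k (q, d)))"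
      using abcd by (intro sum.cong refl) (simp add: \<Gamma> sum_distrib_left sum_distrib_right mult_ac)
    also have "\<dots> = (\<Sum>k<m. \<Sum>p\<in>P. \<Sum>q\<in>P. kern (j, a) p * v k (p, b) * cnj (kern (j, c) q * v k (q, d)))"
    proof -
      have "(\<Sum>p\<in>P. \<Sum>q\<in>P. \<Sum>k<m. kern (j, a) p * v k (p, b) * cnj (kern (j, c) q * v k (q, d)))
        = (\<Sum>p\<in>P. \<Sum>k<m. \<Sum>q\<in>P. kern (j, a) p * v k (p, b) * cnj (kern (j, c) q * v k (q, d)))"
        by (intro sum.cong refl sum.swap)
      then show ?thesis
        using sum.swap by (rule trans)
    qed
    also have "\<dots> = (\<Sum>k<m. act (v k) ((j, a), b) * cnj (act (v k) ((j, c), d)))"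
      unfolding act_kern cnj_sum sum_product ..
    finally show ?thesis .
  qed
  then have "stein \<Gamma> ((a, b), (c, d)) = (\<Sum>j<J. \<Sum>k<m. v k ((j, a), b) * cnj (v k ((j, c), d))
      - act (v k) ((j, a), b) * cnj (act (v k) ((j, c), d)))"
    using abcd by (simp add: stein_def \<Gamma> sum_subtractf)
  then show ?thesis
    unfolding block_def prod.case by (subst sum.swap)
qed

text \<open>
In the Gram identity the terms with a minus sign are moved to the other side. It then says that the
families \<open>X\<^bsub>ab\<^esub> = (1\<^bsub>ab\<^esub>, (\<delta>(\<Lambda>) u)\<^bsub>ab\<^esub>)\<close> and \<open>Y\<^bsub>ab\<^esub> = (W\<^bsub>ab\<^esub>, u\<^bsub>ab\<^esub>)\<close> have the same Gram matrix; the resulting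
contraction is a colligation for which \<open>u\<close> is the state at \<open>\<Lambda>\<close> and \<open>W\<close> is the output.
\<close>

lemma interpolant_of_gram:
  fixes m :: nat
  assumes W: "W \<in> carrier_mat n n"
    and gram: "\<And>a b c d. a < n \<Longrightarrow> b < n \<Longrightarrow> c < n \<Longrightarrow> d < n \<Longrightarrow>
      (if a = b then 1 else 0) * cnj (if c = d then 1 else 0) - W $$ (a, b) * cnj (W $$ (c, d))
      = (\<Sum>k<m. \<Sum>j<J. block (v k) j (a, b) * cnj (block (v k) j (c, d))
          - block (act (v k)) j (a, b) * cnj (block (act (v k)) j (c, d)))"
  shows "\<exists>\<phi>\<in>Hinf (G \<delta>). sup_norm (G \<delta>) \<phi> \<le> 1 \<and> \<phi> \<Lambda> = W"
proof -
  let ?T = "{..<m} \<times> {..<J}"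
  let ?I = "insert None (Some ` ?T)"
  define X :: "nat \<times> nat \<Rightarrow> (nat \<times> nat) option \<Rightarrow> complex" where
    "X = (\<lambda>(a, b) t. case t of None \<Rightarrow> if a = b then 1 else 0 | Some (k, i) \<Rightarrow> act (v k) ((i, a), b))"
  define Y :: "nat \<times> nat \<Rightarrow> (nat \<times> nat) option \<Rightarrow> complex" where
    "Y = (\<lambda>(a, b) t. case t of None \<Rightarrow> W $$ (a, b) | Some (k, i) \<Rightarrow> v k ((i, a), b))"
  have sum_I: "(\<Sum>s\<in>?I. F s) = F None + (\<Sum>k<m. \<Sum>j<J. F (Some (k, j)))"
    for F :: "(nat \<times> nat) option \<Rightarrow> complex"
    by (subst sum.insert) (auto simp: sum.reindex sum.cartesian_product split_def)
  have gramXY: "ip ?I (X r) (X r') = ip ?I (Y r) (Y r')" if "r \<in> A" "r' \<in> A" for r r'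
  proof -
    obtain a b c d where r: "r = (a, b)" "r' = (c, d)" by (metis surj_pair)
    have "a < n" "b < n" "c < n" "d < n" using that r by auto
    from gram[OF this] show ?thesis
      unfolding ip_def sum_I r by (simp add: X_def Y_def block_def sum_subtractf algebra_simps)
  qed
  have fin: "finite A" "finite ?I" by simp_all
  obtain V where
    V: "\<And>r t. r \<in> A \<Longrightarrow> t \<in> ?I \<Longrightarrow> Y r t = (\<Sum>s\<in>?I. V t s * X r s)"
    and contr: "\<And>\<beta>. nsq ?I (\<lambda>t. \<Sum>s\<in>?I. V t s * \<beta> s) \<le> nsq ?I \<beta>"
    by (rule lurking_contraction[OF fin gramXY]) (assumption | rule that)+
  interpret colligation \<delta> J m V
    using \<delta> contr by unfold_locales
  define f where "f b = (\<lambda>((k, j), a). v k ((j, a), b))" for b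
  have dact_f: "dact \<Lambda> (f b) ((k, i), a) = act (v k) ((i, a), b)" for b k i a
    by (simp add: dact_def f_def act_def case_prod_eta[symmetric] split_def)
  have out_f: "out t \<Lambda> (std_vec b) (f b) a = Y (a, b) t" if "a < n" "b < n" "t \<in> ?I" for t a b
  proof -
    have "out t \<Lambda> (std_vec b) (f b) a = V t None * std_vec b a + (\<Sum>k<m. \<Sum>i<J. V t (Some (k, i)) * act (v k) ((i, a), b))"
      unfolding out_def by (simp add: dact_f sum.cartesian_product split_def del: split_paired_All flip: dact_f)
    also have "\<dots> = (\<Sum>s\<in>?I. V t s * X (a, b) s)"
      unfolding sum_I by (simp add: X_def std_vec_def)
    finally show ?thesis
      using V[of "(a, b)" t] that by simp
  qed
  have state: "is_state \<Lambda> (std_vec b) (f b)" if "b < n" for b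
    unfolding is_state_def using that \<Lambda>(1) out_f by (auto simp: Y_def f_def)
  have "transfer \<Lambda> = W"
  proof (rule eq_matI)
    fix a b assume "a < dim_row W" "b < dim_col W"
    then have ab: "a < n" "b < n" using W by auto
    have "(\<Sum>c<n. transfer \<Lambda> $$ (a, c) * std_vec b c) = (\<Sum>c<n. if c = b then transfer \<Lambda> $$ (a, c) else 0)"
      by (intro sum.cong) (auto simp: std_vec_def)
    then have "transfer \<Lambda> $$ (a, b) = out None \<Lambda> (std_vec b) (f b) a"
      using transfer_apply[OF \<Lambda>(2,1) state[OF ab(2)] ab(1)] ab by simp
    also have "\<dots> = W $$ (a, b)"
      using out_f[OF ab, of None] by (simp add: Y_def)
    finally show "transfer \<Lambda> $$ (a, b) = W $$ (a, b)" .
  qed (use W carrier_matD[OF transfer_carrier[OF \<Lambda>(1)]] in auto)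
  moreover have le: "sup_norm (G \<delta>) transfer \<le> 1"
    unfolding sup_norm_le_1_iff using transfer_contractive by blast
  moreover have "sup_norm (G \<delta>) transfer < \<infinity>"
    by (rule order_le_less_trans[OF le]) simp
  then have "transfer \<in> Hinf (G \<delta>)"
    by (rule nc_function_in_Hinf[OF J \<delta> transfer_nc])
  ultimately show ?thesis by blast
qed

text \<open>
The real part of the value of the functional \<open>L\<close> at \<open>w \<otimes> w\<^sup>*\<close>. It is the quadratic form of the
Hermitian part of the conjugate of \<open>L\<close>.
\<close>

definition form :: "((nat \<times> nat) \<times> (nat \<times> nat) \<Rightarrow> complex) \<Rightarrow> (nat \<times> nat \<Rightarrow> complex) \<Rightarrow> real" where
  "form L w = Re (\<Sum>\<alpha>\<in>A \<times> A. cnj (L \<alpha>) * (w (fst \<alpha>) * cnj (w (snd \<alpha>))))"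

text \<open>
Entries outside \<open>I \<times> I\<close> are fixed to be zero, since the compactness argument needs a bound on every
coordinate.
\<close>

definition cone :: "(((nat \<times> nat) \<times> nat) \<times> ((nat \<times> nat) \<times> nat) \<Rightarrow> complex) set" where
  "cone = {\<Gamma>. (\<forall>pq. pq \<notin> I \<times> I \<longrightarrow> \<Gamma> pq = 0) \<and> psd I \<Gamma>}"

lemma cone_closed: "closed cone"
proof -
  have "cone = (\<Inter>pq\<in>- (I \<times> I). {\<Gamma>. \<Gamma> pq = 0}) \<inter>
    (\<Inter>p\<in>I. \<Inter>q\<in>I. {\<Gamma>. \<Gamma> (q, p) = cnj (\<Gamma> (p, q))}) \<inter> (\<Inter>c. {\<Gamma>. 0 \<le> Re (qform I \<Gamma> c)})"
    unfolding cone_def psd_def by blast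
  also have "closed \<dots>"
    unfolding qform_def
    by (intro closed_Int closed_INT ballI closed_Collect_eq closed_Collect_le continuous_intros continuous_on_product_coordinates)
  finally show ?thesis .
qed

lemma cone_hermitian: "\<Gamma> \<in> cone \<Longrightarrow> p \<in> I \<Longrightarrow> q \<in> I \<Longrightarrow> \<Gamma> (q, p) = cnj (\<Gamma> (p, q))"
  unfolding cone_def psd_def by blast

lemma cone_outside: "\<Gamma> \<in> cone \<Longrightarrow> pq \<notin> I \<times> I \<Longrightarrow> \<Gamma> pq = 0"
  unfolding cone_def by blast

lemma rank_one_in_cone: "(\<lambda>(p, q). if p \<in> I \<and> q \<in> I then u p * cnj (u q) else 0) \<in> cone"
proof -
  let ?\<Gamma> = "\<lambda>(p, q). if p \<in> I \<and> q \<in> I then u p * cnj (u q) else 0"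
  have "qform I ?\<Gamma> c = (\<Sum>p\<in>I. c p * u p) * cnj (\<Sum>q\<in>I. c q * u q)" for c
    unfolding qform_def cnj_sum sum_product by (intro sum.cong refl) (simp add: mult_ac)
  then have "0 \<le> Re (qform I ?\<Gamma> c)" for c
    by (simp only: complex_norm_square[symmetric]) simp
  moreover have "?\<Gamma> (q, p) = cnj (?\<Gamma> (p, q))" for p q
    by simp
  moreover have "?\<Gamma> pq = 0" if "pq \<notin> I \<times> I" for pq
    using that by (cases pq) auto
  ultimately show ?thesis
    unfolding cone_def psd_def mem_Collect_eq by blast
qed

lemma cone_gram:
  assumes "\<Gamma> \<in> cone"
  obtains v where "\<And>p q. p \<in> I \<Longrightarrow> q \<in> I \<Longrightarrow> \<Gamma> (p, q) = (\<Sum>k<card I. v k p * cnj (v k q))"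
proof -
  have "finite I" "psd I \<Gamma>"
    using assms unfolding cone_def by simp_all
  from psd_gram[OF this] show ?thesis
    using that by blast
qed

text \<open>
The trace of \<open>\<Gamma>\<close> bounds its entries, and taking the trace of the image of \<open>\<Gamma>\<close> recovers at least
\<open>1 - \<rho>\<close> times the trace of \<open>\<Gamma>\<close>.
\<close>

lemma cone_coercive:
  assumes \<Gamma>: "\<Gamma> \<in> cone"
  shows "cmod (\<Gamma> pq) \<le> 1 / (1 - \<rho>) * (\<Sum>\<alpha>\<in>A \<times> A. cmod (stein \<Gamma> \<alpha>))"
proof (cases "pq \<in> I \<times> I")
  case False
  show ?thesis
  proof -
    have "\<Gamma> pq = 0"
      by (rule cone_outside[OF \<Gamma> False])
    then show ?thesis
      using \<rho> by (simp add: sum_nonneg)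
  qed
next
  case True
  then obtain p q where pq: "pq = (p, q)" "p \<in> I" "q \<in> I" by blast
  obtain v where v: "\<And>p q. p \<in> I \<Longrightarrow> q \<in> I \<Longrightarrow> \<Gamma> (p, q) = (\<Sum>k<card I. v k p * cnj (v k q))"
    by (rule cone_gram[OF \<Gamma>]) (assumption | rule that)+
  have "cmod (\<Gamma> pq) \<le> (\<Sum>k<card I. cmod (v k p) * cmod (v k q))"
    unfolding pq(1) v[OF pq(2,3)] by (rule order.trans[OF norm_sum]) (simp add: norm_mult)
  also have "\<dots> \<le> (\<Sum>k<card I. nsq I (v k))"
    using pq(2,3) by (intro sum_mono nsq_mult_le) auto
  finally have 1: "cmod (\<Gamma> pq) \<le> (\<Sum>k<card I. nsq I (v k))" .
  have "(1 - \<rho>) * (\<Sum>k<card I. nsq I (v k)) \<le> (\<Sum>k<card I. nsq I (v k) - nsq I (act (v k)))"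
    unfolding sum_distrib_left using nsq_act by (intro sum_mono) (simp add: algebra_simps)
  also have "\<dots> = (\<Sum>k<card I. \<Sum>j<J. nsq A (block (v k) j) - nsq A (block (act (v k)) j))"
    by (simp add: nsq_block sum_subtractf)
  also have "\<dots> = Re (\<Sum>\<alpha>\<in>A. stein \<Gamma> (\<alpha>, \<alpha>))"
  proof -
    have diag: "stein \<Gamma> (\<alpha>, \<alpha>) = of_real (\<Sum>k<card I. \<Sum>j<J.
        (cmod (block (v k) j \<alpha>))\<^sup>2 - (cmod (block (act (v k)) j \<alpha>))\<^sup>2)" if \<alpha>: "\<alpha> \<in> A" for \<alpha>
    proof -
      obtain a b where ab: "\<alpha> = (a, b)" "a < n" "b < n"
        using \<alpha> by blast
      show ?thesis
        unfolding ab(1) of_real_sum of_real_diff complex_norm_square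
        by (rule stein_gram, erule (1) v) (rule ab)+
    qed
    have "Re (\<Sum>\<alpha>\<in>A. stein \<Gamma> (\<alpha>, \<alpha>)) = (\<Sum>\<alpha>\<in>A. \<Sum>k<card I. \<Sum>j<J.
        (cmod (block (v k) j \<alpha>))\<^sup>2 - (cmod (block (act (v k)) j \<alpha>))\<^sup>2)"
      unfolding Re_sum by (intro sum.cong refl) (simp only: diag Re_complex_of_real)
    also have "\<dots> = (\<Sum>k<card I. \<Sum>\<alpha>\<in>A. \<Sum>j<J. (cmod (block (v k) j \<alpha>))\<^sup>2 - (cmod (block (act (v k)) j \<alpha>))\<^sup>2)"
      by (rule sum.swap)
    also have "\<dots> = (\<Sum>k<card I. \<Sum>j<J. \<Sum>\<alpha>\<in>A. (cmod (block (v k) j \<alpha>))\<^sup>2 - (cmod (block (act (v k)) j \<alpha>))\<^sup>2)"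
      by (intro sum.cong refl sum.swap)
    finally have "Re (\<Sum>\<alpha>\<in>A. stein \<Gamma> (\<alpha>, \<alpha>)) = \<dots>" .
    moreover have "nsq A f - nsq A g = (\<Sum>\<alpha>\<in>A. (cmod (f \<alpha>))\<^sup>2 - (cmod (g \<alpha>))\<^sup>2)" for f g
      by (simp add: nsq_def sum_subtractf)
    ultimately show ?thesis
      by (simp only:)
  qed
  also have "\<dots> \<le> (\<Sum>\<alpha>\<in>A. cmod (stein \<Gamma> (\<alpha>, \<alpha>)))"
    by (rule order.trans[OF complex_Re_le_cmod norm_sum])
  also have "\<dots> = (\<Sum>\<alpha>\<in>(\<lambda>\<alpha>. (\<alpha>, \<alpha>)) ` A. cmod (stein \<Gamma> \<alpha>))"
    by (subst sum.reindex) (auto simp: inj_on_def)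
  also have "\<dots> \<le> (\<Sum>\<alpha>\<in>A \<times> A. cmod (stein \<Gamma> \<alpha>))"
    by (intro sum_mono2) auto
  finally have "(\<Sum>k<card I. nsq I (v k)) \<le> 1 / (1 - \<rho>) * (\<Sum>\<alpha>\<in>A \<times> A. cmod (stein \<Gamma> \<alpha>))"
    using \<rho> by (simp add: field_simps)
  with 1 show ?thesis by linarith
qed

lemma stein_add: "stein (\<lambda>pq. \<Gamma> pq + \<Delta> pq) \<alpha> = stein \<Gamma> \<alpha> + stein \<Delta> \<alpha>"
  by (simp add: stein_def split_def sum.distrib sum_subtractf ring_distribs)

lemma stein_scale: "stein (\<lambda>pq. t * \<Gamma> pq) \<alpha> = t * stein \<Gamma> \<alpha>"
  by (simp add: stein_def split_def sum_distrib_left right_diff_distrib mult_ac)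

lemma stein_continuous: "continuous_on UNIV (\<lambda>\<Gamma>. stein \<Gamma> \<alpha>)"
  unfolding stein_def split_def by (intro continuous_intros continuous_on_product_coordinates)

lemma qform_add: "qform I (\<lambda>pq. \<Gamma> pq + \<Delta> pq) c = qform I \<Gamma> c + qform I \<Delta> c"
  by (simp add: qform_def ring_distribs sum.distrib)

lemma qform_scale: "qform I (\<lambda>pq. t * \<Gamma> pq) c = t * qform I \<Gamma> c"
  by (simp add: qform_def sum_distrib_left mult_ac)

text \<open>
The hypotheses of \<open>cone_alternative\<close> for the map \<open>stein\<close>; coercivity is the only substantial one.
\<close>

lemma cone_dichotomy:
  "(\<exists>\<Gamma>\<in>cone. \<forall>\<alpha>\<in>A \<times> A. stein \<Gamma> \<alpha> = Q \<alpha>) \<or>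
   (\<exists>L. (\<forall>\<Gamma>\<in>cone. 0 \<le> Re (\<Sum>\<alpha>\<in>A \<times> A. cnj (L \<alpha>) * stein \<Gamma> \<alpha>)) \<and> Re (\<Sum>\<alpha>\<in>A \<times> A. cnj (L \<alpha>) * Q \<alpha>) < 0)"
proof (rule cone_alternative[OF _ cone_closed _ _ _ stein_add stein_scale stein_continuous _ cone_coercive])
  show "finite (A \<times> A)" by simp
  show "(\<lambda>_. 0) \<in> cone"
    by (simp add: cone_def psd_def qform_def)
  show "(\<lambda>pq. \<Gamma> pq + \<Delta> pq) \<in> cone" if "\<Gamma> \<in> cone" "\<Delta> \<in> cone" for \<Gamma> \<Delta>
  proof -
    have "\<Gamma> (q, p) + \<Delta> (q, p) = cnj (\<Gamma> (p, q) + \<Delta> (p, q))" if "p \<in> I" "q \<in> I" for p q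
      using cone_hermitian[OF \<open>\<Gamma> \<in> cone\<close> that] cone_hermitian[OF \<open>\<Delta> \<in> cone\<close> that] by (simp only: complex_cnj_add)
    moreover have "0 \<le> Re (qform I (\<lambda>pq. \<Gamma> pq + \<Delta> pq) c)" for c
      using that unfolding qform_add cone_def psd_def by simp
    moreover have "\<Gamma> pq + \<Delta> pq = 0" if "pq \<notin> I \<times> I" for pq
      using cone_outside[OF \<open>\<Gamma> \<in> cone\<close> that] cone_outside[OF \<open>\<Delta> \<in> cone\<close> that] by (simp only: add_0_left)
    ultimately show ?thesis
      unfolding cone_def psd_def mem_Collect_eq by blast
  qed
  show "(\<lambda>pq. complex_of_real t * \<Gamma> pq) \<in> cone" if "0 \<le> t" "\<Gamma> \<in> cone" for t \<Gamma>
  proof -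
    have "of_real t * \<Gamma> (q, p) = cnj (of_real t * \<Gamma> (p, q))" if "p \<in> I" "q \<in> I" for p q
      using cone_hermitian[OF \<open>\<Gamma> \<in> cone\<close> that] by (simp only: complex_cnj_mult complex_cnj_complex_of_real)
    moreover have "0 \<le> Re (qform I (\<lambda>pq. of_real t * \<Gamma> pq) c)" for c
      using that unfolding qform_scale cone_def psd_def by simp
    moreover have "of_real t * \<Gamma> pq = 0" if "pq \<notin> I \<times> I" for pq
      using cone_outside[OF \<open>\<Gamma> \<in> cone\<close> that] by (simp only: mult_zero_right)
    ultimately show ?thesis
      unfolding cone_def psd_def mem_Collect_eq by blast
  qed
  show "0 \<le> 1 / (1 - \<rho>)" using \<rho> by simp
qed

subsection \<open>Positive functionals on the model cone\<close>

lemma form_bound: "\<bar>form L w\<bar> \<le> (\<Sum>\<alpha>\<in>A \<times> A. cmod (L \<alpha>)) * nsq A w"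
proof -
  have "\<bar>form L w\<bar> \<le> (\<Sum>\<alpha>\<in>A \<times> A. cmod (cnj (L \<alpha>) * (w (fst \<alpha>) * cnj (w (snd \<alpha>)))))"
    unfolding form_def by (rule order.trans[OF abs_Re_le_cmod norm_sum])
  also have "\<dots> \<le> (\<Sum>\<alpha>\<in>A \<times> A. cmod (L \<alpha>) * nsq A w)"
  proof (rule sum_mono)
    fix \<alpha> assume "\<alpha> \<in> A \<times> A"
    then have "cmod (w (fst \<alpha>)) * cmod (w (snd \<alpha>)) \<le> nsq A w"
      by (intro nsq_mult_le) (auto simp: mem_Times_iff)
    then show "cmod (cnj (L \<alpha>) * (w (fst \<alpha>) * cnj (w (snd \<alpha>)))) \<le> cmod (L \<alpha>) * nsq A w"
      by (simp add: norm_mult mult_left_mono)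
  qed
  finally show ?thesis
    by (simp add: sum_distrib_right)
qed

text \<open>
Evaluate the functional at the rank-one element \<open>u \<otimes> u\<^sup>*\<close> of the cone.
\<close>

lemma form_contractive:
  assumes L: "\<And>\<Gamma>. \<Gamma> \<in> cone \<Longrightarrow> 0 \<le> Re (\<Sum>\<alpha>\<in>A \<times> A. cnj (L \<alpha>) * stein \<Gamma> \<alpha>)"
  shows "(\<Sum>j<J. form L (block (act u) j)) \<le> (\<Sum>j<J. form L (block u j))"
proof -
  define \<Gamma> where "\<Gamma> = (\<lambda>(p, q). if p \<in> I \<and> q \<in> I then u p * cnj (u q) else 0)"
  have st: "stein \<Gamma> \<alpha> = (\<Sum>j<J. block u j (fst \<alpha>) * cnj (block u j (snd \<alpha>))
      - block (act u) j (fst \<alpha>) * cnj (block (act u) j (snd \<alpha>)))" if \<alpha>: "\<alpha> \<in> A \<times> A" for \<alpha>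
  proof -
    obtain a b c d where abcd: "\<alpha> = ((a, b), (c, d))" "a < n" "b < n" "c < n" "d < n"
      using \<alpha> by auto
    have "stein \<Gamma> ((a, b), (c, d)) = (\<Sum>k<(1::nat). \<Sum>j<J. block u j (a, b) * cnj (block u j (c, d))
      - block (act u) j (a, b) * cnj (block (act u) j (c, d)))"
      by (rule stein_gram[where v = "\<lambda>_. u"]) (use abcd in \<open>auto simp: \<Gamma>_def\<close>)
    then show ?thesis
      by (simp add: abcd(1))
  qed
  have "(\<Sum>\<alpha>\<in>A \<times> A. cnj (L \<alpha>) * stein \<Gamma> \<alpha>)
      = (\<Sum>\<alpha>\<in>A \<times> A. \<Sum>j<J. cnj (L \<alpha>) * (block u j (fst \<alpha>) * cnj (block u j (snd \<alpha>)))
        - cnj (L \<alpha>) * (block (act u) j (fst \<alpha>) * cnj (block (act u) j (snd \<alpha>))))"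
    by (intro sum.cong refl) (simp only: st sum_distrib_left right_diff_distrib)
  also have "\<dots> = (\<Sum>j<J. \<Sum>\<alpha>\<in>A \<times> A. cnj (L \<alpha>) * (block u j (fst \<alpha>) * cnj (block u j (snd \<alpha>)))
        - cnj (L \<alpha>) * (block (act u) j (fst \<alpha>) * cnj (block (act u) j (snd \<alpha>))))"
    by (rule sum.swap)
  finally have "Re (\<Sum>\<alpha>\<in>A \<times> A. cnj (L \<alpha>) * stein \<Gamma> \<alpha>) = (\<Sum>j<J. form L (block u j) - form L (block (act u) j))"
    by (simp only: Re_sum form_def minus_complex.sel sum_subtractf)
  moreover have "\<Gamma> \<in> cone"
    unfolding \<Gamma>_def by (rule rank_one_in_cone)
  ultimately show ?thesis
    using L[of \<Gamma>] by (simp add: sum_subtractf)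
qed

text \<open>
Put \<open>w\<close> into the first slot of a \<open>J\<close>-tuple. Passing to \<open>\<delta>(\<Lambda>) u\<close> can only lower the value of the form,
while the square of the Hilbert-Schmidt norm drops at least by the factor \<open>\<rho>\<close>. Hence a lower bound \<open>- C \<parallel>w\<parallel>\<^sup>2\<close> improves to
\<open>- C \<rho> \<parallel>w\<parallel>\<^sup>2\<close>, and iteration gives nonnegativity.
\<close>

lemma form_nonneg:
  assumes L: "\<And>\<Gamma>. \<Gamma> \<in> cone \<Longrightarrow> 0 \<le> Re (\<Sum>\<alpha>\<in>A \<times> A. cnj (L \<alpha>) * stein \<Gamma> \<alpha>)"
  shows "0 \<le> form L w"
proof -
  define C where "C = (\<Sum>\<alpha>\<in>A \<times> A. cmod (L \<alpha>))"
  have C: "0 \<le> C"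
    by (simp add: C_def sum_nonneg)
  have step: "- (C * \<rho> ^ k * nsq A w) \<le> form L w" for k w
  proof (induct k arbitrary: w)
    case 0
    show ?case using form_bound[of L w] by (simp add: C_def)
  next
    case (Suc k)
    define u where "u = (\<lambda>((j, a), b). if j = (0::nat) then w (a, b) else 0)"
    have u: "block u j = (if j = 0 then w else (\<lambda>_. 0))" for j
      by (auto simp: block_def u_def)
    have form0: "form L (\<lambda>_. 0) = 0"
      by (simp add: form_def)
    have "(\<Sum>j<J. form L (block u j)) = (\<Sum>j<J. if j = 0 then form L w else 0)"
      using form0 by (intro sum.cong) (auto simp: u)
    then have f: "(\<Sum>j<J. form L (block u j)) = form L w"
      using J by simp
    have "(\<Sum>j<J. nsq A (block u j)) = (\<Sum>j<J. if j = 0 then nsq A w else 0)"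
      by (intro sum.cong) (auto simp: u nsq_def)
    then have nI: "nsq I u = nsq A w"
      unfolding nsq_block using J by simp
    have "C * \<rho> ^ k * nsq I (act u) \<le> C * \<rho> ^ k * (\<rho> * nsq I u)"
      using C \<rho> by (intro mult_left_mono nsq_act) auto
    then have "- (C * \<rho> ^ Suc k * nsq A w) \<le> - (C * \<rho> ^ k * nsq I (act u))"
      by (simp add: nI mult_ac)
    also have "\<dots> = (\<Sum>j<J. - (C * \<rho> ^ k * nsq A (block (act u) j)))"
      by (simp add: nsq_block[symmetric] sum_distrib_left sum_negf)
    also have "\<dots> \<le> (\<Sum>j<J. form L (block (act u) j))"
      by (intro sum_mono Suc)
    also have "\<dots> \<le> (\<Sum>j<J. form L (block u j))"
      by (rule form_contractive[OF L])
    finally show ?case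
      unfolding f .
  qed
  have "(\<lambda>k. - (C * \<rho> ^ k * nsq A w)) \<longlonglongrightarrow> - (C * 0 * nsq A w)"
    using \<rho> by (intro tendsto_intros LIMSEQ_realpow_zero)
  then show ?thesis
    using LIMSEQ_le_const2[of _ _ "form L w"] step by fastforce
qed

text \<open>
The finite-dimensional GNS construction. For \<open>\<epsilon> > 0\<close> the form \<open>fe = L + \<epsilon> \<parallel>\<cdot>\<parallel>\<^sup>2\<close> is positive definite; a
Gram factorisation writes it as \<open>fe(w) = \<parallel>S w\<parallel>\<^sup>2\<close> with \<open>S\<close> invertible. Conjugating the ampliation
\<open>\<Lambda> \<otimes> 1\<close> (left multiplication by \<open>\<Lambda>\<close> on matrices) by \<open>S\<close> gives a tuple \<open>x\<close> of size \<open>n\<^sup>2\<close> that lies in both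
\<open>V\<^sub>\<Lambda>\<close> and \<open>G\<^sub>\<delta>\<close>. Since \<open>p(x) S 1 = S p(\<Lambda>)\<close>, the hypothesis \<open>\<parallel>p(x)\<parallel> \<le> 1\<close> compares the values of \<open>fe\<close> at
\<open>p(\<Lambda>)\<close> and at \<open>1\<close>; finally \<open>\<epsilon>\<close> tends to zero.
\<close>

lemma form_monotone:
  assumes L: "\<And>\<Gamma>. \<Gamma> \<in> cone \<Longrightarrow> 0 \<le> Re (\<Sum>\<alpha>\<in>A \<times> A. cnj (L \<alpha>) * stein \<Gamma> \<alpha>)"
    and sup: "\<And>x. x \<in> V_var \<Lambda> \<inter> G \<delta> \<Longrightarrow> mnorm (peval p x) \<le> 1"
  shows "form L (\<lambda>(a, b). peval p \<Lambda> $$ (a, b)) \<le> form L (\<lambda>(a, b). if a = b then 1 else 0)"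
proof -
  let ?W = "\<lambda>(a, b). peval p \<Lambda> $$ (a, b)" and ?E = "\<lambda>(a, b). if a = b then 1 else 0 :: complex"
  have main: "form L ?W + \<epsilon> * nsq A ?W \<le> form L ?E + \<epsilon> * nsq A ?E" if \<epsilon>: "\<epsilon> > 0" for \<epsilon>
  proof -
    define fe where "fe w = form L w + \<epsilon> * nsq A w" for w
    (* the Hermitian part of the conjugate of L, shifted by \<epsilon> *)
    define H where "H = (\<lambda>(\<alpha>, \<beta>). (cnj (L (\<alpha>, \<beta>)) + L (\<beta>, \<alpha>)) / 2 + (if \<alpha> = \<beta> then complex_of_real \<epsilon> else 0))"
    have qH: "Re (qform A H w) = fe w" for w
    proof -
      define S1 where "S1 = (\<Sum>\<alpha>\<in>A. \<Sum>\<beta>\<in>A. cnj (L (\<alpha>, \<beta>)) * (w \<alpha> * cnj (w \<beta>)))"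
      have c: "cnj S1 = (\<Sum>\<alpha>\<in>A. \<Sum>\<beta>\<in>A. L (\<beta>, \<alpha>) * (w \<alpha> * cnj (w \<beta>)))"
        unfolding S1_def cnj_sum by (subst sum.swap) (simp add: mult.commute)
      have d: "of_real (\<epsilon> * nsq A w) = (\<Sum>\<alpha>\<in>A. \<Sum>\<beta>\<in>A. (if \<alpha> = \<beta> then complex_of_real \<epsilon> else 0) * (w \<alpha> * cnj (w \<beta>)))"
      proof -
        have "(\<Sum>\<beta>\<in>A. (if \<alpha> = \<beta> then complex_of_real \<epsilon> else 0) * (w \<alpha> * cnj (w \<beta>))) = of_real \<epsilon> * (w \<alpha> * cnj (w \<alpha>))"
          if \<alpha>: "\<alpha> \<in> A" for \<alpha>
        proof -
          have "(\<Sum>\<beta>\<in>A. (if \<alpha> = \<beta> then complex_of_real \<epsilon> else 0) * (w \<alpha> * cnj (w \<beta>)))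
            = (\<Sum>\<beta>\<in>A. if \<alpha> = \<beta> then of_real \<epsilon> * (w \<alpha> * cnj (w \<beta>)) else 0)"
            by (intro sum.cong) auto
          also have "\<dots> = of_real \<epsilon> * (w \<alpha> * cnj (w \<alpha>))"
            using \<alpha> by (simp only: sum.delta'[OF finite_cartesian_product[OF finite_lessThan finite_lessThan]] if_True)
          finally show ?thesis .
        qed
        then show ?thesis
          unfolding nsq_def of_real_mult of_real_sum complex_norm_square sum_distrib_left
          by (intro sum.cong refl) simp
      qed
      have "qform A H w = (\<Sum>\<alpha>\<in>A. \<Sum>\<beta>\<in>A. cnj (L (\<alpha>, \<beta>)) * (w \<alpha> * cnj (w \<beta>)) / 2
          + L (\<beta>, \<alpha>) * (w \<alpha> * cnj (w \<beta>)) / 2 + (if \<alpha> = \<beta> then complex_of_real \<epsilon> else 0) * (w \<alpha> * cnj (w \<beta>)))"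
        unfolding qform_def H_def prod.case by (intro sum.cong refl) (simp only: ring_distribs add_divide_distrib times_divide_eq_left times_divide_eq_right mult_ac)
      also have "\<dots> = S1 / 2 + cnj S1 / 2 + of_real (\<epsilon> * nsq A w)"
        unfolding c d by (simp only: S1_def sum.distrib sum_divide_distrib)
      finally have "Re (qform A H w) = Re S1 + \<epsilon> * nsq A w"
        by simp
      moreover have "form L w = Re S1"
        unfolding form_def S1_def sum.cartesian_product'[of _ A A] by simp
      ultimately show ?thesis
        by (simp add: fe_def)
    qed
    have fe_ge: "\<epsilon> * nsq A w \<le> fe w" for w
      using form_nonneg[OF L] by (simp add: fe_def)
    have fe_nonneg: "0 \<le> fe w" for w
      using fe_ge[of w] \<epsilon> nsq_nonneg[of A w] by (meson less_imp_le mult_nonneg_nonneg order.trans)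
    have "psd A H"
      unfolding psd_def
    proof (intro conjI ballI allI)
      fix \<alpha> \<beta>
      show "H (\<beta>, \<alpha>) = cnj (H (\<alpha>, \<beta>))"
        by (auto simp: H_def add.commute)
    next
      fix w show "0 \<le> Re (qform A H w)"
        unfolding qH by (rule fe_nonneg)
    qed
    define N where "N = n * n"
    have "card A = N" by (simp add: N_def)
    then obtain v where v: "\<And>\<alpha> \<beta>. \<alpha> \<in> A \<Longrightarrow> \<beta> \<in> A \<Longrightarrow> H (\<alpha>, \<beta>) = (\<Sum>k<N. v k \<alpha> * cnj (v k \<beta>))"
      using psd_gram[OF _ \<open>psd A H\<close>] by auto
    have fe_gram: "nsq {..<N} (\<lambda>k. \<Sum>\<alpha>\<in>A. v k \<alpha> * w \<alpha>) = fe w" for w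
    proof -
      have "qform A H w = (\<Sum>\<alpha>\<in>A. \<Sum>\<beta>\<in>A. \<Sum>k<N. (v k \<alpha> * w \<alpha>) * cnj (v k \<beta> * w \<beta>))"
        unfolding qform_def by (intro sum.cong refl) (simp add: v sum_distrib_left sum_distrib_right mult_ac)
      also have "\<dots> = (\<Sum>\<alpha>\<in>A. \<Sum>k<N. \<Sum>\<beta>\<in>A. (v k \<alpha> * w \<alpha>) * cnj (v k \<beta> * w \<beta>))"
        by (intro sum.cong refl sum.swap)
      also have "\<dots> = (\<Sum>k<N. \<Sum>\<alpha>\<in>A. \<Sum>\<beta>\<in>A. (v k \<alpha> * w \<alpha>) * cnj (v k \<beta> * w \<beta>))"
        by (rule sum.swap)
      also have "\<dots> = of_real (nsq {..<N} (\<lambda>k. \<Sum>\<alpha>\<in>A. v k \<alpha> * w \<alpha>))"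
        unfolding nsq_def of_real_sum complex_norm_square cnj_sum sum_product ..
      finally show ?thesis
        using qH[of w] by simp
    qed
    (* the Gram factor as a matrix; the index s = a * n + b stands for the matrix entry (a, b) *)
    define S where "S = mat N N (\<lambda>(k, s). v k (s div n, s mod n))"
    have S: "S \<in> carrier_mat N N" by (simp add: S_def)
    have S_fe: "nsq {..<N} (\<lambda>k. \<Sum>s<N. S $$ (k, s) * g s) = fe (\<lambda>(a, b). g (a * n + b))" for g
    proof -
      have "(\<Sum>s<N. S $$ (k, s) * g s) = (\<Sum>\<alpha>\<in>A. v k \<alpha> * (case \<alpha> of (a, b) \<Rightarrow> g (a * n + b)))" if "k < N" for k
        unfolding N_def sum_flatten sum.cartesian_product'[of _ "{..<n}" "{..<n}"]
        using that by (intro sum.cong refl) (simp add: S_def N_def flat_index)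
      then show ?thesis
        unfolding fe_gram[symmetric] by (intro nsq_cong) simp
    qed
    obtain S' where S': "S' \<in> carrier_mat N N" "S * S' = 1\<^sub>m N" "S' * S = 1\<^sub>m N"
    proof (rule injective_mat_inverse[OF S])
      fix g :: "complex Matrix.vec" assume g: "g \<in> carrier_vec N" "S *\<^sub>v g = 0\<^sub>v N"
      have "nsq {..<N} (\<lambda>k. \<Sum>s<N. S $$ (k, s) * g $ s) = nsq {..<N} (\<lambda>k. (S *\<^sub>v g) $ k)"
        using mult_vec_index[OF S g(1)] by (intro nsq_cong) simp
      also have "\<dots> = 0"
        using g(2) by (simp add: nsq_def)
      finally have "\<epsilon> * nsq A (\<lambda>(a, b). g $ (a * n + b)) \<le> 0"
        using fe_ge[of "\<lambda>(a, b). g $ (a * n + b)"] unfolding S_fe by simp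
      then have "nsq A (\<lambda>(a, b). g $ (a * n + b)) = 0"
        using \<epsilon> nsq_nonneg[of A "\<lambda>(a, b). g $ (a * n + b)"] by (simp add: mult_le_0_iff)
      then have z: "g $ (a * n + b) = 0" if "a < n" "b < n" for a b
        using that by (subst (asm) nsq_eq_0) auto
      show "g = 0\<^sub>v N"
      proof (rule eq_vecI)
        fix s assume "s < dim_vec (0\<^sub>v N :: complex Matrix.vec)"
        then show "g $ s = 0\<^sub>v N $ s"
          using z[of "s div n" "s mod n"] flat_index_div[of s n n] flat_index_mod[of s n n] by (simp add: N_def)
      qed (use g in simp)
    qed blast
    define Z where "Z = amp n \<Lambda>"
    have Z: "Z \<in> tuples N" "\<And>i. Z i \<in> carrier_mat N N"
      using amp_tuples[OF \<Lambda>(1), of n] by (auto simp: Z_def N_def tuples_def)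
    define x where "x i = S * Z i * S'" for i
    have x: "x \<in> tuples N"
      using S S' Z by (auto simp: tuples_def x_def)
    have xS: "x i * S = S * Z i" for i
    proof -
      have "x i * S = S * Z i * (S' * S)"
        unfolding x_def by (rule assoc_mult_mat[of _ N N _ N _ N]) (use S S' Z in auto)
      then show ?thesis
        unfolding S'(3) using S Z(2)[of i] by simp
    qed
    have N1: "N \<ge> 1" using n by (simp add: N_def)
    (* x is similar to an ampliation of \<Lambda>, so every polynomial vanishing at \<Lambda> vanishes at x *)
    have xV: "x \<in> V_var \<Lambda>"
      unfolding V_var_def
    proof (intro CollectI conjI ballI)
      show "x \<in> all_tuples" using all_tuples_iff[OF x] N1 by simp
      fix q assume "q \<in> I_ideal \<Lambda>"
      then have q: "peval q \<Lambda> = 0\<^sub>m n n"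
        using \<Lambda>(1) by (simp add: I_ideal_def)
      have qZ: "peval q Z = 0\<^sub>m N N"
      proof (rule eq_matI)
        fix r s assume "r < dim_row (0\<^sub>m N N :: complex mat)" "s < dim_col (0\<^sub>m N N :: complex mat)"
        then have rs: "r < n * n" "s < n * n" by (simp_all add: N_def)
        show "peval q Z $$ (r, s) = 0\<^sub>m N N $$ (r, s)"
          unfolding Z_def peval_amp[OF \<Lambda>(1) rs] q
          using rs flat_index_div[OF rs(1)] flat_index_div[OF rs(2)] by (simp add: N_def)
      qed (use carrier_matD[OF peval_carrier[OF Z(1), of q]] in auto)
      have "peval q x * S = 0\<^sub>m N N"
        unfolding peval_intertwine[OF x Z(1) S xS] qZ using S by simp
      then have "peval q x * (S * S') = 0\<^sub>m N N"
        using left_mult_zero_mat[OF S'(1), of N]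
        unfolding assoc_mult_mat[OF peval_carrier[OF x] S S'(1), symmetric] by simp
      then show "peval q x = 0\<^sub>m (tsize x) (tsize x)"
        unfolding S'(2) using x peval_carrier[OF x, of q] by simp
    qed
    have xG: "x \<in> G \<delta>"
    proof -
      define C where "C = (\<Sum>\<alpha>\<in>A \<times> A. cmod (L \<alpha>)) + \<epsilon>"
      have C: "C \<ge> \<epsilon>" "C > 0"
        using \<epsilon> by (simp_all add: C_def sum_nonneg add_nonneg_pos)
      have fe_le: "fe w \<le> C * nsq A w" for w
        using form_bound[of L w] by (simp add: fe_def C_def distrib_right)
      (* the gain \<epsilon> (1 - \<rho>) in the square of the Hilbert-Schmidt norm, measured relative to fe, which is
         at most C times that square *)
      define \<kappa> where "\<kappa> = \<epsilon> * (1 - \<rho>) / C"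
      have \<kappa>: "0 < \<kappa>" "\<kappa> \<le> 1"
      proof -
        show "0 < \<kappa>" using \<epsilon> C \<rho> by (simp add: \<kappa>_def)
        have "\<epsilon> * (1 - \<rho>) \<le> C * 1" using \<epsilon> C \<rho> by (intro mult_mono) auto
        then show "\<kappa> \<le> 1" using C by (simp add: \<kappa>_def)
      qed
      have fe_act: "(\<Sum>j<J. fe (block (act u) j)) \<le> (1 - \<kappa>) * (\<Sum>j<J. fe (block u j))" for u
      proof -
        have sum_fe: "(\<Sum>j<J. fe (block u j)) = (\<Sum>j<J. form L (block u j)) + \<epsilon> * nsq I u" for u
          by (simp add: fe_def sum.distrib nsq_block[symmetric] sum_distrib_left)
        have "(\<Sum>j<J. fe (block u j)) \<le> (\<Sum>j<J. C * nsq A (block u j))"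
          by (intro sum_mono fe_le)
        then have "(\<Sum>j<J. fe (block u j)) \<le> C * nsq I u"
          by (simp add: nsq_block[symmetric] sum_distrib_left)
        then have "\<kappa> * (\<Sum>j<J. fe (block u j)) \<le> \<kappa> * (C * nsq I u)"
          using \<kappa> by (intro mult_left_mono) auto
        also have "\<dots> = \<epsilon> * (1 - \<rho>) * nsq I u"
          using C by (simp add: \<kappa>_def)
        finally have 1: "\<kappa> * (\<Sum>j<J. fe (block u j)) \<le> \<epsilon> * (1 - \<rho>) * nsq I u" .
        have "\<epsilon> * nsq I (act u) \<le> \<epsilon> * (\<rho> * nsq I u)"
          using \<epsilon> by (intro mult_left_mono nsq_act) auto
        then have "(\<Sum>j<J. fe (block (act u) j)) \<le> (\<Sum>j<J. fe (block u j)) - \<epsilon> * (1 - \<rho>) * nsq I u"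
          unfolding sum_fe using form_contractive[OF L, of u] by (simp add: algebra_simps)
        then show ?thesis
          using 1 by (simp add: algebra_simps)
      qed
      have lift_fe: "nsq ({..<J} \<times> {..<N}) (lift S w) = (\<Sum>j<J. fe (block (\<lambda>((j, a), b). w (j, a * n + b)) j))" for w
        unfolding nsq_times using S by (simp add: lift_def S_fe block_def)
      have "nsq ({..<J} \<times> {..<N}) (pact \<delta> x g) \<le> (1 - \<kappa>) * nsq ({..<J} \<times> {..<N}) g" for g
      proof -
        define w where "w = lift S' g"
        have g: "lift S w (j, a) = g (j, a)" if "a < N" for j a
        proof -
          have "lift S w (j, a) = (\<Sum>c<N. \<Sum>d<N. S $$ (a, c) * S' $$ (c, d) * g (j, d))"
            using S S' by (simp add: w_def lift_def sum_distrib_left mult.assoc)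
          also have "\<dots> = (\<Sum>d<N. (S * S') $$ (a, d) * g (j, d))"
            using that by (subst sum.swap) (simp add: mult_mat_index[OF S S'(1)] sum_distrib_right)
          also have "\<dots> = (\<Sum>d<N. if a = d then g (j, d) else 0)"
            unfolding S'(2) using that by (intro sum.cong) auto
          finally show ?thesis using that by simp
        qed
        define u where "u = (\<lambda>((j, a), b). w (j, a * n + b))"
        have "nsq ({..<J} \<times> {..<N}) (pact \<delta> x g) = nsq ({..<J} \<times> {..<N}) (pact \<delta> x (lift S w))"
          using \<delta> x g by (intro arg_cong[where f = "nsq _"] pact_cong) simp
        also have "\<dots> = nsq ({..<J} \<times> {..<N}) (lift S (pact \<delta> Z w))"
          using pact_intertwine[OF \<delta> x Z(1) S xS] by (intro nsq_cong) auto
        also have "\<dots> = (\<Sum>j<J. fe (block (act u) j))"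
          unfolding lift_fe fe_gram[symmetric]
          by (intro sum.cong refl nsq_cong) (auto simp: block_def Z_def pact_amp[OF \<Lambda>(1)] act_def u_def split_def)
        also have "\<dots> \<le> (1 - \<kappa>) * (\<Sum>j<J. fe (block u j))"
          by (rule fe_act)
        also have "(\<Sum>j<J. fe (block u j)) = nsq ({..<J} \<times> {..<N}) (lift S w)"
          unfolding lift_fe u_def ..
        also have "\<dots> = nsq ({..<J} \<times> {..<N}) g"
          using g by (intro nsq_cong) auto
        finally show ?thesis .
      qed
      then show ?thesis
        using \<kappa> by (subst mem_G_iff[OF \<delta> x N1]) (intro exI[of _ "1 - \<kappa>"], simp)
    qed
    have "mnorm (peval p x) \<le> 1"
      using sup xV xG by blast
    then have le: "nsq {..<N} (\<lambda>a. \<Sum>b<N. peval p x $$ (a, b) * h b) \<le> nsq {..<N} h" for h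
      using mnorm_le_1_iff[OF peval_carrier[OF x]] by blast
    (* the identity matrix, flattened; h is its image in the Hilbert space of fe *)
    define e :: "nat \<Rightarrow> complex" where "e s = (if s div n = s mod n then 1 else 0)" for s
    define h where "h k = (\<Sum>s<N. S $$ (k, s) * e s)" for k
    have e_flat: "e (a * n + b) = (if a = b then 1 else 0)" if "b < n" for a b
      using that by (simp add: e_def)
    have fe_cong: "fe w = fe w'" if "\<And>a b. a < n \<Longrightarrow> b < n \<Longrightarrow> w (a, b) = w' (a, b)" for w w'
      unfolding fe_gram[symmetric] using that by (intro nsq_cong sum.cong refl) auto
    have "fe ?W = nsq {..<N} (\<lambda>k. \<Sum>s<N. S $$ (k, s) * (\<Sum>t<N. peval p Z $$ (s, t) * e t))"
      unfolding S_fe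
    proof (rule fe_cong)
      fix a b assume ab: "a < n" "b < n"
      have "(\<Sum>t<N. peval p Z $$ (a * n + b, t) * e t)
        = (\<Sum>t<n * n. if (a * n + b) mod n = t mod n then peval p \<Lambda> $$ (a, t div n) * e t else 0)"
        unfolding N_def Z_def using ab flat_index[OF ab] by (intro sum.cong refl) (simp add: peval_amp[OF \<Lambda>(1)])
      also have "\<dots> = (\<Sum>c<n. peval p \<Lambda> $$ (a, c) * e (c * n + b))"
        unfolding sum_same_residue[OF ab] using ab by simp
      also have "\<dots> = (\<Sum>c<n. if c = b then peval p \<Lambda> $$ (a, c) else 0)"
        using ab by (intro sum.cong) (auto simp: e_flat)
      finally show "?W (a, b) = (case (a, b) of (a, b) \<Rightarrow> \<Sum>t<N. peval p Z $$ (a * n + b, t) * e t)"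
        using ab by simp
    qed
    also have "\<dots> = nsq {..<N} (\<lambda>k. \<Sum>b<N. peval p x $$ (k, b) * h b)"
    proof (rule nsq_cong)
      fix k assume "k \<in> {..<N}"
      then have k: "k < N" by simp
      have "(\<Sum>s<N. S $$ (k, s) * (\<Sum>t<N. peval p Z $$ (s, t) * e t)) = (\<Sum>t<N. (S * peval p Z) $$ (k, t) * e t)"
        unfolding mult_mat_index[OF S peval_carrier[OF Z(1)] k] sum_distrib_left sum_distrib_right
        using k by (subst sum.swap) (simp add: mult_mat_index[OF S peval_carrier[OF Z(1)] k] sum_distrib_right mult.assoc)
      also have "\<dots> = (\<Sum>t<N. (peval p x * S) $$ (k, t) * e t)"
        by (simp only: peval_intertwine[OF x Z(1) S xS])
      also have "\<dots> = (\<Sum>t<N. \<Sum>b<N. peval p x $$ (k, b) * (S $$ (b, t) * e t))"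
        by (intro sum.cong refl) (simp add: mult_mat_index[OF peval_carrier[OF x] S k] sum_distrib_right mult.assoc)
      also have "\<dots> = (\<Sum>b<N. peval p x $$ (k, b) * h b)"
        unfolding h_def sum_distrib_left by (rule sum.swap)
      finally show "(\<Sum>s<N. S $$ (k, s) * (\<Sum>t<N. peval p Z $$ (s, t) * e t)) = (\<Sum>b<N. peval p x $$ (k, b) * h b)" .
    qed
    also have "\<dots> \<le> nsq {..<N} h"
      by (rule le)
    also have "\<dots> = fe (\<lambda>(a, b). e (a * n + b))"
      unfolding h_def by (rule S_fe)
    also have "\<dots> = fe ?E"
      by (rule fe_cong) (simp add: e_flat)
    finally show ?thesis
      by (simp add: fe_def)
  qed
  show ?thesis
    using main by (rule le_of_perturbed_le)
qed

text \<open>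
A separating functional would contradict \<open>form_monotone\<close>, so the data lie in the cone, and a Gram
factorisation of the preimage provides the families needed by \<open>interpolant_of_gram\<close>.
\<close>

lemma interpolation_sufficient:
  assumes sup: "\<And>x. x \<in> V_var \<Lambda> \<inter> G \<delta> \<Longrightarrow> mnorm (peval p x) \<le> 1"
  shows "\<exists>\<phi>\<in>Hinf (G \<delta>). sup_norm (G \<delta>) \<phi> \<le> 1 \<and> \<phi> \<Lambda> = peval p \<Lambda>"
proof -
  let ?W = "\<lambda>(a, b). peval p \<Lambda> $$ (a, b)" and ?E = "\<lambda>(a, b). if a = b then 1 else 0 :: complex"
  define Q where "Q \<alpha> = ?E (fst \<alpha>) * cnj (?E (snd \<alpha>)) - ?W (fst \<alpha>) * cnj (?W (snd \<alpha>))" for \<alpha>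
  have Q_form: "Re (\<Sum>\<alpha>\<in>A \<times> A. cnj (L \<alpha>) * Q \<alpha>) = form L ?E - form L ?W" for L
    by (simp only: Q_def form_def right_diff_distrib sum_subtractf minus_complex.sel)
  have "\<not> (\<exists>L. (\<forall>\<Gamma>\<in>cone. 0 \<le> Re (\<Sum>\<alpha>\<in>A \<times> A. cnj (L \<alpha>) * stein \<Gamma> \<alpha>)) \<and> Re (\<Sum>\<alpha>\<in>A \<times> A. cnj (L \<alpha>) * Q \<alpha>) < 0)"
  proof
    assume "\<exists>L. (\<forall>\<Gamma>\<in>cone. 0 \<le> Re (\<Sum>\<alpha>\<in>A \<times> A. cnj (L \<alpha>) * stein \<Gamma> \<alpha>)) \<and> Re (\<Sum>\<alpha>\<in>A \<times> A. cnj (L \<alpha>) * Q \<alpha>) < 0"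
    then obtain L where L: "\<And>\<Gamma>. \<Gamma> \<in> cone \<Longrightarrow> 0 \<le> Re (\<Sum>\<alpha>\<in>A \<times> A. cnj (L \<alpha>) * stein \<Gamma> \<alpha>)"
      and neg: "form L ?E - form L ?W < 0"
      unfolding Q_form by blast
    have "form L ?W \<le> form L ?E"
      by (rule form_monotone[OF L sup])
    then show False
      using neg by simp
  qed
  then obtain \<Gamma> where \<Gamma>: "\<Gamma> \<in> cone" "\<And>\<alpha>. \<alpha> \<in> A \<times> A \<Longrightarrow> stein \<Gamma> \<alpha> = Q \<alpha>"
    using cone_dichotomy[of Q] by blast
  obtain v where v: "\<And>p q. p \<in> I \<Longrightarrow> q \<in> I \<Longrightarrow> \<Gamma> (p, q) = (\<Sum>k<card I. v k p * cnj (v k q))"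
    by (rule cone_gram[OF \<Gamma>(1)]) (assumption | rule that)+
  show ?thesis
  proof (rule interpolant_of_gram[OF peval_carrier[OF \<Lambda>(1)]])
    fix a b c d assume abcd: "a < n" "b < n" "c < n" "d < n"
    have "stein \<Gamma> ((a, b), (c, d)) = (\<Sum>k<card I. \<Sum>j<J. block (v k) j (a, b) * cnj (block (v k) j (c, d))
      - block (act (v k)) j (a, b) * cnj (block (act (v k)) j (c, d)))"
      by (rule stein_gram, erule (1) v) (rule abcd)+
    moreover have "stein \<Gamma> ((a, b), (c, d)) = Q ((a, b), (c, d))"
      using abcd by (intro \<Gamma>(2)) simp
    ultimately show "(if a = b then 1 else 0) * cnj (if c = d then 1 else 0) - peval p \<Lambda> $$ (a, b) * cnj (peval p \<Lambda> $$ (c, d))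
      = (\<Sum>k<card I. \<Sum>j<J. block (v k) j (a, b) * cnj (block (v k) j (c, d))
      - block (act (v k)) j (a, b) * cnj (block (act (v k)) j (c, d)))"
      by (simp only: Q_def fst_conv snd_conv prod.case)
  qed
qed

end

section \<open>The interpolation theorem\<close>

theorem theorem1p3:
  fixes \<delta> :: "'d::finite fpoly mat" and \<Lambda> :: "'d tuple" and W :: "complex mat"
    and J n :: nat
  assumes "J \<ge> 1" and "\<delta> \<in> carrier_mat J J"
    and "\<Lambda> \<in> G \<delta> \<inter> tuples n"
    and "W \<in> carrier_mat n n"
  shows "(\<exists>\<phi> \<in> Hinf (G \<delta>). sup_norm (G \<delta>) \<phi> \<le> 1 \<and> \<phi> \<Lambda> = W) \<longleftrightarrow>
    W \<in> M_alg \<Lambda> \<and>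
    (\<forall>p\<^sub>0. peval p\<^sub>0 \<Lambda> = W \<longrightarrow> sup_norm (V_var \<Lambda> \<inter> G \<delta>) (peval p\<^sub>0) \<le> 1)"
proof
  assume "\<exists>\<phi> \<in> Hinf (G \<delta>). sup_norm (G \<delta>) \<phi> \<le> 1 \<and> \<phi> \<Lambda> = W"
  then obtain \<phi> where \<phi>: "\<phi> \<in> Hinf (G \<delta>)" "sup_norm (G \<delta>) \<phi> \<le> 1" "\<phi> \<Lambda> = W"
    by blast
  have \<Lambda>: "\<Lambda> \<in> G \<delta>"
    using assms(3) by blast
  show "W \<in> M_alg \<Lambda> \<and>
    (\<forall>p\<^sub>0. peval p\<^sub>0 \<Lambda> = W \<longrightarrow> sup_norm (V_var \<Lambda> \<inter> G \<delta>) (peval p\<^sub>0) \<le> 1)"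
    using interpolation_necessary[OF assms(2) \<Lambda> \<phi>(1,2)] unfolding \<phi>(3) by blast
next
  assume R: "W \<in> M_alg \<Lambda> \<and>
    (\<forall>p\<^sub>0. peval p\<^sub>0 \<Lambda> = W \<longrightarrow> sup_norm (V_var \<Lambda> \<inter> G \<delta>) (peval p\<^sub>0) \<le> 1)"
  then obtain p where p: "peval p \<Lambda> = W"
    by (auto simp: M_alg_def)
  have \<Lambda>: "\<Lambda> \<in> tuples n" "\<Lambda> \<in> G \<delta>"
    using assms(3) by auto
  then have n: "n \<ge> 1"
    using all_tuples_iff by (auto simp: G_def)
  obtain \<rho> where \<rho>: "0 \<le> \<rho>" "\<rho> < 1"
    "\<And>v. nsq ({..<J} \<times> {..<n}) (pact \<delta> \<Lambda> v) \<le> \<rho> * nsq ({..<J} \<times> {..<n}) v"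
    using mem_G_iff[OF assms(2) \<Lambda>(1) n] \<Lambda>(2) by blast
  interpret strict_point \<delta> J \<Lambda> n \<rho>
    using assms(1,2) n \<Lambda> \<rho> by unfold_locales
  have "mnorm (peval p x) \<le> 1" if "x \<in> V_var \<Lambda> \<inter> G \<delta>" for x
    using R p that by (simp add: sup_norm_le_1_iff)
  from interpolation_sufficient[OF this] show "\<exists>\<phi> \<in> Hinf (G \<delta>). sup_norm (G \<delta>) \<phi> \<le> 1 \<and> \<phi> \<Lambda> = W"
    unfolding p .
qed

end
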